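(* Let $N\ge2$ and assume that $(V,K)\in\mathcal K$ (defined in the context). If $(VK_2)$ holds, then $E_V$ is compactly embedded in $L^r_K(\mathbb{R}^N)$ for all $r\in(1,1^* )$. If $(VK_3)$ holds, then $E_V$ is compactly embedded in $L^q_K(\mathbb{R}^N)$, where $q$ is the exponent given in $(VK_3)$.
   Context: Let $1^*=\frac{N}{N-1}$. For (measurable) $V,K:\mathbb{R}^N\to\mathbb{R}$, $(V,K)\in\mathcal K$ means that $(VK_0)$ and $(VK_1)$ hold and that at least one of $(VK_2)$, $(VK_3)$ holds: - $(VK_0)$ $V(x),K(x)>0$ for all $x\in\mathbb{R}^N$, and $K\in C^0(\mathbb{R}^N)\cap L^\infty(\mathbb{R}^N)$. - $(VK_1)$ If $(A_n)$ is a sequence of Borel subsets of $\mathbb{R}^N$ with Lebesgue measure $|A_n|\le R$ for all $n$ and some $R>0$, then $\lim_{r\to+\infty}\int_{A_n\cap B_r(0)^c}K(x)\,dx=0$ uniformly in $n\in\mathbb{N}$. - $(VK_2)$ $K/V\in L^\infty(\mathbb{R}^N)$. - $(VK_3)$ There exists $q\in(1,1^* )$ such that $\frac{K(x)}{V(x)^{\frac{1^*-q}{1^*-1}}}\to0$ as $|x|\to+\infty$. $E$ is the space of $u\in L^{1^*}(\mathbb{R}^N)$ whose distributional derivative $Du$ is a finite vector Radon measure, equivalently $$\int_{\mathbb{R}^N}|Du|:=\sup\Big\{\int_{\mathbb{R}^N}u\,\operatorname{div}\phi\,dx:\ \phi\in C^1_c(\mathbb{R}^N,\mathbb{R}^N),\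 |\phi|_\infty\le1\Big\}<+\infty .$$ $E_V=\{u\in E:\int_{\mathbb{R}^N}V(x)|u|\,dx<\infty\}$, with norm $\|u\|=\int_{\mathbb{R}^N}|Du|+\int_{\mathbb{R}^N}V(x)|u|\,dx$. For $s\in(1,1^* )$, $L^s_K(\mathbb{R}^N)$ is the weighted space of measurable $u:\mathbb{R}^N\to\mathbb{R}$ with $\int_{\mathbb{R}^N}K(x)|u|^s\,dx<+\infty$, with norm $|u|_{s,K}=\left(\int_{\mathbb{R}^N}K(x)|u|^s\,dx\right)^{1/s}$. *)

theory Defs
  imports "HOL-Analysis.Analysis"
begin

text \<open>
  The ambient space is \<open>real ^ 'n\<close>, so \<open>N = CARD('n)\<close>. Measurability and integrals refer to
  Lebesgue measure \<open>lebesgue\<close>. Elements of the function spaces below are functions rather than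
  classes modulo equality almost everywhere, so that the norms are formally seminorms; all of them
  vanish exactly on the functions that are zero almost everywhere.
\<close>

definition critical_exponent :: "nat \<Rightarrow> real" where
  "critical_exponent N = real N / (real N - 1)"

definition ess_bounded :: "(real ^ 'n::finite \<Rightarrow> real) \<Rightarrow> bool" where
  "ess_bounded f \<longleftrightarrow> f \<in> borel_measurable lebesgue \<and> (\<exists>C. AE x in lebesgue. \<bar>f x\<bar> \<le> C)"


subsection \<open>The class of admissible pairs of potentials\<close>

definition VK0 :: "(real ^ 'n::finite \<Rightarrow> real) \<Rightarrow> (real ^ 'n \<Rightarrow> real) \<Rightarrow> bool" where
  "VK0 V K \<longleftrightarrow> (\<forall>x. V x > 0 \<and> K x > 0) \<and> continuous_on UNIV K \<and> ess_bounded K"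

text \<open>
  The set integrals are genuine under \<open>VK0\<close>: there \<open>K\<close> is bounded, and each \<open>A n\<close> has
  finite measure.
\<close>

definition VK1 :: "(real ^ 'n::finite \<Rightarrow> real) \<Rightarrow> bool" where
  "VK1 K \<longleftrightarrow>
    (\<forall>(A :: nat \<Rightarrow> (real ^ 'n) set) R.
       (\<forall>n. A n \<in> sets borel) \<and> R > 0 \<and> (\<forall>n. emeasure lebesgue (A n) \<le> ennreal R) \<longrightarrow>
       uniform_limit UNIV (\<lambda>r n. LINT x : A n \<inter> - ball 0 r | lebesgue. K x) (\<lambda>n. 0) at_top)"

definition VK2 :: "(real ^ 'n::finite \<Rightarrow> real) \<Rightarrow> (real ^ 'n \<Rightarrow> real) \<Rightarrow> bool" where
  "VK2 V K \<longleftrightarrow> ess_bounded (\<lambda>x. K x / V x)"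

text \<open>The exponent is a parameter, since it occurs in the conclusion drawn from this condition.\<close>

definition VK3 :: "(real ^ 'n::finite \<Rightarrow> real) \<Rightarrow> (real ^ 'n \<Rightarrow> real) \<Rightarrow> real \<Rightarrow> bool" where
  "VK3 V K q \<longleftrightarrow>
     1 < q \<and> q < critical_exponent CARD('n) \<and>
     ((\<lambda>x. K x / V x powr ((critical_exponent CARD('n) - q) / (critical_exponent CARD('n) - 1)))
        \<longlongrightarrow> 0) at_infinity"

definition VK_class ::
    "((real ^ 'n::finite \<Rightarrow> real) \<times> (real ^ 'n \<Rightarrow> real)) set" where
  "VK_class = {(V, K). V \<in> borel_measurable lebesgue \<and> K \<in> borel_measurable lebesgue \<and>
     VK0 V K \<and> VK1 K \<and> (VK2 V K \<or> (\<exists>q. VK3 V K q))}"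


subsection \<open>Functions of bounded variation and the weighted spaces\<close>

definition divergence :: "(real ^ 'n::finite \<Rightarrow> real ^ 'n) \<Rightarrow> real ^ 'n \<Rightarrow> real" where
  "divergence \<phi> x = (\<Sum>i\<in>UNIV. frechet_derivative \<phi> (at x) (axis i 1) $ i)"

definition C1c_fields :: "(real ^ 'n::finite \<Rightarrow> real ^ 'n) set" where
  "C1c_fields = {\<phi>. (\<forall>x. \<phi> differentiable (at x)) \<and>
     (\<forall>v. continuous_on UNIV (\<lambda>x. frechet_derivative \<phi> (at x) v)) \<and>
     compact (closure {x. \<phi> x \<noteq> 0})}"

definition total_variation :: "(real ^ 'n::finite \<Rightarrow> real) \<Rightarrow> ereal" where
  "total_variation u =
     (SUP \<phi> \<in> {\<phi> \<in> C1c_fields. \<forall>x. norm (\<phi> x) \<le> 1}.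
        ereal (LINT x | lebesgue. u x * divergence \<phi> x))"

definition E_space :: "(real ^ 'n::finite \<Rightarrow> real) set" where
  "E_space = {u. u \<in> borel_measurable lebesgue \<and>
     integrable lebesgue (\<lambda>x. \<bar>u x\<bar> powr critical_exponent CARD('n)) \<and>
     total_variation u < \<infinity>}"

definition EV_space :: "(real ^ 'n::finite \<Rightarrow> real) \<Rightarrow> (real ^ 'n \<Rightarrow> real) set" where
  "EV_space V = {u \<in> E_space. integrable lebesgue (\<lambda>x. V x * \<bar>u x\<bar>)}"

definition EV_norm :: "(real ^ 'n::finite \<Rightarrow> real) \<Rightarrow> (real ^ 'n \<Rightarrow> real) \<Rightarrow> real" where
  "EV_norm V u = real_of_ereal (total_variation u) + (LINT x | lebesgue. V x * \<bar>u x\<bar>)"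

definition LK_space :: "(real ^ 'n::finite \<Rightarrow> real) \<Rightarrow> real \<Rightarrow> (real ^ 'n \<Rightarrow> real) set" where
  "LK_space K s = {u. u \<in> borel_measurable lebesgue \<and>
     integrable lebesgue (\<lambda>x. K x * \<bar>u x\<bar> powr s)}"

definition LK_norm :: "(real ^ 'n::finite \<Rightarrow> real) \<Rightarrow> real \<Rightarrow> (real ^ 'n \<Rightarrow> real) \<Rightarrow> real" where
  "LK_norm K s u = (LINT x | lebesgue. K x * \<bar>u x\<bar> powr s) powr (1 / s)"


subsection \<open>Compact embeddings\<close>

text \<open>
  The inclusion of \<open>X\<close> in \<open>Y\<close> is continuous and maps bounded sequences to sequences with a
  subsequence converging in \<open>Y\<close>. As the norms are only seminorms on functions, the kernel
  condition says that the inclusion is injective on the quotients; that it is well defined there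
  follows from the norm bound.
\<close>

definition compactly_embedded ::
    "('a \<Rightarrow> real) set \<Rightarrow> (('a \<Rightarrow> real) \<Rightarrow> real) \<Rightarrow> ('a \<Rightarrow> real) set \<Rightarrow> (('a \<Rightarrow> real) \<Rightarrow> real) \<Rightarrow> bool" where
  "compactly_embedded X normX Y normY \<longleftrightarrow>
     X \<subseteq> Y \<and>
     (\<forall>u\<in>X. normY u = 0 \<longrightarrow> normX u = 0) \<and>
     (\<exists>C. \<forall>u\<in>X. normY u \<le> C * normX u) \<and>
     (\<forall>u :: nat \<Rightarrow> 'a \<Rightarrow> real.
        (\<forall>n. u n \<in> X) \<and> (\<exists>M. \<forall>n. normX (u n) \<le> M) \<longrightarrow>
        (\<exists>l\<in>Y. \<exists>\<sigma> :: nat \<Rightarrow> nat. strict_mono \<sigma> \<and>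
           (\<lambda>k. normY (\<lambda>x. u (\<sigma> k) x - l x)) \<longlonglongrightarrow> 0))"

end

theory Submission
  imports Defs "HOL-Complex_Analysis.Great_Picard"
begin

text \<open>
  The variation of \<open>u\<close> enters only through the translation bound
  \<open>\<integral>\<bar>u(x + h) - u(x)\<bar> dx \<le> M \<bar>h\<bar>\<close> with \<open>M = \<integral>\<bar>Du\<bar>\<close>, obtained by testing with fields that are
  averages of a scalar test function along \<open>h\<close>.

  The bound gives the Sobolev inequality with the critical exponent \<open>p\<close>. Let \<open>a(t)\<close> be the measure
  of \<open>{\<bar>u\<bar> > t}\<close>. In a ball whose volume is at least twice \<open>a(t)\<close>, \<open>\<bar>u\<bar> \<le> t\<close> holds on at least half
  of the ball, so comparing \<open>u\<close> on \<open>{\<bar>u\<bar> > 2t}\<close> with its translates bounds \<open>t a(2t)\<close> by the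
  translation bound of the truncation of \<open>\<bar>u\<bar>\<close> to \<open>[t, 2t]\<close>. At a single level this yields the weak
  estimate \<open>t\<^sup>p a(t) \<le> C M\<^sup>p\<close>. The increments of the truncations at dyadic levels add up to at most
  the increment of \<open>\<bar>u\<bar>\<close>, so summing over the levels upgrades the weak estimate to the strong one.

  The bound also makes averages over balls of radius \<open>\<rho>\<close> equi-Lipschitz and \<open>M \<rho>\<close>-close to \<open>u\<close> in
  mean, so bounded sequences have subsequences that are Cauchy in mean on every ball. Finally,
  \<open>(VK\<^sub>1)\<close> with \<open>(VK\<^sub>2)\<close>, or \<open>(VK\<^sub>3)\<close>, bounds \<open>\<integral> K \<bar>w\<bar>\<^sup>r\<close> by an arbitrarily small quantity plus a
  multiple of the integral of \<open>\<bar>w\<bar>\<close> over a ball. Applied to differences, this gives Cauchy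
  sequences in the weighted space.
\<close>

subsection \<open>Translation bounds and the Sobolev inequality\<close>

text \<open>The obstacle in the summation over levels is that the radius suited to a level depends
  on the measure of its own level set, whereas the increments of the truncations add up to the
  increment of |u| only for one common shift. Every radius is therefore rounded up to a multiple of
  one small step, a shift by m steps costs at most m single shifts, and the rounding error
  disappears as the step tends to 0. The weak estimate is self-improving: if B is the supremum of
  t^p a(t), comparing levels t and 2t bounds B by a multiple of M B^(1/N). Absorbing B^(1/N)
  requires B to be finite, whence the integrability of |u|^p assumed in the inequality; nonzero
  constants satisfy the translation bound with M = 0, so the bound alone cannot control u.
  Translation bounds pass to absolute values and add under differences, with no approximation of u.
  Smoothness matters only for the test functions, where polynomials times a C^1 cutoff
  suffice.\<close>

definition shift_bounded :: "real \<Rightarrow> ('a::euclidean_space \<Rightarrow> real) \<Rightarrow> bool" where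
  "shift_bounded M u \<longleftrightarrow> u \<in> borel_measurable borel \<and> 0 \<le> M \<and>
     (\<forall>h. (\<integral>\<^sup>+x. ennreal \<bar>u (x + h) - u x\<bar> \<partial>lborel) \<le> ennreal (M * norm h))"

lemma nn_integral_lborel_shift:
  fixes f :: "'a::euclidean_space \<Rightarrow> ennreal"
  assumes [measurable]: "f \<in> borel_measurable borel"
  shows "(\<integral>\<^sup>+x. f (x + h) \<partial>lborel) = (\<integral>\<^sup>+x. f x \<partial>lborel)"
proof -
  have "(\<integral>\<^sup>+x. f x \<partial>lborel) = (\<integral>\<^sup>+x. f x \<partial>distr lborel borel ((+) h))"
    by (simp only: lborel_distr_plus)
  also have "\<dots> = (\<integral>\<^sup>+x. f (h + x) \<partial>lborel)"
    by (rule nn_integral_distr) auto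
  finally show ?thesis by (simp only: add.commute)
qed

lemma nn_integral_lborel_affine:
  fixes f :: "'a::euclidean_space \<Rightarrow> ennreal"
  assumes [measurable]: "f \<in> borel_measurable borel" and c: "c > 0"
  shows "(\<integral>\<^sup>+x. f x \<partial>lborel) = ennreal (c ^ DIM('a)) * (\<integral>\<^sup>+z. f (x + c *\<^sub>R z) \<partial>lborel)"
proof -
  have "(\<integral>\<^sup>+x. f x \<partial>lborel) =
      (\<integral>\<^sup>+z. f z \<partial>density (distr lborel borel (\<lambda>z. x + c *\<^sub>R z)) (\<lambda>_. \<bar>c\<bar>^DIM('a)))"
    using c by (subst lborel_affine[of c x]) auto
  also have "\<dots> = ennreal (c ^ DIM('a)) * (\<integral>\<^sup>+z. f (x + c *\<^sub>R z) \<partial>lborel)"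
    using c by (subst nn_integral_density) (auto simp: nn_integral_distr nn_integral_cmult)
  finally show ?thesis .
qed

lemma emeasure_lborel_ball_eq: "emeasure lborel (ball (x::'a::euclidean_space) r) = ennreal (measure lborel (ball x r))"
  using emeasure_lborel_ball_finite[of x r] by (intro emeasure_eq_ennreal_measure) auto

text \<open>The shifts \<rho> z with z in the unit ball have length at most \<rho>. This averaged
  form is what remains, after exchanging integrals, both in the summation over levels and in the
  comparison of a function with its ball averages.\<close>

lemma shift_bounded_avg:
  fixes u :: "'a::euclidean_space \<Rightarrow> real"
  assumes "shift_bounded M u" "0 \<le> \<rho>"
  shows "(\<integral>\<^sup>+z. indicator (ball 0 1) z * (\<integral>\<^sup>+x. ennreal \<bar>u (x + \<rho> *\<^sub>R z) - u x\<bar> \<partial>lborel) \<partial>lborel)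
     \<le> ennreal (M * \<rho> * measure lborel (ball (0::'a) 1))"
proof -
  have M: "0 \<le> M" using assms by (simp add: shift_bounded_def)
  have "(\<integral>\<^sup>+z. indicator (ball 0 1) z * (\<integral>\<^sup>+x. ennreal \<bar>u (x + \<rho> *\<^sub>R z) - u x\<bar> \<partial>lborel) \<partial>lborel)
      \<le> (\<integral>\<^sup>+z. ennreal (M * \<rho>) * indicator (ball (0::'a) 1) z \<partial>lborel)"
  proof (intro nn_integral_mono)
    fix z :: 'a
    have "M * norm (\<rho> *\<^sub>R z) \<le> M * \<rho>" if "norm z \<le> 1"
      using that assms(2) M by (simp add: mult_left_le mult_left_mono)
    then have "(\<integral>\<^sup>+x. ennreal \<bar>u (x + \<rho> *\<^sub>R z) - u x\<bar> \<partial>lborel) \<le> ennreal (M * \<rho>)" if "norm z \<le> 1"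
      using assms(1) that unfolding shift_bounded_def
      by (meson ennreal_leI order_trans)
    then show "indicator (ball 0 1) z * (\<integral>\<^sup>+x. ennreal \<bar>u (x + \<rho> *\<^sub>R z) - u x\<bar> \<partial>lborel)
       \<le> ennreal (M * \<rho>) * indicator (ball 0 1) z"
      by (auto simp: indicator_def)
  qed
  also have "\<dots> = ennreal (M * \<rho>) * emeasure lborel (ball (0::'a) 1)"
    by (simp add: nn_integral_cmult_indicator)
  also have "\<dots> = ennreal (M * \<rho> * measure lborel (ball (0::'a) 1))"
    using assms(2) M by (simp add: emeasure_lborel_ball_eq ennreal_mult)
  finally show ?thesis .
qed

lemma ball_measure_pos: "0 < measure lborel (ball (0::'a::euclidean_space) 1)"
  by (simp add: content_ball_pos)


lemma measurable_shift_diff [measurable]: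
  fixes w :: "'a::euclidean_space \<Rightarrow> real"
  assumes [measurable]: "w \<in> borel_measurable borel"
  shows "(\<lambda>p. w (fst p + \<rho> *\<^sub>R snd p) - w (fst p)) \<in> borel_measurable (lborel \<Otimes>\<^sub>M lborel)"
proof -
  have [measurable]: "(\<lambda>p::'a \<times> 'a. fst p + \<rho> *\<^sub>R snd p) \<in> lborel \<Otimes>\<^sub>M lborel \<rightarrow>\<^sub>M borel"
    unfolding lborel_prod by (auto intro!: borel_measurable_continuous_onI continuous_intros)
  show ?thesis by measurable
qed

lemma nn_integral_shift_swap:
  fixes w :: "'a::euclidean_space \<Rightarrow> real"
  assumes [measurable]: "w \<in> borel_measurable borel" "A \<in> sets borel" "B \<in> sets borel"
  shows "(\<integral>\<^sup>+x. indicator A x * (\<integral>\<^sup>+z. indicator B z * ennreal \<bar>w (x + \<rho> *\<^sub>R z) - w x\<bar> \<partial>lborel) \<partial>lborel)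
    = (\<integral>\<^sup>+z. indicator B z * (\<integral>\<^sup>+x. indicator A x * ennreal \<bar>w (x + \<rho> *\<^sub>R z) - w x\<bar> \<partial>lborel) \<partial>lborel)"
proof -
  have m: "(\<lambda>(x, z). indicator A x * (indicator B z * ennreal \<bar>w (x + \<rho> *\<^sub>R z) - w x\<bar>)) \<in> borel_measurable (lborel \<Otimes>\<^sub>M lborel)"
    unfolding case_prod_beta by measurable
  have "(\<integral>\<^sup>+x. indicator A x * (\<integral>\<^sup>+z. indicator B z * ennreal \<bar>w (x + \<rho> *\<^sub>R z) - w x\<bar> \<partial>lborel) \<partial>lborel)
     = (\<integral>\<^sup>+x. (\<integral>\<^sup>+z. indicator A x * (indicator B z * ennreal \<bar>w (x + \<rho> *\<^sub>R z) - w x\<bar>) \<partial>lborel) \<partial>lborel)"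
    by (intro nn_integral_cong nn_integral_cmult[symmetric]) measurable
  also have "\<dots> = (\<integral>\<^sup>+z. (\<integral>\<^sup>+x. indicator A x * (indicator B z * ennreal \<bar>w (x + \<rho> *\<^sub>R z) - w x\<bar>) \<partial>lborel) \<partial>lborel)"
    by (rule lborel_pair.Fubini'[symmetric]) (rule m)
  also have "\<dots> = (\<integral>\<^sup>+z. indicator B z * (\<integral>\<^sup>+x. indicator A x * ennreal \<bar>w (x + \<rho> *\<^sub>R z) - w x\<bar> \<partial>lborel) \<partial>lborel)"
    unfolding mult.left_commute[of "indicator A _"]
    by (intro nn_integral_cong nn_integral_cmult) measurable
  finally show ?thesis .
qed

section \<open>Dyadic truncations and their increments\<close>

definition trunc :: "real \<Rightarrow> real \<Rightarrow> real" where
  "trunc t s = min (max (s - t) 0) t"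

lemma trunc_measurable [measurable]: "trunc t \<in> borel_measurable borel"
  unfolding trunc_def by measurable

lemma trunc_mono: "s \<le> s' \<Longrightarrow> trunc t s \<le> trunc t s'"
  unfolding trunc_def by auto

text \<open>\<open>trunc t\<close> keeps the part of a value between t and 2t, lowered to the range
  from 0 to t. The bands from 2^k \<theta> to 2^(k+1) \<theta> are adjacent, so the pieces stack up
  to one truncation between \<theta> and 2^n \<theta>.\<close>

lemma sum_trunc: 
  assumes "0 < \<theta>" shows "(\<Sum>k<n. trunc (2^k * \<theta>) s) = min (max (s - \<theta>) 0) (2^n * \<theta> - \<theta>)"
proof (induction n)
  case (Suc n)
  have "1 \<le> (2::real)^n" by simp
  then have "\<theta> \<le> 2^n * \<theta>" using assms by simp
  moreover define A where "A = 2^n * \<theta>"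
  ultimately have "\<theta> \<le> A" "0 < A" using assms by auto
  moreover have *: "2 ^ Suc n * \<theta> = 2 * A" by (simp add: A_def)
  ultimately show ?case
    unfolding sum.lessThan_Suc Suc.IH * unfolding trunc_def A_def[symmetric]
    by (auto simp: min_def max_def)
qed simp

text \<open>All truncations are nondecreasing, so their increments between two values share a sign;
  the sum of absolute values is then the increment of the stacked truncation, which is
  1-Lipschitz.\<close>

lemma sum_trunc_diff:
  assumes "0 < \<theta>" shows "(\<Sum>k<n. \<bar>trunc (2^k * \<theta>) s - trunc (2^k * \<theta>) s'\<bar>) \<le> \<bar>s - s'\<bar>"
proof -
  have *: "(\<Sum>k<n. \<bar>trunc (2^k * \<theta>) s - trunc (2^k * \<theta>) s'\<bar>) \<le> s - s'" if "s' \<le> s" for s s'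
  proof -
    have "(\<Sum>k<n. \<bar>trunc (2^k * \<theta>) s - trunc (2^k * \<theta>) s'\<bar>) = (\<Sum>k<n. trunc (2^k * \<theta>) s - trunc (2^k * \<theta>) s')"
      using trunc_mono[OF that] by (intro sum.cong) auto
    also have "\<dots> = min (max (s - \<theta>) 0) (2^n * \<theta> - \<theta>) - min (max (s' - \<theta>) 0) (2^n * \<theta> - \<theta>)"
      using assms by (simp add: sum_subtractf sum_trunc)
    also have "\<dots> \<le> s - s'" using that by auto
    finally show ?thesis .
  qed
  show ?thesis
  proof (cases "s' \<le> s")
    case True then show ?thesis using *[of s' s] by simp
  next
    case False then show ?thesis using *[of s s'] by (simp add: abs_minus_commute)
  qed
qed

abbreviation shift_var :: "('a::euclidean_space \<Rightarrow> real) \<Rightarrow> 'a \<Rightarrow> ennreal" where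
  "shift_var w h \<equiv> (\<integral>\<^sup>+x. ennreal \<bar>w (x + h) - w x\<bar> \<partial>lborel)"

lemma pred_ball_measurable [measurable]: "Measurable.pred borel (\<lambda>x::'a::euclidean_space. x \<in> ball c r)"
proof -
  have "{x \<in> space borel. x \<in> ball c r} = ball c r" by auto
  then show ?thesis unfolding pred_def by (simp only: borel_open[OF open_ball])
qed

lemma measurable_shift_var [measurable]:
  fixes w :: "'a::euclidean_space \<Rightarrow> real"
  assumes [measurable]: "w \<in> borel_measurable borel"
  shows "(\<lambda>z. shift_var w (\<rho> *\<^sub>R z)) \<in> borel_measurable borel"
proof -
  have [measurable]: "(\<lambda>p::'a \<times> 'a. snd p + \<rho> *\<^sub>R fst p) \<in> lborel \<Otimes>\<^sub>M lborel \<rightarrow>\<^sub>M borel"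
    unfolding lborel_prod by (auto intro!: borel_measurable_continuous_onI continuous_intros)
  have "(\<lambda>z. shift_var w (\<rho> *\<^sub>R z)) \<in> borel_measurable lborel"
    by (rule lborel.borel_measurable_nn_integral) (unfold case_prod_beta, measurable)
  then show ?thesis by simp
qed

text \<open>A shift by n h is a chain of n shifts by h, each of the same cost by translation
  invariance. The bound is in terms of the shift cost of w itself, since w will be a single
  truncation whose share of the total cost must be kept.\<close>

lemma shift_var_mult:
  fixes w :: "'a::euclidean_space \<Rightarrow> real"
  assumes [measurable]: "w \<in> borel_measurable borel"
  shows "shift_var w (real n *\<^sub>R h) \<le> of_nat n * shift_var w h"
proof (induction n)
  case (Suc n)
  have "shift_var w (real (Suc n) *\<^sub>R h) \<le> (\<integral>\<^sup>+x. ennreal \<bar>w ((x + h) + real n *\<^sub>R h) - w (x + h)\<bar> + ennreal \<bar>w (x + h) - w x\<bar> \<partial>lborel)"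
  proof (intro nn_integral_mono)
    fix x
    have "x + real (Suc n) *\<^sub>R h = x + h + real n *\<^sub>R h" by (simp add: algebra_simps)
    then have "\<bar>w (x + real (Suc n) *\<^sub>R h) - w x\<bar> \<le> \<bar>w ((x + h) + real n *\<^sub>R h) - w (x + h)\<bar> + \<bar>w (x + h) - w x\<bar>"
      by (simp only:)
    then show "ennreal \<bar>w (x + real (Suc n) *\<^sub>R h) - w x\<bar> \<le> ennreal \<bar>w ((x + h) + real n *\<^sub>R h) - w (x + h)\<bar> + ennreal \<bar>w (x + h) - w x\<bar>"
      by (rule order_trans[OF ennreal_leI]) simp
  qed
  also have "\<dots> = (\<integral>\<^sup>+x. ennreal \<bar>w ((x + h) + real n *\<^sub>R h) - w (x + h)\<bar> \<partial>lborel) + shift_var w h"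
    by (rule nn_integral_add) measurable
  also have "(\<integral>\<^sup>+x. ennreal \<bar>w ((x + h) + real n *\<^sub>R h) - w (x + h)\<bar> \<partial>lborel) = shift_var w (real n *\<^sub>R h)"
    by (rule nn_integral_lborel_shift[where f="\<lambda>x. ennreal \<bar>w (x + real n *\<^sub>R h) - w x\<bar>"]) measurable
  also have "\<dots> + shift_var w h \<le> of_nat n * shift_var w h + shift_var w h"
    using Suc by (intro add_right_mono)
  finally show ?case by (simp only: of_nat_Suc distrib_right mult_1_left add.commute)
qed simp

text \<open>At a point with v > 2t the truncation equals t, and it vanishes wherever v \<le> t. A
  ball of radius \<rho> has volume at least 2a, so from every centre x at least half of the z in the
  unit ball lead to a point x + \<rho> z with v \<le> t, and each of these contributes t to the
  increment.\<close>

lemma trunc_level: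
  fixes v :: "'a::euclidean_space \<Rightarrow> real"
  assumes [measurable]: "v \<in> borel_measurable borel" and t: "0 < t"
    and a: "emeasure lborel {x. v x > t} = ennreal a" "0 \<le> a"
    and \<rho>: "0 < \<rho>" "2 * a \<le> \<rho> ^ DIM('a) * measure lborel (ball (0::'a) 1)"
  shows "ennreal (t * (measure lborel (ball (0::'a) 1) / 2)) * emeasure lborel {x. v x > 2 * t}
    \<le> (\<integral>\<^sup>+z. indicator (ball 0 1) z * shift_var (\<lambda>x. trunc t (v x)) (\<rho> *\<^sub>R z) \<partial>lborel)"
proof -
  define \<omega> where "\<omega> = measure lborel (ball (0::'a) 1)"
  have \<omega>: "0 < \<omega>" unfolding \<omega>_def by (rule ball_measure_pos)
  let ?G = "\<lambda>x. {z \<in> ball 0 1. v (x + \<rho> *\<^sub>R z) \<le> t}"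
  have [measurable]: "?G x \<in> sets borel" for x by measurable
  have G: "ennreal (\<omega> / 2) \<le> emeasure lborel (?G x)" for x
  proof -
    let ?H = "{z. v (x + \<rho> *\<^sub>R z) > t}"
    have [measurable]: "?H \<in> sets borel" by measurable
    \<comment> \<open>The set of bad z is a translated and rescaled copy of the superlevel set,
      hence of measure a / \<rho>^N, which is at most half the volume of the unit ball.\<close>
    have "ennreal a = (\<integral>\<^sup>+y. indicator {x. v x > t} y \<partial>lborel)"
      using a by simp
    also have "\<dots> = ennreal (\<rho> ^ DIM('a)) * (\<integral>\<^sup>+z. indicator {x. v x > t} (x + \<rho> *\<^sub>R z) \<partial>lborel)"
      by (rule nn_integral_lborel_affine) (use \<rho> in measurable)
    also have "(\<integral>\<^sup>+z. indicator {x. v x > t} (x + \<rho> *\<^sub>R z) \<partial>lborel) = (\<integral>\<^sup>+z. indicator ?H z \<partial>lborel)"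
      by (intro nn_integral_cong) (auto simp: indicator_def)
    also have "\<dots> = emeasure lborel ?H" by simp
    finally have e: "ennreal a = ennreal (\<rho> ^ DIM('a)) * emeasure lborel ?H" .
    have "emeasure lborel ?H \<noteq> \<infinity>"
      using e \<rho> by (auto simp: ennreal_mult_top)
    then have H: "emeasure lborel ?H = ennreal (measure lborel ?H)"
      by (simp add: emeasure_eq_ennreal_measure)
    have "a = \<rho> ^ DIM('a) * measure lborel ?H"
      using e \<rho> a(2) unfolding H by (simp add: ennreal_mult[symmetric])
    then have "measure lborel ?H \<le> \<omega> / 2"
      using \<rho> unfolding \<omega>_def[symmetric] by (simp add: mult_le_cancel_left_pos)
    then have *: "emeasure lborel ?H \<le> ennreal (\<omega> / 2)"
      unfolding H by (rule ennreal_leI)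
    have "ennreal (\<omega> / 2) + ennreal (\<omega> / 2) = ennreal \<omega>"
      using \<omega> by (simp flip: ennreal_plus)
    also have "ennreal \<omega> \<le> emeasure lborel (?G x) + emeasure lborel ?H"
    proof -
      have "ennreal \<omega> \<le> emeasure lborel (?G x \<union> ?H)"
        unfolding \<omega>_def emeasure_lborel_ball_eq[symmetric] by (intro emeasure_mono) auto
      also have "\<dots> \<le> emeasure lborel (?G x) + emeasure lborel ?H"
        by (rule emeasure_subadditive) auto
      finally show ?thesis .
    qed
    also have "\<dots> \<le> emeasure lborel (?G x) + ennreal (\<omega> / 2)"
      by (intro add_left_mono *)
    finally have "ennreal (\<omega> / 2) + ennreal (\<omega> / 2) \<le> ennreal (\<omega> / 2) + emeasure lborel (?G x)"
      by (simp add: add.commute)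
    then show ?thesis
      by (simp add: ennreal_add_left_cancel_le)
  qed
  have "ennreal (t * (\<omega> / 2)) * emeasure lborel {x. v x > 2 * t}
      = (\<integral>\<^sup>+x. ennreal (t * (\<omega> / 2)) * indicator {x. v x > 2 * t} x \<partial>lborel)"
    by (simp add: nn_integral_cmult_indicator)
  also have "\<dots> \<le> (\<integral>\<^sup>+x. (\<integral>\<^sup>+z. indicator (ball 0 1) z * ennreal \<bar>trunc t (v (x + \<rho> *\<^sub>R z)) - trunc t (v x)\<bar> \<partial>lborel) \<partial>lborel)"
  proof (intro nn_integral_mono)
    fix x
    show "ennreal (t * (\<omega> / 2)) * indicator {x. v x > 2 * t} x
      \<le> (\<integral>\<^sup>+z. indicator (ball 0 1) z * ennreal \<bar>trunc t (v (x + \<rho> *\<^sub>R z)) - trunc t (v x)\<bar> \<partial>lborel)"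
    proof (cases "v x > 2 * t")
      case True
      have "ennreal (t * (\<omega> / 2)) * indicator {x. v x > 2 * t} x = ennreal t * ennreal (\<omega> / 2)"
        using True \<omega> t by (simp add: ennreal_mult[symmetric])
      also have "\<dots> \<le> ennreal t * emeasure lborel (?G x)"
        by (intro mult_left_mono G) auto
      also have "\<dots> = (\<integral>\<^sup>+z. ennreal t * indicator (?G x) z \<partial>lborel)"
        by (simp add: nn_integral_cmult_indicator)
      also have "\<dots> \<le> (\<integral>\<^sup>+z. indicator (ball 0 1) z * ennreal \<bar>trunc t (v (x + \<rho> *\<^sub>R z)) - trunc t (v x)\<bar> \<partial>lborel)"
        using True t by (intro nn_integral_mono) (auto simp: indicator_def trunc_def)
      finally show ?thesis .
    qed simp
  qed
  also have "\<dots> = (\<integral>\<^sup>+z. indicator (ball 0 1) z * shift_var (\<lambda>x. trunc t (v x)) (\<rho> *\<^sub>R z) \<partial>lborel)"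
    using nn_integral_shift_swap[of "\<lambda>x. trunc t (v x)" UNIV "ball 0 1" \<rho>] by simp
  finally show ?thesis unfolding \<omega>_def .
qed

lemma ennreal_eq_enn2real: "x \<le> ennreal r \<Longrightarrow> x = ennreal (enn2real x)"
  by (rule ennreal_enn2real[symmetric]) (erule le_less_trans, simp)

text \<open>\<open>D\<close> bounds t^(p-1) times the radius of a ball of volume 2 a(t), the
  smallest radius at which the level estimate applies. Multiplying that estimate by t^(p-1) replaces
  the varying radii by one constant, so that the costs of all levels can be summed.\<close>

lemma weighted_level_sum:
  fixes v :: "'a::euclidean_space \<Rightarrow> real"
  assumes v: "shift_bounded M v" 
    and a: "\<And>t. 0 < t \<Longrightarrow> emeasure lborel {x. v x > t} = ennreal (a t)" "\<And>t. 0 \<le> a t"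
    and D: "\<And>t. 0 < t \<Longrightarrow> t powr (p - 1) * (2 * a t / measure lborel (ball (0::'a) 1)) powr (1 / DIM('a)) \<le> D"
    and \<theta>: "0 < \<theta>"
  shows "(\<Sum>k<n. (2^k * \<theta>) powr p * a (2 * (2^k * \<theta>))) \<le> 2 * D * M"
proof -
  have [measurable]: "v \<in> borel_measurable borel" and M: "0 \<le> M"
    using v by (auto simp: shift_bounded_def)
  define \<omega> where "\<omega> = measure lborel (ball (0::'a) 1)"
  have \<omega>: "0 < \<omega>" unfolding \<omega>_def by (rule ball_measure_pos)
  define t where "t k = 2^k * \<theta>" for k :: nat
  have t: "0 < t k" for k using \<theta> by (simp add: t_def)
  define r where "r k = (2 * a (t k) / \<omega>) powr (1 / DIM('a))" for k
  have r0: "0 \<le> r k" for k by (simp add: r_def)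
  have rN: "r k ^ DIM('a) * \<omega> = 2 * a (t k)" for k
  proof -
    have "r k ^ DIM('a) = r k powr DIM('a)" 
      by (cases "r k = 0") (auto simp: powr_realpow r0 order_less_le)
    also have "\<dots> = 2 * a (t k) / \<omega>"
      using a(2)[of "t k"] \<omega> by (simp add: r_def powr_powr)
    finally show ?thesis using \<omega> by simp
  qed
  \<comment> \<open>Collects the rounding errors: each radius is rounded up by at most \<delta>, so
    level k loses at most t_k^(p-1) \<delta>.\<close>
  define \<Lambda> where "\<Lambda> = (\<Sum>k<n. t k powr (p - 1))"
  let ?X = "\<lambda>k. t k powr p * a (2 * t k)"
  have key: "(\<Sum>k<n. ?X k) * (\<omega> / 2) \<le> D * M * \<omega> + (\<Lambda> * M * \<omega>) * \<delta>" if \<delta>: "0 < \<delta>" for \<delta>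
  proof -
    let ?H = "\<lambda>k. (\<integral>\<^sup>+z. indicator (ball 0 1) z * shift_var (\<lambda>x. trunc (t k) (v x)) (\<delta> *\<^sub>R z) \<partial>lborel)"
    have "(\<Sum>k<n. ?H k) = (\<integral>\<^sup>+z. (\<Sum>k<n. indicator (ball 0 1) z * shift_var (\<lambda>x. trunc (t k) (v x)) (\<delta> *\<^sub>R z)) \<partial>lborel)"
      by (rule nn_integral_sum[symmetric]) measurable
    also have "\<dots> \<le> (\<integral>\<^sup>+z. indicator (ball 0 1) z * shift_var v (\<delta> *\<^sub>R z) \<partial>lborel)"
    proof (intro nn_integral_mono)
      fix z :: 'a
      have "(\<Sum>k<n. shift_var (\<lambda>x. trunc (t k) (v x)) (\<delta> *\<^sub>R z)) =
         (\<integral>\<^sup>+x. (\<Sum>k<n. ennreal \<bar>trunc (t k) (v (x + \<delta> *\<^sub>R z)) - trunc (t k) (v x)\<bar>) \<partial>lborel)"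
        by (rule nn_integral_sum[symmetric]) measurable
      also have "\<dots> \<le> shift_var v (\<delta> *\<^sub>R z)"
        using sum_trunc_diff[OF \<theta>]
        by (intro nn_integral_mono) (simp add: t_def ennreal_leI)
      finally show "(\<Sum>k<n. indicator (ball 0 1) z * shift_var (\<lambda>x. trunc (t k) (v x)) (\<delta> *\<^sub>R z))
          \<le> indicator (ball 0 1) z * shift_var v (\<delta> *\<^sub>R z)"
        unfolding sum_distrib_left[symmetric] by (intro mult_left_mono) auto
    qed
    also have "\<dots> \<le> ennreal (M * \<delta> * \<omega>)"
      unfolding \<omega>_def using \<delta> by (intro shift_bounded_avg[OF v]) auto
    finally have sumH: "(\<Sum>k<n. ?H k) \<le> ennreal (M * \<delta> * \<omega>)" .
    \<comment> \<open>The share of level k in the averaged cost of shifts of length at most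
      \<delta>; together the shares do not exceed the cost for v.\<close>
    define h where "h k = enn2real (?H k)" for k
    have h: "?H k = ennreal (h k)" if "k < n" for k
    proof -
      have "?H k \<le> (\<Sum>k<n. ?H k)" using that by (intro member_le_sum) auto
      also note sumH
      finally show ?thesis
        unfolding h_def by (rule ennreal_eq_enn2real)
    qed
    have h0: "0 \<le> h k" for k by (simp add: h_def)
    have "ennreal (\<Sum>k<n. h k) = (\<Sum>k<n. ?H k)"
      using h h0 by (subst sum_ennreal[symmetric]) auto
    also note sumH
    finally have sumh: "(\<Sum>k<n. h k) \<le> M * \<delta> * \<omega>"
      using M \<delta> \<omega> by simp
    have "\<delta> * (?X k * (\<omega> / 2)) \<le> (D + \<Lambda> * \<delta>) * h k" if k: "k < n" for k
    proof -
      \<comment> \<open>The added 1 keeps m positive even when the radius r k is 0, and m \<delta>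
        lies between r k and r k + \<delta>.\<close>
      define m where "m = nat \<lfloor>r k / \<delta>\<rfloor> + 1"
      have "real m = real_of_int \<lfloor>r k / \<delta>\<rfloor> + 1"
        unfolding m_def using r0[of k] \<delta> by simp
      then have "r k / \<delta> \<le> real m" "real m \<le> r k / \<delta> + 1"
        by linarith+
      then have m: "r k \<le> real m * \<delta>" "real m * \<delta> \<le> r k + \<delta>"
        using \<delta> by (simp_all add: field_simps)
      have m0: "0 < m" by (simp add: m_def)
      have "2 * a (t k) \<le> (real m * \<delta>) ^ DIM('a) * \<omega>"
        unfolding rN[symmetric] using \<omega> m r0 by (intro mult_right_mono power_mono) auto
      then have "ennreal (t k * (\<omega> / 2)) * emeasure lborel {x. v x > 2 * t k}
          \<le> (\<integral>\<^sup>+z. indicator (ball 0 1) z * shift_var (\<lambda>x. trunc (t k) (v x)) ((real m * \<delta>) *\<^sub>R z) \<partial>lborel)"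
        unfolding \<omega>_def using m0 \<delta> t a by (intro trunc_level) auto
      also have "\<dots> \<le> (\<integral>\<^sup>+z. of_nat m * (indicator (ball 0 1) z * shift_var (\<lambda>x. trunc (t k) (v x)) (\<delta> *\<^sub>R z)) \<partial>lborel)"
      proof (intro nn_integral_mono)
        fix z :: 'a
        have "shift_var (\<lambda>x. trunc (t k) (v x)) ((real m * \<delta>) *\<^sub>R z) \<le> of_nat m * shift_var (\<lambda>x. trunc (t k) (v x)) (\<delta> *\<^sub>R z)"
          unfolding scaleR_scaleR[symmetric] by (rule shift_var_mult) measurable
        then show "indicator (ball 0 1) z * shift_var (\<lambda>x. trunc (t k) (v x)) ((real m * \<delta>) *\<^sub>R z)
          \<le> of_nat m * (indicator (ball 0 1) z * shift_var (\<lambda>x. trunc (t k) (v x)) (\<delta> *\<^sub>R z))"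
          by (auto simp: indicator_def)
      qed
      also have "\<dots> = of_nat m * ?H k"
        by (rule nn_integral_cmult) measurable
      also have "\<dots> = ennreal (real m * h k)"
        using h[OF k] h0 by (simp add: ennreal_mult ennreal_of_nat_eq_real_of_nat)
      finally have "ennreal (t k * (\<omega> / 2) * a (2 * t k)) \<le> ennreal (real m * h k)"
        using a(1)[of "2 * t k"] a(2)[of "2 * t k"] t[of k] \<omega> by (simp add: ennreal_mult[symmetric])
      then have "t k * (\<omega> / 2) * a (2 * t k) \<le> real m * h k"
        using h0 by simp
      then have "(\<delta> * t k powr (p - 1)) * (t k * (\<omega> / 2) * a (2 * t k)) \<le> (\<delta> * t k powr (p - 1)) * (real m * h k)"
        using \<delta> by (intro mult_left_mono) auto
      also have "\<dots> = t k powr (p - 1) * (real m * \<delta>) * h k" by simp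
      also have "\<dots> \<le> t k powr (p - 1) * (r k + \<delta>) * h k"
        using m h0 by (intro mult_right_mono mult_left_mono) auto
      also have "\<dots> \<le> (D + \<Lambda> * \<delta>) * h k"
      proof (intro mult_right_mono h0)
        have "t k powr (p - 1) * r k \<le> D"
          unfolding r_def \<omega>_def by (intro D t)
        moreover have "t k powr (p - 1) \<le> \<Lambda>"
          unfolding \<Lambda>_def using k by (intro member_le_sum) auto
        then have "t k powr (p - 1) * \<delta> \<le> \<Lambda> * \<delta>" using \<delta> by simp
        ultimately show "t k powr (p - 1) * (r k + \<delta>) \<le> D + \<Lambda> * \<delta>"
          by (simp add: distrib_left)
      qed
      also have "(\<delta> * t k powr (p - 1)) * (t k * (\<omega> / 2) * a (2 * t k)) = \<delta> * (?X k * (\<omega> / 2))"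
        using t[of k] powr_mult_base[of "t k" "p - 1"] by (simp add: algebra_simps)
      finally show ?thesis .
    qed
    then have "(\<Sum>k<n. \<delta> * (?X k * (\<omega> / 2))) \<le> (\<Sum>k<n. (D + \<Lambda> * \<delta>) * h k)"
      by (intro sum_mono) auto
    also have "\<dots> = (D + \<Lambda> * \<delta>) * (\<Sum>k<n. h k)" by (simp add: sum_distrib_left)
    also have "\<dots> \<le> (D + \<Lambda> * \<delta>) * (M * \<delta> * \<omega>)"
    proof (intro mult_left_mono sumh)
      have "0 \<le> D" using D[of 1] by (meson mult_nonneg_nonneg order_trans powr_ge_zero zero_less_one)
      moreover have "0 \<le> \<Lambda>" unfolding \<Lambda>_def by (intro sum_nonneg) auto
      ultimately show "0 \<le> D + \<Lambda> * \<delta>" using \<delta> by simp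
    qed
    finally have "\<delta> * ((\<Sum>k<n. ?X k) * (\<omega> / 2)) \<le> \<delta> * (D * M * \<omega> + (\<Lambda> * M * \<omega>) * \<delta>)"
      by (simp add: sum_distrib_left sum_distrib_right algebra_simps)
    then show ?thesis using \<delta> by simp
  qed
  have "(\<Sum>k<n. ?X k) * (\<omega> / 2) \<le> D * M * \<omega>"
  proof (rule field_le_epsilon)
    fix e :: real assume e: "0 < e"
    define \<delta> where "\<delta> = e / (\<bar>\<Lambda> * M * \<omega>\<bar> + 1)"
    have \<delta>: "0 < \<delta>" using e by (simp add: \<delta>_def)
    have "(\<Lambda> * M * \<omega>) * \<delta> \<le> (\<bar>\<Lambda> * M * \<omega>\<bar> + 1) * \<delta>"
      using \<delta> by (intro mult_right_mono) auto
    also have "\<dots> = e" by (simp add: \<delta>_def)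
    finally show "(\<Sum>k<n. ?X k) * (\<omega> / 2) \<le> D * M * \<omega> + e"
      using key[OF \<delta>] by linarith
  qed
  then have "(\<Sum>k<n. ?X k) * \<omega> \<le> (2 * D * M) * \<omega>" by simp
  then show ?thesis using \<omega> by (simp add: t_def)
qed

text \<open>The value s lies in one shell from 2 (2^k \<theta>) to 4 (2^k \<theta>), and the summand
  of that index already dominates s^p. Superlevel sets replace shells because their measures a(2
  (2^k \<theta>)) are what the level sum controls.\<close>

lemma dyadic_sum_ge:
  fixes s \<theta> :: real
  assumes "2 * \<theta> < s" "s \<le> 2 * (2^n * \<theta>)" "0 < \<theta>" "0 < p"
  shows "s powr p \<le> (\<Sum>k<n. (4 * (2^k * \<theta>)) powr p * indicator {2 * (2^k * \<theta>)<..} s)"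
  using assms(2)
proof (induction n)
  case 0 then show ?case using assms(1) by simp
next
  case (Suc n)
  show ?case
  proof (cases "s \<le> 2 * (2^n * \<theta>)")
    case True
    then have "s powr p \<le> (\<Sum>k<n. (4 * (2^k * \<theta>)) powr p * indicator {2 * (2^k * \<theta>)<..} s)"
      by (rule Suc.IH)
    then show ?thesis by (simp add: add_increasing2)
  next
    case False
    have "s powr p \<le> (4 * (2^n * \<theta>)) powr p"
      using Suc.prems assms by (intro powr_mono2) auto
    moreover have "0 \<le> (\<Sum>k<n. (4 * (2^k * \<theta>)) powr p * indicator {2 * (2^k * \<theta>)<..} s)"
      by (intro sum_nonneg) auto
    ultimately show ?thesis using False by simp
  qed
qed

lemma shift_bounded_abs:
  assumes "shift_bounded M u" shows "shift_bounded M (\<lambda>x. \<bar>u x\<bar>)"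
proof -
  have "(\<integral>\<^sup>+x. ennreal \<bar>\<bar>u (x + h)\<bar> - \<bar>u x\<bar>\<bar> \<partial>lborel) \<le> shift_var u h" for h
    by (intro nn_integral_mono ennreal_leI) linarith
  then show ?thesis
    using assms unfolding shift_bounded_def by (auto intro: order_trans)
qed

text \<open>With B the supremum of t^p a(t), the constant \<open>D\<close> of the level sum can be a
  multiple of B^(1/N), because t^(p-1) = (t^p)^(1/N). Up to constants, the level sum with one term
  bounds B by M B^(1/N), and with many terms it bounds the integral of |u|^p by M B^(1/N);
  eliminating B leaves M^p.\<close>

lemma shift_sobolev:
  assumes N: "2 \<le> DIM('a::euclidean_space)"
  defines "p \<equiv> real DIM('a) / (real DIM('a) - 1)"
  shows "\<exists>C\<ge>0. \<forall>(u :: 'a \<Rightarrow> real) M. shift_bounded M u \<longrightarrow> (\<integral>\<^sup>+x. ennreal (\<bar>u x\<bar> powr p) \<partial>lborel) < \<infinity> \<longrightarrow>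
    (\<integral>\<^sup>+x. ennreal (\<bar>u x\<bar> powr p) \<partial>lborel) \<le> ennreal (C * M powr p)"
proof -
  define \<omega> where "\<omega> = measure lborel (ball (0::'a) 1)"
  have \<omega>: "0 < \<omega>" unfolding \<omega>_def by (rule ball_measure_pos)
  define d where "d = 1 / real DIM('a)"
  have d: "0 < d" using N by (simp add: d_def)
  \<comment> \<open>The identities that single out the critical exponent: the first makes t^(p-1) a
    power of t^p, the second turns B^(1-d) \<le> \<kappa> M into a bound for B^d by (\<kappa>
    M)^(p-1).\<close>
  have pd: "p - 1 = p * d" "p * (1 - d) = 1" "1 < p"
    using N by (auto simp: p_def d_def field_simps)
  define c where "c = (2 / \<omega>) powr d"
  \<comment> \<open>From the level sum with a single term: 2 c is the constant of its bound, and 2^p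
    passes from the base level t/2 to t.\<close>
  define \<kappa> where "\<kappa> = 2 * 2 powr p * c"
  have c: "0 < c" "0 < \<kappa>" using \<omega> by (auto simp: c_def \<kappa>_def)
  define C where "C = 4 powr p * (2 * c * \<kappa> powr (p - 1))"
  have main: "(\<integral>\<^sup>+x. ennreal (\<bar>u x\<bar> powr p) \<partial>lborel) \<le> ennreal (C * M powr p)"
    if u: "shift_bounded M u" and fin: "(\<integral>\<^sup>+x. ennreal (\<bar>u x\<bar> powr p) \<partial>lborel) < \<infinity>" for u :: "'a \<Rightarrow> real" and M
  proof -
    define v where "v x = \<bar>u x\<bar>" for x
    have v: "shift_bounded M v" unfolding v_def by (rule shift_bounded_abs[OF u])
    have [measurable]: "v \<in> borel_measurable borel" and M: "0 \<le> M"
      using v by (auto simp: shift_bounded_def)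
    define I where "I = enn2real (\<integral>\<^sup>+x. ennreal (v x powr p) \<partial>lborel)"
    have I: "(\<integral>\<^sup>+x. ennreal (v x powr p) \<partial>lborel) = ennreal I"
      using fin unfolding I_def v_def by (simp add: ennreal_enn2real)
    define a where "a t = measure lborel {x. v x > t}" for t
    have a0: "0 \<le> a t" for t by (simp add: a_def)
    have markov: "ennreal (t powr p) * emeasure lborel {x. v x > t} \<le> ennreal I" if "0 < t" for t
    proof -
      have "ennreal (t powr p) * emeasure lborel {x. v x > t} = (\<integral>\<^sup>+x. ennreal (t powr p) * indicator {x. v x > t} x \<partial>lborel)"
        by (simp add: nn_integral_cmult_indicator)
      also have "\<dots> \<le> ennreal I"
        unfolding I[symmetric] using that pd
        by (intro nn_integral_mono) (auto simp: indicator_def intro!: ennreal_leI powr_mono2)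
      finally show ?thesis .
    qed
    have a: "emeasure lborel {x. v x > t} = ennreal (a t)" if "0 < t" for t
      using markov[OF that] that unfolding a_def
      by (intro emeasure_eq_ennreal_measure) (auto simp: ennreal_mult_top top_unique)
    have bI: "t powr p * a t \<le> I" if "0 < t" for t
      using markov[OF that] a0[of t] unfolding a[OF that] by (simp add: I_def ennreal_mult[symmetric])
    \<comment> \<open>A supremum of reals, bounded above by Markov's inequality and the assumed
      finiteness of the integral; this finiteness is what later permits cancelling a power of
      B.\<close>
    define B where "B = (SUP t\<in>{0<..}. t powr p * a t)"
    have bdd: "bdd_above ((\<lambda>t. t powr p * a t) ` {0<..})" using bI by (auto intro!: bdd_aboveI)
    have bB: "t powr p * a t \<le> B" if "0 < t" for t
      unfolding B_def using that by (intro cSUP_upper bdd) auto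
    have B0: "0 \<le> B" using bB[of 1] a0[of 1] by simp
    have D: "t powr (p - 1) * (2 * a t / measure lborel (ball (0::'a) 1)) powr (1 / DIM('a)) \<le> c * B powr d" if "0 < t" for t
    proof -
      have "t powr (p - 1) * (2 * a t / \<omega>) powr d = ((2 / \<omega>) * (t powr p * a t)) powr d"
        using that a0[of t] \<omega> by (simp add: pd powr_powr[symmetric] powr_mult powr_divide)
      also have "\<dots> \<le> ((2 / \<omega>) * B) powr d"
        using \<omega> d a0[of t] that by (intro powr_mono2 mult_left_mono bB) auto
      also have "\<dots> = c * B powr d" unfolding c_def by (rule powr_mult)
      finally show ?thesis unfolding \<omega>_def d_def by simp
    qed
    have lev: "(\<Sum>k<n. (2^k * \<theta>) powr p * a (2 * (2^k * \<theta>))) \<le> 2 * (c * B powr d) * M" if "0 < \<theta>" for n \<theta>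
      by (rule weighted_level_sum[OF v a a0 D that])
    have "B \<le> \<kappa> * M * B powr d"
      unfolding B_def
    proof (rule cSUP_least, goal_cases)
      case (2 t)
      then have "0 < t / 2" by simp
      from lev[OF this, of 1] have "(t / 2) powr p * a t \<le> 2 * (c * B powr d) * M" by simp
      then have "2 powr p * ((t / 2) powr p * a t) \<le> 2 powr p * (2 * (c * B powr d) * M)"
        by (intro mult_left_mono) auto
      moreover have "2 powr p * (t / 2) powr p = t powr p"
        using 2 by (simp add: powr_divide)
      ultimately show ?case
        unfolding B_def[symmetric] by (simp add: \<kappa>_def mult.assoc[symmetric]) (simp add: mult_ac)
    qed simp
    then have Bd: "B powr d \<le> (\<kappa> * M) powr (p - 1)"
    proof (cases "B = 0")
      case False
      then have "0 < B" using B0 by simp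
      then have "B powr (1 - d) * B powr d = B" by (simp flip: powr_add)
      then have "B powr (1 - d) * B powr d \<le> (\<kappa> * M) * B powr d"
        using \<open>B \<le> \<kappa> * M * B powr d\<close> by simp
      then have "B powr (1 - d) \<le> \<kappa> * M"
        using \<open>0 < B\<close> by (simp add: mult_le_cancel_right)
      then have "(B powr (1 - d)) powr (p * d) \<le> (\<kappa> * M) powr (p * d)"
        using pd d by (intro powr_mono2) auto
      moreover have "(1 - d) * (p * d) = d" using pd(2) by (metis mult.assoc mult.commute mult_1)
      ultimately show ?thesis by (simp add: powr_powr pd(1))
    qed (use d in auto)
    have "c * B powr d * M \<le> c * (\<kappa> powr (p - 1) * M powr (p - 1)) * M"
      using Bd c M by (intro mult_left_mono mult_right_mono) (auto simp: powr_mult)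
    also have "\<dots> = c * \<kappa> powr (p - 1) * M powr p"
    proof (cases "M = 0")
      case False then show ?thesis using M powr_mult_base[of M "p - 1"] by (simp add: mult_ac)
    qed simp
    finally have DM: "2 * (c * B powr d) * M \<le> 2 * c * \<kappa> powr (p - 1) * M powr p" by simp
    \<comment> \<open>An exhaustion of the set where v > 0 by dyadic shells: the base level is 2^-i,
      and 2i levels reach up to 2^i. The bound on the integrals does not depend on i, so monotone
      convergence applies.\<close>
    define f where "f i x = ennreal (v x powr p) * indicator {x. 2 * (1/2)^i < v x \<and> v x \<le> 2 * 2^i} x" for i :: nat and x
    have [measurable]: "f i \<in> borel_measurable borel" for i unfolding f_def by measurable
    have fi: "integral\<^sup>N lborel (f i) \<le> ennreal (C * M powr p)" for i
    proof -
      define \<theta> where "\<theta> = (1/2::real)^i"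
      have \<theta>: "0 < \<theta>" by (simp add: \<theta>_def)
      have top: "2^(2*i) * \<theta> = 2^i" by (simp add: \<theta>_def mult_2 power_add power_one_over)
      have "integral\<^sup>N lborel (f i) \<le> (\<integral>\<^sup>+x. (\<Sum>k<2*i. ennreal ((4 * (2^k * \<theta>)) powr p) * indicator {x. v x > 2 * (2^k * \<theta>)} x) \<partial>lborel)"
      proof (intro nn_integral_mono)
        fix x
        have "f i x \<le> ennreal (\<Sum>k<2*i. (4 * (2^k * \<theta>)) powr p * indicator {2 * (2^k * \<theta>)<..} (v x))"
        proof (cases "2 * \<theta> < v x \<and> v x \<le> 2 * (2^(2*i) * \<theta>)")
          case True
          then have "f i x = ennreal (v x powr p)" unfolding top by (simp add: f_def \<theta>_def)
          then show ?thesis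
            using dyadic_sum_ge[of \<theta> "v x" "2*i" p] True \<theta> pd by (simp add: ennreal_leI)
        next
          case False
          then have "f i x = 0" unfolding top by (simp add: f_def \<theta>_def)
          then show ?thesis by simp
        qed
        also have "\<dots> = (\<Sum>k<2*i. ennreal ((4 * (2^k * \<theta>)) powr p) * indicator {x. v x > 2 * (2^k * \<theta>)} x)"
        proof -
          have "(\<Sum>k<2*i. ennreal ((4 * (2^k * \<theta>)) powr p) * indicator {x. v x > 2 * (2^k * \<theta>)} x)
             = (\<Sum>k<2*i. ennreal ((4 * (2^k * \<theta>)) powr p * indicator {2 * (2^k * \<theta>)<..} (v x)))"
            by (intro sum.cong refl) (simp add: indicator_def)
          also have "\<dots> = ennreal (\<Sum>k<2*i. (4 * (2^k * \<theta>)) powr p * indicator {2 * (2^k * \<theta>)<..} (v x))"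
            by (rule sum_ennreal) simp
          finally show ?thesis by (rule sym)
        qed
        finally show "f i x \<le> \<dots>" .
      qed
      also have "\<dots> = (\<Sum>k<2*i. ennreal ((4 * (2^k * \<theta>)) powr p) * emeasure lborel {x. v x > 2 * (2^k * \<theta>)})"
        by (subst nn_integral_sum) (auto simp: nn_integral_cmult_indicator)
      also have "\<dots> = (\<Sum>k<2*i. ennreal (4 powr p * ((2^k * \<theta>) powr p * a (2 * (2^k * \<theta>)))))"
        using \<theta> a0 by (intro sum.cong refl) (subst a, auto simp: ennreal_mult[symmetric] powr_mult mult.assoc)
      also have "\<dots> = ennreal (4 powr p * (\<Sum>k<2*i. (2^k * \<theta>) powr p * a (2 * (2^k * \<theta>))))"
        using a0 by (subst sum_ennreal) (auto simp: sum_distrib_left)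
      also have "\<dots> \<le> ennreal (C * M powr p)"
        unfolding C_def using order_trans[OF lev[OF \<theta>, of "2*i"] DM] 
        by (intro ennreal_leI) (simp add: mult.assoc)
      finally show ?thesis .
    qed
    have inc: "incseq f"
    proof (rule incseq_SucI, rule le_funI)
      fix i x
      show "f i x \<le> f (Suc i) x"
      proof (cases "2 * (1/2)^i < v x \<and> v x \<le> 2 * 2^i")
        case True
        then have "2 * (1/2)^Suc i < v x \<and> v x \<le> 2 * 2^Suc i"
          using zero_less_power[of "1/2::real" i] zero_less_power[of "2::real" i] unfolding power_Suc by linarith
        then show ?thesis using True unfolding f_def by simp
      qed (auto simp: f_def)
    qed
    have lim: "(\<lambda>i. f i x) \<longlonglongrightarrow> ennreal (v x powr p)" for x
    proof (cases "v x = 0")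
      case True
      then have "f i x = 0" for i unfolding f_def by auto
      then show ?thesis using True by simp
    next
      case False
      then have vx: "0 < v x" by (simp add: v_def)
      have "(\<lambda>i. 2 * (1/2::real)^i) \<longlonglongrightarrow> 0"
        by (intro tendsto_mult_right_zero LIMSEQ_power_zero) simp
      then have "\<forall>\<^sub>F i in sequentially. 2 * (1/2)^i < v x" using vx by (rule order_tendstoD(2))
      moreover have "\<forall>\<^sub>F i in sequentially. v x \<le> 2 * 2^i"
      proof -
        obtain n where n: "v x < 2^n" using real_arch_pow[of 2 "v x"] by auto
        have "v x \<le> 2 * 2^i" if "n \<le> i" for i
        proof -
          have "(2::real)^n \<le> 2^i" using that by (rule power_increasing) simp
          then show ?thesis using n zero_less_power[of "2::real" i] by linarith
        qed
        then show ?thesis by (auto simp: eventually_sequentially)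
      qed
      ultimately have "\<forall>\<^sub>F i in sequentially. f i x = ennreal (v x powr p)"
        by eventually_elim (simp add: f_def)
      then show ?thesis by (rule tendsto_eventually)
    qed
    have "(\<lambda>i. integral\<^sup>N lborel (f i)) \<longlonglongrightarrow> (\<integral>\<^sup>+x. ennreal (v x powr p) \<partial>lborel)"
      by (rule nn_integral_LIMSEQ[OF inc]) (auto simp: lim)
    then have "(\<integral>\<^sup>+x. ennreal (v x powr p) \<partial>lborel) \<le> ennreal (C * M powr p)"
      by (rule LIMSEQ_le_const2) (use fi in auto)
    then show ?thesis by (simp add: v_def)
  qed
  show ?thesis
    by (intro exI[of _ C]) (use c main in \<open>auto simp: C_def\<close>)
qed

subsection \<open>Local compactness\<close>

text \<open>Not divided by the volume of the unit ball, so it approximates that volume times w; the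
  factor is carried along until the very end of the compactness argument.\<close>

definition ball_avg :: "real \<Rightarrow> ('a::euclidean_space \<Rightarrow> real) \<Rightarrow> 'a \<Rightarrow> real" where
  "ball_avg \<rho> w x = (LINT z|lborel. indicator (ball 0 1) z * w (x + \<rho> *\<^sub>R z))"

lemma nn_integral_ball_avg_le:
  fixes w :: "'a::euclidean_space \<Rightarrow> real"
  assumes [measurable]: "w \<in> borel_measurable borel" and \<rho>: "0 < \<rho>" and x: "norm x + \<rho> \<le> R"
  shows "(\<integral>\<^sup>+z. ennreal \<bar>indicator (ball 0 1) z * w (x + \<rho> *\<^sub>R z)\<bar> \<partial>lborel)
    \<le> ennreal (1 / \<rho> ^ DIM('a)) * (\<integral>\<^sup>+y. indicator (ball 0 R) y * ennreal \<bar>w y\<bar> \<partial>lborel)"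
proof -
  have "(\<integral>\<^sup>+z. ennreal \<bar>indicator (ball 0 1) z * w (x + \<rho> *\<^sub>R z)\<bar> \<partial>lborel)
     \<le> (\<integral>\<^sup>+z. indicator (ball 0 R) (x + \<rho> *\<^sub>R z) * ennreal \<bar>w (x + \<rho> *\<^sub>R z)\<bar> \<partial>lborel)"
  proof (intro nn_integral_mono)
    fix z :: 'a
    have "norm (x + \<rho> *\<^sub>R z) < R" if "norm z < 1"
    proof -
      have "norm (x + \<rho> *\<^sub>R z) \<le> norm x + \<rho> * norm z"
        using \<rho> norm_triangle_ineq[of x "\<rho> *\<^sub>R z"] by simp
      also have "\<dots> < norm x + \<rho>" using that \<rho> by simp
      finally show ?thesis using x by simp
    qed
    then show "ennreal \<bar>indicator (ball 0 1) z * w (x + \<rho> *\<^sub>R z)\<bar> \<le> indicator (ball 0 R) (x + \<rho> *\<^sub>R z) * ennreal \<bar>w (x + \<rho> *\<^sub>R z)\<bar>"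
      by (auto simp: indicator_def)
  qed
  also have "\<dots> = ennreal (1 / \<rho> ^ DIM('a)) * (ennreal (\<rho> ^ DIM('a)) * (\<integral>\<^sup>+z. indicator (ball 0 R) (x + \<rho> *\<^sub>R z) * ennreal \<bar>w (x + \<rho> *\<^sub>R z)\<bar> \<partial>lborel))"
    using \<rho> by (subst mult.assoc[symmetric], subst ennreal_mult[symmetric]) auto
  also have "ennreal (\<rho> ^ DIM('a)) * (\<integral>\<^sup>+z. indicator (ball 0 R) (x + \<rho> *\<^sub>R z) * ennreal \<bar>w (x + \<rho> *\<^sub>R z)\<bar> \<partial>lborel)
     = (\<integral>\<^sup>+y. indicator (ball 0 R) y * ennreal \<bar>w y\<bar> \<partial>lborel)"
    using \<rho> by (subst nn_integral_lborel_affine[of "\<lambda>y. indicator (ball 0 R) y * ennreal \<bar>w y\<bar>" \<rho> x]) auto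
  finally show ?thesis .
qed

definition loc_int :: "('a::euclidean_space \<Rightarrow> real) \<Rightarrow> bool" where
  "loc_int w \<longleftrightarrow> w \<in> borel_measurable borel \<and> (\<forall>R. (\<integral>\<^sup>+y. indicator (ball 0 R) y * ennreal \<bar>w y\<bar> \<partial>lborel) < \<infinity>)"

lemma ball_avg_integrable:
  assumes "loc_int w" and \<rho>: "0 < \<rho>"
  shows "integrable lborel (\<lambda>z. indicator (ball 0 1) z * w (x + \<rho> *\<^sub>R z))"
proof (rule integrableI_bounded)
  have [measurable]: "w \<in> borel_measurable borel" using assms by (simp add: loc_int_def)
  show "(\<lambda>z. indicator (ball 0 1) z * w (x + \<rho> *\<^sub>R z)) \<in> borel_measurable lborel" by measurable
  have "(\<integral>\<^sup>+z. ennreal \<bar>indicator (ball 0 1) z * w (x + \<rho> *\<^sub>R z)\<bar> \<partial>lborel)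
    \<le> ennreal (1 / \<rho> ^ DIM('a)) * (\<integral>\<^sup>+y. indicator (ball 0 (norm x + \<rho>)) y * ennreal \<bar>w y\<bar> \<partial>lborel)"
    by (rule nn_integral_ball_avg_le) (use \<rho> in auto)
  also have "\<dots> < \<infinity>" using assms by (simp add: loc_int_def ennreal_mult_less_top)
  finally show "(\<integral>\<^sup>+z. ennreal (norm (indicator (ball 0 1) z * w (x + \<rho> *\<^sub>R z))) \<partial>lborel) < \<infinity>" by simp
qed

lemma ball_avg_diff:
  assumes "loc_int w" "loc_int w'" "0 < \<rho>"
  shows "ball_avg \<rho> (\<lambda>x. w x - w' x) x = ball_avg \<rho> w x - ball_avg \<rho> w' x"
  unfolding ball_avg_def right_diff_distrib
  by (intro Bochner_Integration.integral_diff ball_avg_integrable assms)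

lemma ball_avg_bound:
  fixes w :: "'a::euclidean_space \<Rightarrow> real"
  assumes "loc_int w" and \<rho>: "0 < \<rho>" and x: "norm x + \<rho> \<le> R" and B: "0 \<le> B"
    "(\<integral>\<^sup>+y. indicator (ball 0 R) y * ennreal \<bar>w y\<bar> \<partial>lborel) \<le> ennreal B"
  shows "\<bar>ball_avg \<rho> w x\<bar> \<le> B / \<rho> ^ DIM('a)"
proof -
  have [measurable]: "w \<in> borel_measurable borel" using assms by (simp add: loc_int_def)
  have "ennreal \<bar>ball_avg \<rho> w x\<bar> \<le> (\<integral>\<^sup>+z. ennreal \<bar>indicator (ball 0 1) z * w (x + \<rho> *\<^sub>R z)\<bar> \<partial>lborel)"
    unfolding ball_avg_def using integral_norm_bound_ennreal[OF ball_avg_integrable[OF assms(1) \<rho>]] by simp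
  also have "\<dots> \<le> ennreal (1 / \<rho> ^ DIM('a)) * (\<integral>\<^sup>+y. indicator (ball 0 R) y * ennreal \<bar>w y\<bar> \<partial>lborel)"
    by (rule nn_integral_ball_avg_le) (use \<rho> x in auto)
  also have "\<dots> \<le> ennreal (1 / \<rho> ^ DIM('a)) * ennreal B"
    by (intro mult_left_mono B) auto
  also have "\<dots> = ennreal (B / \<rho> ^ DIM('a))"
    using \<rho> B by (simp add: ennreal_mult[symmetric])
  finally show ?thesis using B \<rho> by simp
qed

text \<open>Moving the centre from y to x is a translation of w by x - y. Dropping the indicator of
  the ball bounds the change by the shift cost over the whole space, and rescaling by \<rho>
  supplies the factor \<rho>^-N.\<close>

lemma ball_avg_lipschitz:
  fixes w :: "'a::euclidean_space \<Rightarrow> real"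
  assumes w: "loc_int w" and sb: "shift_bounded M w" and \<rho>: "0 < \<rho>"
  shows "\<bar>ball_avg \<rho> w x - ball_avg \<rho> w y\<bar> \<le> M / \<rho> ^ DIM('a) * norm (x - y)"
proof -
  have [measurable]: "w \<in> borel_measurable borel" and M: "0 \<le> M" using sb by (auto simp: shift_bounded_def)
  let ?g = "\<lambda>z. indicator (ball 0 1) z * w (x + \<rho> *\<^sub>R z) - indicator (ball 0 1) z * w (y + \<rho> *\<^sub>R z)"
  have int: "integrable lborel ?g"
    by (intro Bochner_Integration.integrable_diff ball_avg_integrable w \<rho>)
  have "ball_avg \<rho> w x - ball_avg \<rho> w y = (LINT z|lborel. ?g z)"
    unfolding ball_avg_def by (intro Bochner_Integration.integral_diff[symmetric] ball_avg_integrable w \<rho>)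
  then have "ennreal \<bar>ball_avg \<rho> w x - ball_avg \<rho> w y\<bar> \<le> (\<integral>\<^sup>+z. ennreal \<bar>?g z\<bar> \<partial>lborel)"
    using integral_norm_bound_ennreal[OF int] by simp
  also have "\<dots> \<le> (\<integral>\<^sup>+z. ennreal \<bar>w ((y + \<rho> *\<^sub>R z) + (x - y)) - w (y + \<rho> *\<^sub>R z)\<bar> \<partial>lborel)"
  proof (intro nn_integral_mono ennreal_leI)
    fix z :: 'a
    have "(y + \<rho> *\<^sub>R z) + (x - y) = x + \<rho> *\<^sub>R z" by simp
    then show "\<bar>?g z\<bar> \<le> \<bar>w ((y + \<rho> *\<^sub>R z) + (x - y)) - w (y + \<rho> *\<^sub>R z)\<bar>"
      by (simp only:) (auto simp: indicator_def)
  qed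
  also have "\<dots> = ennreal (1 / \<rho> ^ DIM('a)) * (ennreal (\<rho> ^ DIM('a)) * (\<integral>\<^sup>+z. ennreal \<bar>w ((y + \<rho> *\<^sub>R z) + (x - y)) - w (y + \<rho> *\<^sub>R z)\<bar> \<partial>lborel))"
    using \<rho> by (subst mult.assoc[symmetric], subst ennreal_mult[symmetric]) auto
  also have "ennreal (\<rho> ^ DIM('a)) * (\<integral>\<^sup>+z. ennreal \<bar>w ((y + \<rho> *\<^sub>R z) + (x - y)) - w (y + \<rho> *\<^sub>R z)\<bar> \<partial>lborel)
     = shift_var w (x - y)"
    by (rule nn_integral_lborel_affine[of "\<lambda>s. ennreal \<bar>w (s + (x - y)) - w s\<bar>" \<rho> y, symmetric]) (use \<rho> in auto)
  also have "ennreal (1 / \<rho> ^ DIM('a)) * shift_var w (x - y) \<le> ennreal (1 / \<rho> ^ DIM('a)) * ennreal (M * norm (x - y))"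
    using sb by (intro mult_left_mono) (auto simp: shift_bounded_def)
  also have "\<dots> = ennreal (M / \<rho> ^ DIM('a) * norm (x - y))"
    using \<rho> M by (simp add: ennreal_mult[symmetric])
  finally show ?thesis using M \<rho> by simp
qed

text \<open>Both terms are integrals over the unit ball, of w(x) and of w(x + \<rho> z). After
  exchanging the integrals each z contributes the cost of a shift of length at most \<rho>.\<close>

lemma ball_avg_approx:
  fixes w :: "'a::euclidean_space \<Rightarrow> real"
  assumes w: "loc_int w" and sb: "shift_bounded M w" and \<rho>: "0 < \<rho>"
  shows "(\<integral>\<^sup>+x. ennreal \<bar>measure lborel (ball (0::'a) 1) * w x - ball_avg \<rho> w x\<bar> \<partial>lborel)
     \<le> ennreal (M * \<rho> * measure lborel (ball (0::'a) 1))"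
proof -
  have [measurable]: "w \<in> borel_measurable borel" using sb by (auto simp: shift_bounded_def)
  have "(\<integral>\<^sup>+x. ennreal \<bar>measure lborel (ball (0::'a) 1) * w x - ball_avg \<rho> w x\<bar> \<partial>lborel)
    \<le> (\<integral>\<^sup>+x. indicator UNIV x * (\<integral>\<^sup>+z. indicator (ball 0 1) z * ennreal \<bar>w (x + \<rho> *\<^sub>R z) - w x\<bar> \<partial>lborel) \<partial>lborel)"
  proof (intro nn_integral_mono)
    fix x :: 'a
    let ?g = "\<lambda>z. indicator (ball 0 1) z * w x - indicator (ball 0 1) z * w (x + \<rho> *\<^sub>R z)"
    have i1: "integrable lborel (\<lambda>z::'a. indicator (ball 0 1) z * w x)"
      using emeasure_lborel_ball_finite[of "0::'a" 1]
      by (intro integrable_mult_left integrable_real_indicator) auto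
    have int: "integrable lborel ?g"
      by (intro Bochner_Integration.integrable_diff ball_avg_integrable w \<rho> i1)
    have "measure lborel (ball (0::'a) 1) * w x - ball_avg \<rho> w x = (LINT z|lborel. ?g z)"
      unfolding ball_avg_def
      by (subst Bochner_Integration.integral_diff[OF i1 ball_avg_integrable[OF w \<rho>]]) simp
    then have "ennreal \<bar>measure lborel (ball (0::'a) 1) * w x - ball_avg \<rho> w x\<bar> \<le> (\<integral>\<^sup>+z. ennreal \<bar>?g z\<bar> \<partial>lborel)"
      using integral_norm_bound_ennreal[OF int] by simp
    also have "\<dots> \<le> (\<integral>\<^sup>+z. indicator (ball 0 1) z * ennreal \<bar>w (x + \<rho> *\<^sub>R z) - w x\<bar> \<partial>lborel)"
      by (intro nn_integral_mono) (auto simp: indicator_def)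
    finally show "ennreal \<bar>measure lborel (ball (0::'a) 1) * w x - ball_avg \<rho> w x\<bar> \<le> 
       indicator UNIV x * (\<integral>\<^sup>+z. indicator (ball 0 1) z * ennreal \<bar>w (x + \<rho> *\<^sub>R z) - w x\<bar> \<partial>lborel)" by simp
  qed
  also have "\<dots> = (\<integral>\<^sup>+z. indicator (ball 0 1) z * (\<integral>\<^sup>+x. indicator UNIV x * ennreal \<bar>w (x + \<rho> *\<^sub>R z) - w x\<bar> \<partial>lborel) \<partial>lborel)"
    by (rule nn_integral_shift_swap) auto
  also have "\<dots> \<le> ennreal (M * \<rho> * measure lborel (ball (0::'a) 1))"
    using shift_bounded_avg[OF sb, of \<rho>] \<rho> by simp
  finally show ?thesis .
qed

section \<open>Extraction of a locally convergent subsequence\<close>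

lemma ennreal_le_add: "\<lbrakk>0 \<le> b; 0 \<le> c; a \<le> b + c\<rbrakk> \<Longrightarrow> ennreal a \<le> ennreal b + ennreal c"
  by (subst ennreal_plus[symmetric]) (auto simp del: ennreal_plus intro: ennreal_leI)

lemma shift_bounded_diff:
  assumes "shift_bounded M u" "shift_bounded M' v"
  shows "shift_bounded (M + M') (\<lambda>x. u x - v x)"
proof -
  have [measurable]: "u \<in> borel_measurable borel" "v \<in> borel_measurable borel" and M: "0 \<le> M" "0 \<le> M'"
    using assms by (auto simp: shift_bounded_def)
  have "(\<integral>\<^sup>+x. ennreal \<bar>u (x + h) - v (x + h) - (u x - v x)\<bar> \<partial>lborel) \<le> ennreal ((M + M') * norm h)" for h
  proof -
    have "(\<integral>\<^sup>+x. ennreal \<bar>u (x + h) - v (x + h) - (u x - v x)\<bar> \<partial>lborel) 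
      \<le> (\<integral>\<^sup>+x. ennreal \<bar>u (x + h) - u x\<bar> + ennreal \<bar>v (x + h) - v x\<bar> \<partial>lborel)"
      by (intro nn_integral_mono) (intro ennreal_le_add, simp, simp, linarith)
    also have "\<dots> = shift_var u h + shift_var v h"
      by (rule nn_integral_add) measurable
    also have "\<dots> \<le> ennreal (M * norm h) + ennreal (M' * norm h)"
      using assms by (intro add_mono) (auto simp: shift_bounded_def)
    also have "\<dots> = ennreal ((M + M') * norm h)"
      using M by (simp add: ennreal_plus[symmetric] distrib_right del: ennreal_plus)
    finally show ?thesis .
  qed
  then show ?thesis using M unfolding shift_bounded_def by simp
qed

lemma loc_int_diff:
  assumes "loc_int u" "loc_int v"
  shows "loc_int (\<lambda>x. u x - v x)"
proof -
  have [measurable]: "u \<in> borel_measurable borel" "v \<in> borel_measurable borel"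
    using assms by (auto simp: loc_int_def)
  have "(\<integral>\<^sup>+y. indicator (ball 0 R) y * ennreal \<bar>u y - v y\<bar> \<partial>lborel) < \<infinity>" for R
  proof -
    have "(\<integral>\<^sup>+y. indicator (ball 0 R) y * ennreal \<bar>u y - v y\<bar> \<partial>lborel)
      \<le> (\<integral>\<^sup>+y. indicator (ball 0 R) y * ennreal \<bar>u y\<bar> + indicator (ball 0 R) y * ennreal \<bar>v y\<bar> \<partial>lborel)"
      by (intro nn_integral_mono) (auto simp: indicator_def simp del: ennreal_plus intro!: ennreal_le_add)
    also have "\<dots> = (\<integral>\<^sup>+y. indicator (ball 0 R) y * ennreal \<bar>u y\<bar> \<partial>lborel) + (\<integral>\<^sup>+y. indicator (ball 0 R) y * ennreal \<bar>v y\<bar> \<partial>lborel)"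
      by (rule nn_integral_add) measurable
    also have "\<dots> < \<infinity>" using assms by (simp add: loc_int_def)
    finally show ?thesis .
  qed
  then show ?thesis unfolding loc_int_def by simp
qed


text \<open>For a fixed radius the averages are locally bounded and equi-Lipschitz, so convergence
  on a countable dense set spreads to every point, and dominated convergence makes it convergence in
  mean on balls. One subsequence serves all radii 1/(j+1), and averages of small radius are close to
  the functions uniformly in n.\<close>

lemma shift_compact:
  fixes u :: "nat \<Rightarrow> 'a::euclidean_space \<Rightarrow> real"
  assumes sb: "\<And>n. shift_bounded M (u n)"
    and bd: "\<And>R. \<exists>B. \<forall>n. (\<integral>\<^sup>+x. indicator (ball 0 R) x * ennreal \<bar>u n x\<bar> \<partial>lborel) \<le> ennreal B"
  obtains \<sigma> :: "nat \<Rightarrow> nat" where "strict_mono \<sigma>"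
    "\<And>R e. 0 < e \<Longrightarrow> \<exists>n0. \<forall>m\<ge>n0. \<forall>n\<ge>n0.
       (\<integral>\<^sup>+x. indicator (ball 0 R) x * ennreal \<bar>u (\<sigma> m) x - u (\<sigma> n) x\<bar> \<partial>lborel) \<le> ennreal e"
proof -
  have [measurable]: "u n \<in> borel_measurable borel" and M: "0 \<le> M" for n
    using sb by (auto simp: shift_bounded_def)
  have "\<exists>B\<ge>0. \<forall>n. (\<integral>\<^sup>+x. indicator (ball 0 R) x * ennreal \<bar>u n x\<bar> \<partial>lborel) \<le> ennreal B" for R
  proof -
    obtain B where "\<forall>n. (\<integral>\<^sup>+x. indicator (ball 0 R) x * ennreal \<bar>u n x\<bar> \<partial>lborel) \<le> ennreal B"
      using bd by blast
    moreover have "ennreal B \<le> ennreal (max B 0)" by (intro ennreal_leI) simp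
    ultimately show ?thesis by (intro exI[of _ "max B 0"]) (auto intro: order_trans)
  qed
  then obtain Bd where Bd: "\<And>R. 0 \<le> Bd R"
    "\<And>R n. (\<integral>\<^sup>+x. indicator (ball 0 R) x * ennreal \<bar>u n x\<bar> \<partial>lborel) \<le> ennreal (Bd R)"
    by metis
  have li: "loc_int (u n)" for n
    unfolding loc_int_def using le_less_trans[OF Bd(2)] by auto
  define \<rho> where "\<rho> j = 1 / real (Suc j)" for j
  have \<rho>: "0 < \<rho> j" for j by (simp add: \<rho>_def)
  obtain D :: "'a set" where D: "countable D" "\<And>U. open U \<Longrightarrow> U \<noteq> {} \<Longrightarrow> \<exists>d\<in>D. d \<in> U"
    using countable_dense_setE by blast
  define c where "c R j = Bd (R + \<rho> j) / \<rho> j ^ DIM('a)" for R j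
  have c0: "0 \<le> c R j" for R j using Bd(1) \<rho> by (simp add: c_def less_imp_le)
  have avg_bd: "\<bar>ball_avg (\<rho> j) (u n) x\<bar> \<le> c R j" if "norm x \<le> R" for n x j R
    unfolding c_def by (rule ball_avg_bound[OF li \<rho> _ Bd(1) Bd(2)]) (use that in simp)
  \<comment> \<open>The diagonal extraction expects one bound for all values. Dividing by a bound
    that does not depend on n provides it and is undone by multiplication.\<close>
  define f where "f n = (\<lambda>(x, j). ball_avg (\<rho> j) (u n) x / (1 + c (norm x) j))" for n
  have "norm (f n y) \<le> 1" for n y
  proof (cases y)
    case (Pair x j)
    show ?thesis
      using avg_bd[OF order_refl, of j n x] c0[of "norm x" j] unfolding f_def Pair by simp
  qed
  moreover have "countable (D \<times> (UNIV :: nat set))" using D by simp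
  ultimately obtain \<sigma> :: "nat \<Rightarrow> nat" where \<sigma>: "strict_mono \<sigma>" 
    "\<And>y. y \<in> D \<times> UNIV \<Longrightarrow> \<exists>l. (\<lambda>n. f (\<sigma> n) y) \<longlonglongrightarrow> l"
    using function_convergent_subsequence[of "D \<times> (UNIV :: nat set)" f 1] by metis
  let ?A = "\<lambda>j n x. ball_avg (\<rho> j) (u (\<sigma> n)) x"
  have CD: "Cauchy (\<lambda>n. ?A j n x)" if xD: "x \<in> D" for x j
  proof -
    obtain l where "(\<lambda>n. f (\<sigma> n) (x, j)) \<longlonglongrightarrow> l" using \<sigma>(2)[of "(x, j)"] xD by auto
    then have "(\<lambda>n. (1 + c (norm x) j) * f (\<sigma> n) (x, j)) \<longlonglongrightarrow> (1 + c (norm x) j) * l"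
      by (intro tendsto_intros)
    moreover have "(1 + c (norm x) j) * f (\<sigma> n) (x, j) = ?A j n x" for n
      using c0[of "norm x" j] unfolding f_def by simp
    ultimately show ?thesis by (simp add: LIMSEQ_imp_Cauchy)
  qed
  have lip: "\<bar>?A j n x - ?A j n y\<bar> \<le> M / \<rho> j ^ DIM('a) * norm (x - y)" for j n x y
    by (rule ball_avg_lipschitz[OF li sb \<rho>])
  have Cauchy_A: "Cauchy (\<lambda>n. ?A j n x)" for x j
  proof (rule metric_CauchyI)
    fix e :: real assume e: "0 < e"
    define L where "L = M / \<rho> j ^ DIM('a)"
    have L: "0 \<le> L" using M \<rho> by (simp add: L_def less_imp_le)
    have "0 < e / (3 * (L + 1))" using e L by simp
    then obtain d where d: "d \<in> D" "d \<in> ball x (e / (3 * (L + 1)))"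
      using D(2)[of "ball x (e / (3 * (L + 1)))"] by auto
    have "L * norm (x - d) \<le> L * (e / (3 * (L + 1)))"
      using d L by (intro mult_left_mono) (auto simp: dist_norm)
    also have "\<dots> < (L + 1) * (e / (3 * (L + 1)))"
      using \<open>0 < e / (3 * (L + 1))\<close> by (intro mult_strict_right_mono) auto
    also have "\<dots> = e / 3"
      using L mult_divide_mult_cancel_left[of "L + 1" e 3] by (simp add: mult.commute)
    finally have close: "\<bar>?A j n x - ?A j n d\<bar> < e / 3" for n
      using lip[of j n x d] unfolding L_def by linarith
    obtain n0 where n0: "\<And>m n. m \<ge> n0 \<Longrightarrow> n \<ge> n0 \<Longrightarrow> dist (?A j m d) (?A j n d) < e / 3"
      using metric_CauchyD[OF CD[OF d(1)], of "e / 3" j] e by auto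
    have "dist (?A j m x) (?A j n x) < e" if "m \<ge> n0" "n \<ge> n0" for m n
      using n0[OF that] close[of m] close[of n] unfolding dist_real_def by linarith
    then show "\<exists>n0. \<forall>m\<ge>n0. \<forall>n\<ge>n0. dist (?A j m x) (?A j n x) < e" by blast
  qed
  define Li where "Li j x = lim (\<lambda>n. ?A j n x)" for j x
  have Li: "(\<lambda>n. ?A j n x) \<longlonglongrightarrow> Li j x" for j x
    unfolding Li_def using Cauchy_A real_Cauchy_convergent convergent_LIMSEQ_iff by blast
  have [measurable]: "(\<lambda>x. ?A j n x) \<in> borel_measurable borel" for j n
  proof (intro borel_measurable_continuous_onI)
    have "(M / \<rho> j ^ DIM('a))-lipschitz_on UNIV (\<lambda>x. ?A j n x)"
      using lip M \<rho> by (intro lipschitz_onI) (auto simp: dist_norm less_imp_le)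
    then show "continuous_on UNIV (\<lambda>x. ?A j n x)" by (rule lipschitz_on_continuous_on)
  qed
  have [measurable]: "Li j \<in> borel_measurable borel" for j
    by (rule borel_measurable_LIMSEQ_real[of borel "\<lambda>n x. ?A j n x"]) (use Li in auto)
  have Li_bd: "\<bar>Li j x\<bar> \<le> c R j" if "norm x \<le> R" for j x R
    by (rule LIMSEQ_le_const2[OF tendsto_rabs[OF Li]]) (use avg_bd that in auto)
  let ?G = "\<lambda>R j n. (\<integral>\<^sup>+x. indicator (ball 0 R) x * ennreal \<bar>?A j n x - Li j x\<bar> \<partial>lborel)"
  have G: "(\<lambda>n. ?G R j n) \<longlonglongrightarrow> 0" for R j
  proof -
    have "(\<lambda>n. ?G R j n) \<longlonglongrightarrow> (\<integral>\<^sup>+x. 0 \<partial>(lborel :: 'a measure))"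
    proof (rule nn_integral_dominated_convergence[where w="\<lambda>x. ennreal (2 * c R j) * indicator (ball 0 R) x"])
      have "(\<integral>\<^sup>+x. ennreal (2 * c R j) * indicator (ball 0 R) x \<partial>(lborel :: 'a measure)) = ennreal (2 * c R j) * emeasure lborel (ball (0::'a) R)"
        by (simp add: nn_integral_cmult_indicator)
      also have "\<dots> < \<infinity>" using emeasure_lborel_ball_finite[of "0::'a" R] by (simp add: ennreal_mult_less_top)
      finally show "(\<integral>\<^sup>+x. ennreal (2 * c R j) * indicator (ball 0 R) x \<partial>(lborel :: 'a measure)) < \<infinity>" .
      have "\<bar>?A j n x - Li j x\<bar> \<le> 2 * c R j" if "norm x \<le> R" for n x
        using avg_bd[OF that, of j "\<sigma> n"] Li_bd[OF that, of j] by linarith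
      then show "AE x in lborel. indicator (ball 0 R) x * ennreal \<bar>?A j n x - Li j x\<bar> \<le> ennreal (2 * c R j) * indicator (ball 0 R) x" for n
        by (intro AE_I2) (auto simp: indicator_def intro!: ennreal_leI)
      have "(\<lambda>n. \<bar>?A j n x - Li j x\<bar>) \<longlonglongrightarrow> 0" for x
        using tendsto_rabs[OF tendsto_diff[OF Li[of j x] tendsto_const[of "Li j x"]]] by simp
      then have "(\<lambda>n. ennreal \<bar>?A j n x - Li j x\<bar>) \<longlonglongrightarrow> ennreal 0" for x
        by (rule tendsto_ennrealI)
      then show "AE x in lborel. (\<lambda>n. indicator (ball 0 R) x * ennreal \<bar>?A j n x - Li j x\<bar>) \<longlonglongrightarrow> 0"
        by (intro AE_I2) (simp add: indicator_def)
    qed (measurable)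
    then show ?thesis by simp
  qed
  have "\<exists>n0. \<forall>m\<ge>n0. \<forall>n\<ge>n0. (\<integral>\<^sup>+x. indicator (ball 0 R) x * ennreal \<bar>u (\<sigma> m) x - u (\<sigma> n) x\<bar> \<partial>lborel) \<le> ennreal e"
    if e: "0 < e" for R e
  proof -
    define \<omega> where "\<omega> = measure lborel (ball (0::'a) 1)"
    have \<omega>: "0 < \<omega>" unfolding \<omega>_def by (rule ball_measure_pos)
    \<comment> \<open>A difference of two members has shift constant 2M, so with this radius its
      distance to the averages costs at most e/2; the two averages cost e/4 each.\<close>
    obtain j where "4 * M / e < real j" using reals_Archimedean2 by blast
    then have "4 * M < real (Suc j) * e" using e by (simp add: field_simps)
    then have j: "2 * M * \<rho> j \<le> e / 2" by (simp add: \<rho>_def field_simps)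
    have "\<forall>\<^sub>F n in sequentially. ?G R j n < ennreal (\<omega> * e / 4)"
      by (rule order_tendstoD(2)[OF G]) (use \<omega> e in simp)
    then obtain n0 where n0: "\<And>n. n \<ge> n0 \<Longrightarrow> ?G R j n \<le> ennreal (\<omega> * e / 4)"
      unfolding eventually_sequentially by (meson less_imp_le)
    have "(\<integral>\<^sup>+x. indicator (ball 0 R) x * ennreal \<bar>u (\<sigma> m) x - u (\<sigma> n) x\<bar> \<partial>lborel) \<le> ennreal e"
      if mn: "m \<ge> n0" "n \<ge> n0" for m n
    proof -
      let ?w = "\<lambda>x. u (\<sigma> m) x - u (\<sigma> n) x"
      have w: "loc_int ?w" "shift_bounded (M + M) ?w"
        by (intro loc_int_diff li shift_bounded_diff sb)+
      have [measurable]: "ball_avg (\<rho> j) ?w \<in> borel_measurable borel"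
        unfolding ball_avg_diff[OF li li \<rho>, abs_def] by measurable
      have "ennreal \<omega> * (\<integral>\<^sup>+x. indicator (ball 0 R) x * ennreal \<bar>?w x\<bar> \<partial>lborel)
         = (\<integral>\<^sup>+x. ennreal \<omega> * (indicator (ball 0 R) x * ennreal \<bar>?w x\<bar>) \<partial>lborel)"
        by (rule nn_integral_cmult[symmetric]) measurable
      also have "\<dots> \<le> (\<integral>\<^sup>+x. (ennreal \<bar>\<omega> * ?w x - ball_avg (\<rho> j) ?w x\<bar>
          + indicator (ball 0 R) x * ennreal \<bar>?A j m x - Li j x\<bar>)
          + indicator (ball 0 R) x * ennreal \<bar>?A j n x - Li j x\<bar> \<partial>lborel)"
      proof (intro nn_integral_mono)
        fix x :: 'a
        have "ennreal \<omega> * ennreal \<bar>?w x\<bar> = ennreal \<bar>\<omega> * ?w x\<bar>"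
          using \<omega> by (simp add: ennreal_mult[symmetric] abs_mult)
        also have "\<dots> \<le> ennreal (\<bar>\<omega> * ?w x - ball_avg (\<rho> j) ?w x\<bar> + \<bar>?A j m x - Li j x\<bar>) + ennreal \<bar>?A j n x - Li j x\<bar>"
          unfolding ball_avg_diff[OF li li \<rho>] by (intro ennreal_le_add) auto
        finally show "ennreal \<omega> * (indicator (ball 0 R) x * ennreal \<bar>?w x\<bar>) \<le> (ennreal \<bar>\<omega> * ?w x - ball_avg (\<rho> j) ?w x\<bar>
          + indicator (ball 0 R) x * ennreal \<bar>?A j m x - Li j x\<bar>)
          + indicator (ball 0 R) x * ennreal \<bar>?A j n x - Li j x\<bar>"
          by (auto simp: indicator_def)
      qed
      also have "\<dots> = ((\<integral>\<^sup>+x. ennreal \<bar>\<omega> * ?w x - ball_avg (\<rho> j) ?w x\<bar> \<partial>lborel) + ?G R j m) + ?G R j n"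
        by (subst nn_integral_add, measurable, subst nn_integral_add, measurable)
      also have "\<dots> \<le> (ennreal ((M + M) * \<rho> j * \<omega>) + ennreal (\<omega> * e / 4)) + ennreal (\<omega> * e / 4)"
        unfolding \<omega>_def by (intro add_mono ball_avg_approx w \<rho>) (use n0 mn in \<open>auto simp: \<omega>_def\<close>)
      also have "\<dots> = ennreal (\<omega> * (2 * M * \<rho> j) + \<omega> * e / 2)"
        using M \<rho>[of j] \<omega> e by (simp add: ennreal_plus[symmetric] algebra_simps del: ennreal_plus)
      also have "\<dots> \<le> ennreal (\<omega> * e)"
      proof (intro ennreal_leI)
        have "\<omega> * (2 * M * \<rho> j) \<le> \<omega> * (e / 2)" using j \<omega> by (intro mult_left_mono) auto
        then show "\<omega> * (2 * M * \<rho> j) + \<omega> * e / 2 \<le> \<omega> * e" by (simp add: field_simps)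
      qed
      also have "\<dots> = ennreal \<omega> * ennreal e" using \<omega> e by (simp add: ennreal_mult)
      finally show ?thesis
        using \<omega> by (subst (asm) ennreal_mult_le_mult_iff) auto
    qed
    then show ?thesis by blast
  qed
  with \<sigma>(1) show ?thesis by (rule that)
qed

subsection \<open>Translation bounds for functions of bounded variation\<close>

text \<open>The derivative is an argument, so that products and multiples come with explicit
  derivatives. Continuity is asked for each direction separately, as in \<open>C1c_fields\<close>;
  in finite dimension this is continuity of the derivative.\<close>

definition C1_with :: "('a::euclidean_space \<Rightarrow> real) \<Rightarrow> ('a \<Rightarrow> 'a \<Rightarrow> real) \<Rightarrow> bool" where
  "C1_with \<phi> d \<longleftrightarrow> (\<forall>x. (\<phi> has_derivative d x) (at x)) \<and> (\<forall>v. continuous_on UNIV (\<lambda>x. d x v))"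

lemma C1_with_continuous: "C1_with \<phi> d \<Longrightarrow> continuous_on S \<phi>"
  unfolding C1_with_def
  by (meson continuous_at_imp_continuous_on has_derivative_continuous)

lemma C1_with_mult:
  assumes "C1_with f f'" "C1_with g g'"
  shows "C1_with (\<lambda>x. f x * g x) (\<lambda>x v. f x * g' x v + f' x v * g x)"
  using assms C1_with_continuous[OF assms(1)] C1_with_continuous[OF assms(2)]
  unfolding C1_with_def by (auto intro!: has_derivative_mult continuous_intros)

lemma C1_with_cmult:
  assumes "C1_with f f'" shows "C1_with (\<lambda>x. c * f x) (\<lambda>x v. c * f' x v)"
  using assms unfolding C1_with_def by (auto intro!: has_derivative_mult_right continuous_intros)

lemma C1_polynomial:
  fixes p :: "'a::euclidean_space \<Rightarrow> real"
  assumes "real_polynomial_function p" shows "\<exists>d. C1_with p d"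
  using assms
proof induction
  case (linear f)
  then have "C1_with f (\<lambda>x. f)"
    unfolding C1_with_def by (auto intro: bounded_linear_imp_has_derivative)
  then show ?case by blast
next
  case (const c)
  have "C1_with (\<lambda>x. c) (\<lambda>x v. 0)" unfolding C1_with_def by auto
  then show ?case by blast
next
  case (add f g)
  then obtain f' g' where "C1_with f f'" "C1_with g g'" by blast
  then have "C1_with (\<lambda>x. f x + g x) (\<lambda>x v. f' x v + g' x v)"
    unfolding C1_with_def by (auto intro!: has_derivative_add continuous_intros)
  then show ?case by blast
next
  case (mult f g)
  then show ?case using C1_with_mult by blast
qed

section \<open>A C^1 cutoff and the dual description of the L^1 norm\<close>

lemma has_real_derivative_pos_part_square:
  "((\<lambda>s::real. (max 0 s)\<^sup>2) has_real_derivative 2 * max 0 s) (at s)"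
proof -
  consider "s < 0" | "s = 0" | "s > 0" by linarith
  then show ?thesis
  proof cases
    case 1
    have "((\<lambda>s::real. 0) has_real_derivative 0) (at s)" by simp
    then have "((\<lambda>s::real. (max 0 s)\<^sup>2) has_real_derivative 0) (at s)"
      by (rule DERIV_cong_ev[THEN iffD1, rotated 3, OF _ refl _ refl])
         (auto intro!: eventually_nhds_in_open[of "{..<0}", THEN eventually_mono] simp: 1)
    then show ?thesis using 1 by simp
  next
    case 2
    have "((\<lambda>h::real. (max 0 h)\<^sup>2 / h) \<longlongrightarrow> 0) (at 0)"
    proof (rule Lim_null_comparison[where g="\<lambda>h. \<bar>h\<bar>"])
      have "norm ((max 0 h)\<^sup>2 / h) \<le> \<bar>h\<bar>" for h :: real
        by (auto simp: max_def power2_eq_square)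
      then show "\<forall>\<^sub>F h in at 0. norm ((max 0 h)\<^sup>2 / h) \<le> \<bar>h\<bar>" by simp
      show "((\<lambda>h::real. \<bar>h\<bar>) \<longlongrightarrow> 0) (at 0)"
        by (rule tendsto_eq_intros refl | simp)+
    qed
    then show ?thesis using 2 by (simp add: DERIV_def)
  next
    case 3
    have "((\<lambda>s::real. s\<^sup>2) has_real_derivative 2 * s) (at s)" by (auto intro!: derivative_eq_intros)
    then have "((\<lambda>s::real. (max 0 s)\<^sup>2) has_real_derivative 2 * s) (at s)"
      by (rule DERIV_cong_ev[THEN iffD1, rotated 3, OF _ refl _ refl])
         (auto intro!: eventually_nhds_in_open[of "{0<..}", THEN eventually_mono] simp: 3)
    then show ?thesis using 3 by simp
  qed
qed

text \<open>A C^1 bump that vanishes outside the ball of radius R. Squaring the positive part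
  removes the kink on the sphere |x| = R. The bump increases to 1 as R grows, which serves the final
  exhaustion of the space.\<close>

definition cutoff :: "real \<Rightarrow> 'a::euclidean_space \<Rightarrow> real" where
  "cutoff R x = (max 0 (1 - (x \<bullet> x) / R\<^sup>2))\<^sup>2"

lemma cutoff_bounds: "0 < R \<Longrightarrow> 0 \<le> cutoff R x" "0 < R \<Longrightarrow> cutoff R x \<le> 1"
  unfolding cutoff_def by (auto simp: power_le_one)

lemma cutoff_zero:
  assumes "0 < R" "R \<le> norm x" shows "cutoff R x = 0"
proof -
  have "R\<^sup>2 \<le> (norm x)\<^sup>2" using assms by (intro power_mono) auto
  then have "R\<^sup>2 \<le> x \<bullet> x" by (simp add: power2_norm_eq_inner)
  then show ?thesis using assms by (simp add: cutoff_def)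
qed

lemma cutoff_C1:
  shows "\<exists>d. C1_with (cutoff R :: 'a::euclidean_space \<Rightarrow> real) d"
proof -
  define c where "c = inverse (R\<^sup>2)"
  have cut: "cutoff R = (\<lambda>x::'a. (max 0 (1 - (x \<bullet> x) * c))\<^sup>2)"
    by (simp add: cutoff_def fun_eq_iff divide_inverse c_def)
  let ?d = "\<lambda>x v::'a. 2 * max 0 (1 - (x \<bullet> x) * c) * - ((x \<bullet> v + v \<bullet> x) * c)"
  have "((cutoff R :: 'a \<Rightarrow> real) has_derivative ?d x) (at x)" for x :: 'a
  proof -
    have "((\<lambda>x::'a. 1 - (x \<bullet> x) * c) has_derivative (\<lambda>v. - ((x \<bullet> v + v \<bullet> x) * c))) (at x)"
      by (auto intro!: derivative_eq_intros)
    from has_derivative_compose[OF this has_real_derivative_pos_part_square[unfolded has_field_derivative_def]]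
    show ?thesis unfolding cut .
  qed
  then have "C1_with (cutoff R :: 'a \<Rightarrow> real) ?d"
    unfolding C1_with_def by (auto intro!: continuous_intros)
  then show ?thesis by blast
qed

lemma loc_int_mult:
  fixes w \<psi> :: "'a::euclidean_space \<Rightarrow> real"
  assumes "loc_int w" and [measurable]: "\<psi> \<in> borel_measurable borel" 
    and \<psi>: "\<And>x. \<bar>\<psi> x\<bar> \<le> C" "\<And>x. R \<le> norm x \<Longrightarrow> \<psi> x = 0" "0 \<le> C"
  shows "integrable lborel (\<lambda>x. w x * \<psi> x)"
    and "\<bar>LINT x|lborel. w x * \<psi> x\<bar> \<le> C * enn2real (\<integral>\<^sup>+x. indicator (ball 0 R) x * ennreal \<bar>w x\<bar> \<partial>lborel)"
proof -
  have [measurable]: "w \<in> borel_measurable borel" using assms by (simp add: loc_int_def)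
  let ?I = "(\<integral>\<^sup>+x. indicator (ball 0 R) x * ennreal \<bar>w x\<bar> \<partial>lborel)"
  have fin: "?I < \<infinity>" using assms by (simp add: loc_int_def)
  have "(\<integral>\<^sup>+x. ennreal (norm (w x * \<psi> x)) \<partial>lborel) \<le> (\<integral>\<^sup>+x. ennreal C * (indicator (ball 0 R) x * ennreal \<bar>w x\<bar>) \<partial>lborel)"
  proof (intro nn_integral_mono)
    fix x
    show "ennreal (norm (w x * \<psi> x)) \<le> ennreal C * (indicator (ball 0 R) x * ennreal \<bar>w x\<bar>)"
    proof (cases "R \<le> norm x")
      case False
      have "norm (w x * \<psi> x) \<le> C * \<bar>w x\<bar>"
        using \<psi>(1)[of x] by (simp add: abs_mult mult.commute mult_right_mono)
      then show ?thesis using False \<psi>(3) by (simp add: ennreal_mult[symmetric] ennreal_leI)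
    qed (use \<psi> in simp)
  qed
  also have "\<dots> = ennreal C * ?I" by (rule nn_integral_cmult) measurable
  finally have *: "(\<integral>\<^sup>+x. ennreal (norm (w x * \<psi> x)) \<partial>lborel) \<le> ennreal C * ?I" .
  also have "\<dots> < \<infinity>" using fin by (simp add: ennreal_mult_less_top)
  finally show int: "integrable lborel (\<lambda>x. w x * \<psi> x)"
    by (intro integrableI_bounded) auto
  have "ennreal \<bar>LINT x|lborel. w x * \<psi> x\<bar> \<le> ennreal C * ?I"
    using order_trans[OF integral_norm_bound_ennreal[OF int] *] by simp
  also have "\<dots> = ennreal (C * enn2real ?I)"
    using fin \<psi>(3) by (simp add: ennreal_mult)
  finally show "\<bar>LINT x|lborel. w x * \<psi> x\<bar> \<le> C * enn2real ?I"
    using \<psi>(3) by simp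
qed

text \<open>Stone-Weierstrass takes the place of mollification: on the closed ball g is within
  \<epsilon> of a polynomial p, and the cutoff times p is a C^1 function of size at most 1 +
  \<epsilon>. Outside the ball the cutoff hides the growth of p.\<close>

lemma dual_bound_continuous:
  fixes w g :: "'a::euclidean_space \<Rightarrow> real"
  assumes w: "loc_int w" and M: "0 \<le> M" and R: "0 < R"
    and test: "\<And>\<phi> d r. C1_with \<phi> d \<Longrightarrow> (\<And>x. r \<le> norm x \<Longrightarrow> \<phi> x = 0) \<Longrightarrow> (\<And>x. \<bar>\<phi> x\<bar> \<le> 1) \<Longrightarrow> (LINT x|lborel. w x * \<phi> x) \<le> M"
    and g: "continuous_on UNIV g" "\<And>x. \<bar>g x\<bar> \<le> 1"
  shows "(LINT x|lborel. w x * (cutoff R x * g x)) \<le> M"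
proof -
  define I where "I = enn2real (\<integral>\<^sup>+x. indicator (ball 0 R) x * ennreal \<bar>w x\<bar> \<partial>lborel)"
  have I0: "0 \<le> I" by (simp add: I_def)
  obtain cd where cd: "C1_with (cutoff R :: 'a \<Rightarrow> real) cd" using cutoff_C1 by blast
  have cb: "0 \<le> cutoff R x" "cutoff R x \<le> 1" for x :: 'a using cutoff_bounds[OF R] by auto
  have [measurable]: "(cutoff R :: 'a \<Rightarrow> real) \<in> borel_measurable borel" "g \<in> borel_measurable borel"
    using C1_with_continuous[OF cd] g by (auto intro: borel_measurable_continuous_onI)
  have key: "(LINT x|lborel. w x * (cutoff R x * g x)) \<le> M + \<epsilon> * (M + I)" if \<epsilon>: "0 < \<epsilon>" for \<epsilon>
  proof -
    have "continuous_on (cball 0 R) g" using g(1) by (rule continuous_on_subset) auto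
    then obtain p where p: "real_polynomial_function p" "\<And>x. x \<in> cball 0 R \<Longrightarrow> \<bar>g x - p x\<bar> < \<epsilon>"
      using Stone_Weierstrass_real_polynomial_function[OF compact_cball _ \<epsilon>, of "0::'a" R g] by blast
    obtain pd where pd: "C1_with p pd" using C1_polynomial[OF p(1)] by blast
    have [measurable]: "p \<in> borel_measurable borel"
      using C1_with_continuous[OF pd] by (rule borel_measurable_continuous_onI)
    \<comment> \<open>Dividing by 1 + \<epsilon> meets the size constraint on test functions; the
      undivided product is then bounded by (1 + \<epsilon>) M.\<close>
    let ?\<phi> = "\<lambda>x. (1 / (1 + \<epsilon>)) * (cutoff R x * p x)"
    have pb: "\<bar>cutoff R x * p x\<bar> \<le> 1 + \<epsilon>" for x
    proof (cases "R \<le> norm x")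
      case False
      then have "\<bar>p x\<bar> \<le> 1 + \<epsilon>" using p(2)[of x] g(2)[of x] by auto
      then have "cutoff R x * \<bar>p x\<bar> \<le> 1 * (1 + \<epsilon>)" using cb[of x] \<epsilon> by (intro mult_mono) auto
      then show ?thesis using cb[of x] by (simp add: abs_mult)
    qed (use \<epsilon> in \<open>simp add: cutoff_zero[OF R]\<close>)
    have z: "R \<le> norm x \<Longrightarrow> cutoff R x * c = 0" for x :: 'a and c by (simp add: cutoff_zero[OF R])
    have i1: "integrable lborel (\<lambda>x. w x * (cutoff R x * p x))"
      by (rule loc_int_mult[OF w, where C="1 + \<epsilon>" and R=R]) (use pb z \<epsilon> in auto)
    have eb: "\<bar>cutoff R x * (g x - p x)\<bar> \<le> \<epsilon>" for x
    proof (cases "R \<le> norm x")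
      case False
      then have "cutoff R x * \<bar>g x - p x\<bar> \<le> 1 * \<epsilon>" using cb[of x] p(2)[of x] by (intro mult_mono) auto
      then show ?thesis using cb[of x] by (simp add: abs_mult)
    qed (use \<epsilon> in \<open>simp add: cutoff_zero[OF R]\<close>)
    have i2: "integrable lborel (\<lambda>x. w x * (cutoff R x * (g x - p x)))"
      "\<bar>LINT x|lborel. w x * (cutoff R x * (g x - p x))\<bar> \<le> \<epsilon> * I"
      unfolding I_def
      by (rule loc_int_mult[OF w, where C="\<epsilon>" and R=R]; use eb z \<epsilon> in \<open>auto simp del: mult_eq_0_iff\<close>)+
    have "(LINT x|lborel. w x * ?\<phi> x) \<le> M"
    proof (rule test)
      show "C1_with ?\<phi> (\<lambda>x v. (1 / (1 + \<epsilon>)) * (cutoff R x * pd x v + cd x v * p x))"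
        by (intro C1_with_cmult C1_with_mult cd pd)
      show "?\<phi> x = 0" if "R \<le> norm x" for x using cutoff_zero[OF R that] by simp
      show "\<bar>?\<phi> x\<bar> \<le> 1" for x using pb[of x] \<epsilon> by (simp add: abs_mult)
    qed
    moreover have "(LINT x|lborel. w x * ?\<phi> x) = (1 / (1 + \<epsilon>)) * (LINT x|lborel. w x * (cutoff R x * p x))"
      by (subst integral_mult_right_zero[symmetric]) (simp add: mult_ac)
    ultimately have "(LINT x|lborel. w x * (cutoff R x * p x)) \<le> (1 + \<epsilon>) * M"
      using \<epsilon> by (simp add: field_simps)
    moreover have "(LINT x|lborel. w x * (cutoff R x * g x)) = (LINT x|lborel. w x * (cutoff R x * p x)) + (LINT x|lborel. w x * (cutoff R x * (g x - p x)))"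
      by (subst Bochner_Integration.integral_add[OF i1 i2(1), symmetric]) (simp add: algebra_simps)
    ultimately show ?thesis using i2(2) by (simp add: algebra_simps)
  qed
  show ?thesis
  proof (rule field_le_epsilon)
    fix e :: real assume e: "0 < e"
    have "0 < e / (M + I + 1)" using e M I0 by simp
    from key[OF this] have "(LINT x|lborel. w x * (cutoff R x * g x)) \<le> M + e * ((M + I) / (M + I + 1))" by simp
    also have "\<dots> \<le> M + e * 1" using e M I0 by (intro add_left_mono mult_left_mono) (auto simp: divide_le_eq_1)
    finally show "(LINT x|lborel. w x * (cutoff R x * g x)) \<le> M + e" by simp
  qed
qed

text \<open>Testing with sgn w would give the L^1 norm. A measurable function is almost everywhere a
  limit of continuous ones, which reaches sgn w times a cutoff of radius R; letting R grow gives the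
  full integral, whose finiteness is part of the conclusion.\<close>

lemma dual_bound:
  fixes w :: "'a::euclidean_space \<Rightarrow> real"
  assumes w: "loc_int w" and M: "0 \<le> M"
    and test: "\<And>\<phi> d r. C1_with \<phi> d \<Longrightarrow> (\<And>x. r \<le> norm x \<Longrightarrow> \<phi> x = 0) \<Longrightarrow> (\<And>x. \<bar>\<phi> x\<bar> \<le> 1) \<Longrightarrow> (LINT x|lborel. w x * \<phi> x) \<le> M"
  shows "(\<integral>\<^sup>+x. ennreal \<bar>w x\<bar> \<partial>lborel) \<le> ennreal M"
proof -
  have [measurable]: "w \<in> borel_measurable borel" using w by (simp add: loc_int_def)
  have [measurable]: "(cutoff R :: 'a \<Rightarrow> real) \<in> borel_measurable borel" for R
    unfolding cutoff_def by measurable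
  have "(\<lambda>x. sgn (w x)) \<in> borel_measurable lborel" by measurable
  then have "(\<lambda>x. sgn (w x)) \<in> borel_measurable lebesgue" by (rule measurable_completion)
  then have "(\<lambda>x. sgn (w x)) measurable_on UNIV"
    by (intro lebesgue_measurable_imp_measurable_on) auto
  then obtain N g where N: "negligible N" and g: "\<And>n. continuous_on UNIV (g n)"
    and lim: "\<And>x. x \<notin> N \<Longrightarrow> (\<lambda>n. g n x) \<longlonglongrightarrow> sgn (w x)"
    unfolding measurable_on_def by auto
  \<comment> \<open>Clamping to [-1, 1] leaves the limit unchanged, as sgn takes its values there,
    and yields both the size constraint and the domination.\<close>
  define G where "G n x = max (-1) (min 1 (g n x))" for n x
  have G: "continuous_on UNIV (G n)" "\<bar>G n x\<bar> \<le> 1" for n x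
    unfolding G_def using g by (auto intro!: continuous_intros)
  have [measurable]: "G n \<in> borel_measurable borel" for n
    using G(1) by (rule borel_measurable_continuous_onI)
  have Glim: "(\<lambda>n. G n x) \<longlonglongrightarrow> sgn (w x)" if "x \<notin> N" for x
  proof -
    have "(\<lambda>n. G n x) \<longlonglongrightarrow> max (-1) (min 1 (sgn (w x)))"
      unfolding G_def using lim[OF that] by (intro tendsto_intros)
    moreover have "max (-1) (min 1 (sgn (w x))) = sgn (w x)" by (simp add: sgn_if)
    ultimately show ?thesis by simp
  qed
  have "AE x in lebesgue. x \<notin> N"
    using N by (intro AE_not_in) (simp add: negligible_iff_null_sets)
  then have AEN: "AE x in lborel. x \<notin> N" by (simp add: AE_completion_iff)
  have R_bound: "(\<integral>\<^sup>+x. ennreal (cutoff R x * \<bar>w x\<bar>) \<partial>lborel) \<le> ennreal M" if R: "0 < R" for R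
  proof -
    have cb: "0 \<le> cutoff R x" "cutoff R x \<le> 1" for x :: 'a using cutoff_bounds[OF R] by auto
    have int: "integrable lborel (\<lambda>x. w x * (cutoff R x * sgn (w x)))" "integrable lborel (\<lambda>x. w x * cutoff R x)"
      by (rule loc_int_mult(1)[OF w, where C=1 and R=R], use cb in \<open>auto simp: abs_mult abs_sgn_eq cutoff_zero[OF R]\<close>)+
    have "(\<lambda>n. LINT x|lborel. w x * (cutoff R x * G n x)) \<longlonglongrightarrow> (LINT x|lborel. w x * (cutoff R x * sgn (w x)))"
    proof (rule integral_dominated_convergence[where w="\<lambda>x. \<bar>w x * cutoff R x\<bar>"])
      show "AE x in lborel. (\<lambda>n. w x * (cutoff R x * G n x)) \<longlonglongrightarrow> w x * (cutoff R x * sgn (w x))"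
        using AEN by eventually_elim (intro tendsto_intros Glim)
      show "AE x in lborel. norm (w x * (cutoff R x * G n x)) \<le> \<bar>w x * cutoff R x\<bar>" for n
      proof (intro AE_I2)
        fix x
        have "\<bar>w x * cutoff R x\<bar> * \<bar>G n x\<bar> \<le> \<bar>w x * cutoff R x\<bar> * 1"
          by (intro mult_left_mono G) auto
        then show "norm (w x * (cutoff R x * G n x)) \<le> \<bar>w x * cutoff R x\<bar>" by (simp add: abs_mult mult.assoc)
      qed
    qed (use int in \<open>auto intro: integrable_abs\<close>)
    moreover have "(LINT x|lborel. w x * (cutoff R x * G n x)) \<le> M" for n
      by (rule dual_bound_continuous[OF w M R _ G]) (rule test)
    ultimately have "(LINT x|lborel. w x * (cutoff R x * sgn (w x))) \<le> M"
      by (intro LIMSEQ_le_const2) auto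
    moreover have "w x * (cutoff R x * sgn (w x)) = cutoff R x * \<bar>w x\<bar>" for x by (auto simp: sgn_if)
    ultimately have "(LINT x|lborel. cutoff R x * \<bar>w x\<bar>) \<le> M" "integrable lborel (\<lambda>x. cutoff R x * \<bar>w x\<bar>)"
      using int by (simp_all only:)
    moreover have "(\<integral>\<^sup>+x. ennreal (cutoff R x * \<bar>w x\<bar>) \<partial>lborel) = ennreal (LINT x|lborel. cutoff R x * \<bar>w x\<bar>)"
      by (rule nn_integral_eq_integral) (use calculation cb in auto)
    ultimately show ?thesis by (simp add: ennreal_leI)
  qed
  let ?f = "\<lambda>k::nat. \<lambda>x. ennreal (cutoff (real (Suc k)) x * \<bar>w x\<bar>)"
  have "(\<lambda>k. integral\<^sup>N lborel (?f k)) \<longlonglongrightarrow> (\<integral>\<^sup>+x. ennreal \<bar>w x\<bar> \<partial>lborel)"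
  proof (rule nn_integral_LIMSEQ)
    show "incseq ?f"
    proof (rule incseq_SucI, rule le_funI, rule ennreal_leI, rule mult_right_mono)
      fix k and x :: 'a
      have "(x \<bullet> x) / (real (Suc (Suc k)))\<^sup>2 \<le> (x \<bullet> x) / (real (Suc k))\<^sup>2"
        by (intro divide_left_mono power_mono) auto
      then show "cutoff (real (Suc k)) x \<le> cutoff (real (Suc (Suc k))) x"
        unfolding cutoff_def by (intro power_mono) auto
    qed simp
    fix x :: 'a
    have "(\<lambda>k. (max 0 (1 - (x \<bullet> x) * (1 / real (Suc k))\<^sup>2))\<^sup>2 * \<bar>w x\<bar>) \<longlonglongrightarrow> (max 0 (1 - (x \<bullet> x) * 0\<^sup>2))\<^sup>2 * \<bar>w x\<bar>"
      by (intro tendsto_intros LIMSEQ_Suc[OF lim_1_over_n])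
    then have "(\<lambda>k. cutoff (real (Suc k)) x * \<bar>w x\<bar>) \<longlonglongrightarrow> \<bar>w x\<bar>"
      by (simp add: cutoff_def power_divide)
    then show "(\<lambda>k. ?f k x) \<longlonglongrightarrow> ennreal \<bar>w x\<bar>" by (rule tendsto_ennrealI)
  qed measurable
  then show ?thesis
    by (rule LIMSEQ_le_const2) (use R_bound in auto)
qed

section \<open>Test fields, divergence and total variation\<close>

lemma divergence_has_derivative:
  assumes "(\<phi> has_derivative D) (at x)"
  shows "divergence \<phi> x = (\<Sum>i\<in>UNIV. D (axis i 1) $ i)"
  using frechet_derivative_at[OF assms] by (simp add: divergence_def)

lemma C1c_has_derivative:
  "\<phi> \<in> C1c_fields \<Longrightarrow> (\<phi> has_derivative frechet_derivative \<phi> (at x)) (at x)"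
  unfolding C1c_fields_def by (auto simp: frechet_derivative_works)

lemma C1c_fieldsI:
  fixes \<phi> :: "real ^ 'n::finite \<Rightarrow> real ^ 'n"
  assumes D: "\<And>x. (\<phi> has_derivative D x) (at x)" "\<And>v. continuous_on UNIV (\<lambda>x. D x v)"
    and r: "\<And>x. r \<le> norm x \<Longrightarrow> \<phi> x = 0"
  shows "\<phi> \<in> C1c_fields"
proof -
  have "frechet_derivative \<phi> (at x) = D x" for x
    using frechet_derivative_at[OF D(1)] by simp
  moreover have "{x. \<phi> x \<noteq> 0} \<subseteq> cball 0 r"
    using r by (force simp: not_le)
  then have "compact (closure {x. \<phi> x \<noteq> 0})"
    using bounded_subset[OF bounded_cball] compact_closure by blast
  ultimately show ?thesis
    using D unfolding C1c_fields_def differentiable_def by auto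
qed

lemma C1c_scaleR:
  fixes \<phi> :: "real ^ 'n::finite \<Rightarrow> real ^ 'n"
  assumes \<phi>: "\<phi> \<in> C1c_fields"
  shows "(\<lambda>x. c *\<^sub>R \<phi> x) \<in> C1c_fields" "divergence (\<lambda>x. c *\<^sub>R \<phi> x) x = c * divergence \<phi> x"
proof -
  have D: "((\<lambda>x. c *\<^sub>R \<phi> x) has_derivative (\<lambda>v. c *\<^sub>R frechet_derivative \<phi> (at x) v)) (at x)" for x
    by (intro has_derivative_scaleR_right C1c_has_derivative \<phi>)
  have "bounded {x. \<phi> x \<noteq> 0}"
    using \<phi> bounded_subset[OF compact_imp_bounded closure_subset] unfolding C1c_fields_def by blast
  then obtain r where r: "\<And>x. \<phi> x \<noteq> 0 \<Longrightarrow> norm x \<le> r" by (auto simp: bounded_iff)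
  have z: "\<phi> x = 0" if "r + 1 \<le> norm x" for x
    using r[of x] that by (cases "\<phi> x = 0") auto
  show "(\<lambda>x. c *\<^sub>R \<phi> x) \<in> C1c_fields"
    by (rule C1c_fieldsI[OF D, of "r + 1"]) (use \<phi> z in \<open>auto simp: C1c_fields_def intro: continuous_intros\<close>)
  show "divergence (\<lambda>x. c *\<^sub>R \<phi> x) x = c * divergence \<phi> x"
    unfolding divergence_has_derivative[OF D] by (simp add: divergence_def sum_distrib_left)
qed

lemma zero_C1c: "(\<lambda>x. 0) \<in> C1c_fields"
  by (rule C1c_fieldsI[of _ "\<lambda>x v. 0" 0]) auto

lemma divergence_zero: "divergence (\<lambda>x. 0) x = 0"
  by (subst divergence_has_derivative[of _ "\<lambda>v. 0"]) auto

lemma total_variation_nonneg: "0 \<le> total_variation u"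
proof -
  have "ereal (LINT x | lebesgue. u x * divergence (\<lambda>x. 0) x) \<le> total_variation u"
    unfolding total_variation_def by (rule SUP_upper) (simp add: zero_C1c)
  then show ?thesis by (simp add: divergence_zero zero_ereal_def)
qed

text \<open>The variation is a supremum over fields of norm at most 1, and dividing by c > 0 brings
  the given field into that range. Finiteness lets the extended real be read as a real
  number.\<close>

lemma total_variation_test:
  fixes u :: "real ^ 'n::finite \<Rightarrow> real"
  assumes tv: "total_variation u < \<infinity>" and \<phi>: "\<phi> \<in> C1c_fields" "\<And>x. norm (\<phi> x) \<le> c" and c: "0 < c"
  shows "(LINT x | lebesgue. u x * divergence \<phi> x) \<le> c * real_of_ereal (total_variation u)"
proof -
  let ?\<psi> = "\<lambda>x. (1 / c) *\<^sub>R \<phi> x"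
  have "ereal (LINT x | lebesgue. u x * divergence ?\<psi> x) \<le> total_variation u"
    unfolding total_variation_def
  proof (rule SUP_upper, safe)
    show "?\<psi> \<in> C1c_fields" by (rule C1c_scaleR[OF \<phi>(1)])
    show "norm (?\<psi> x) \<le> 1" for x using \<phi>(2)[of x] c by (simp add: divide_le_eq)
  qed
  also have "total_variation u = ereal (real_of_ereal (total_variation u))"
    using tv total_variation_nonneg[of u] by (intro ereal_real'[symmetric]) auto
  finally have "(LINT x | lebesgue. (1 / c) * (u x * divergence \<phi> x)) \<le> real_of_ereal (total_variation u)"
    by (simp add: C1c_scaleR(2)[OF \<phi>(1)] mult_ac)
  then show ?thesis
    using c unfolding integral_mult_right_zero by (simp add: field_simps)
qed

text \<open>Averaging \<open>\<phi>\<close> along the segment from \<open>x - h\<close> to \<open>x\<close> gives a field in direction \<open>h\<close> whose divergence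
  is exactly a translation difference of \<open>\<phi>\<close>.\<close>

lemma translation_field:
  fixes \<phi> :: "real ^ 'n::finite \<Rightarrow> real" and h :: "real ^ 'n"
  assumes \<phi>: "C1_with \<phi> d" and supp: "\<And>x. r \<le> norm x \<Longrightarrow> \<phi> x = 0" and bd: "\<And>x. \<bar>\<phi> x\<bar> \<le> 1"
  obtains \<Phi> where "\<Phi> \<in> C1c_fields" "\<And>x. norm (\<Phi> x) \<le> norm h" "\<And>x. divergence \<Phi> x = \<phi> x - \<phi> (x - h)"
proof -
  have deriv: "(\<phi> has_derivative d x) (at x)" and cont: "continuous_on UNIV (\<lambda>x. d x v)" for x v
    using \<phi> by (auto simp: C1_with_def)
  have bl: "bounded_linear (d x)" for x using deriv by (rule has_derivative_bounded_linear)
  \<comment> \<open>The derivative is packaged as a bounded linear map depending continuously on (x,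
    t), the form in which differentiation under the integral sign applies.\<close>
  define B where "B x t = Blinfun (d (x - t *\<^sub>R h))" for x and t :: real
  have B: "blinfun_apply (B x t) = d (x - t *\<^sub>R h)" for x t
    unfolding B_def by (rule bounded_linear_Blinfun_apply[OF bl])
  define g where "g x = integral (cbox 0 1) (\<lambda>t::real. \<phi> (x - t *\<^sub>R h))" for x
  define g' where "g' x = integral (cbox 0 1) (B x)" for x
  have contB: "continuous_on (UNIV \<times> cbox 0 1) (\<lambda>(x, t). B x t)"
  proof (rule continuous_on_blinfun_componentwise)
    fix i :: "real ^ 'n"
    have "continuous_on (UNIV \<times> cbox 0 1) (\<lambda>p. d (fst p - snd p *\<^sub>R h) i)"
      by (rule continuous_on_compose2[OF cont]) (auto intro!: continuous_intros)
    then show "continuous_on (UNIV \<times> cbox 0 1) (\<lambda>p. blinfun_apply (case p of (x, t) \<Rightarrow> B x t) i)"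
      by (simp add: case_prod_beta B)
  qed
  have int_B: "B x integrable_on cbox 0 1" for x
  proof (rule integrable_continuous)
    have "continuous_on (cbox 0 1) (\<lambda>t. (\<lambda>(x, t). B x t) (x, t))"
      by (rule continuous_on_compose2[OF contB]) (auto intro!: continuous_intros)
    then show "continuous_on (cbox 0 1) (B x)" by simp
  qed
  have int_\<phi>: "(\<lambda>t. \<phi> (x - t *\<^sub>R h)) integrable_on cbox 0 1" for x
    by (rule integrable_continuous, rule continuous_on_compose2[OF C1_with_continuous[OF \<phi>, of UNIV]])
       (auto intro!: continuous_intros)
  have g_deriv: "(g has_derivative g' x) (at x)" for x
    unfolding g_def g'_def
  proof (rule leibniz_rule[where U=UNIV, simplified], goal_cases)
    case (1 x t)
    have "((\<lambda>x. x - t *\<^sub>R h) has_derivative (\<lambda>v. v - 0)) (at x)"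
      by (intro has_derivative_diff has_derivative_ident has_derivative_const)
    from has_derivative_compose[OF this deriv] show ?case unfolding B by simp
  qed (use int_\<phi> contB in auto)
  have g'_apply: "g' x v = integral (cbox 0 1) (\<lambda>t. d (x - t *\<^sub>R h) v)" for x v
    unfolding g'_def using integral_linear[OF int_B bounded_linear_apply_blinfun[of v], of x] by (simp add: o_def B)
  have g'_cont: "continuous_on UNIV (\<lambda>x. g' x v)" for v
    unfolding g'_apply
  proof (rule integral_continuous_on_param)
    show "continuous_on (UNIV \<times> cbox 0 1) (\<lambda>(x, t). d (x - t *\<^sub>R h) v)"
      unfolding case_prod_beta
      by (rule continuous_on_compose2[OF cont]) (auto intro!: continuous_intros)
  qed
  have g'_h: "g' x h = \<phi> x - \<phi> (x - h)" for x
  proof -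
    \<comment> \<open>The integrand is the t-derivative of -\<phi>(x - t h), so the average of the
      directional derivatives along the segment is the difference of the end values.\<close>
    have "((\<lambda>t. d (x - t *\<^sub>R h) h) has_integral (- \<phi> (x - 1 *\<^sub>R h) - (- \<phi> (x - 0 *\<^sub>R h)))) {0..1}"
    proof (rule fundamental_theorem_of_calculus)
      fix t :: real
      have "((\<lambda>t. x - t *\<^sub>R h) has_derivative (\<lambda>s. - (s *\<^sub>R h))) (at t within {0..1})"
        by (auto intro!: derivative_eq_intros)
      then have "((\<lambda>t. - \<phi> (x - t *\<^sub>R h)) has_derivative (\<lambda>s. - d (x - t *\<^sub>R h) (- (s *\<^sub>R h)))) (at t within {0..1})"
        by (intro has_derivative_minus has_derivative_compose[OF _ deriv])
      moreover have "- d (x - t *\<^sub>R h) (- (s *\<^sub>R h)) = s *\<^sub>R d (x - t *\<^sub>R h) h" for s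
        using bl[of "x - t *\<^sub>R h"] by (simp add: linear_simps)
      ultimately show "((\<lambda>t. - \<phi> (x - t *\<^sub>R h)) has_vector_derivative d (x - t *\<^sub>R h) h) (at t within {0..1})"
        by (simp add: has_vector_derivative_def)
    qed simp
    then show ?thesis unfolding g'_apply by (simp add: integral_unique)
  qed
  define \<Phi> where "\<Phi> x = g x *\<^sub>R h" for x
  have \<Phi>_deriv: "(\<Phi> has_derivative (\<lambda>v. g' x v *\<^sub>R h)) (at x)" for x
    unfolding \<Phi>_def by (intro has_derivative_scaleR_left g_deriv)
  show ?thesis
  proof (rule that[of \<Phi>])
    show "\<Phi> \<in> C1c_fields"
    proof (rule C1c_fieldsI[OF \<Phi>_deriv, where r="r + norm h"])
      show "continuous_on UNIV (\<lambda>x. g' x v *\<^sub>R h)" for v by (intro continuous_intros g'_cont)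
      fix x :: "real ^ 'n" assume x: "r + norm h \<le> norm x"
      have "\<phi> (x - t *\<^sub>R h) = 0" if "t \<in> cbox 0 1" for t
      proof (rule supp)
        have "norm (t *\<^sub>R h) \<le> norm h" using that by (simp add: mult_left_le_one_le)
        then show "r \<le> norm (x - t *\<^sub>R h)" using x norm_triangle_ineq2[of x "t *\<^sub>R h"] by linarith
      qed
      then have "g x = integral (cbox 0 1) (\<lambda>t::real. 0::real)" unfolding g_def by (intro integral_cong) auto
      then show "\<Phi> x = 0" by (simp add: \<Phi>_def)
    qed
    fix x :: "real ^ 'n"
    have "norm (g x) \<le> 1 * measure lborel (cbox 0 (1::real))"
      unfolding g_def by (rule has_integral_bound[OF _ integrable_integral[OF int_\<phi>]]) (use bd in auto)
    then show "norm (\<Phi> x) \<le> norm h" by (simp add: \<Phi>_def mult_left_le_one_le)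
    \<comment> \<open>The field is a scalar function times the constant vector h, so its divergence
      is the derivative of the scalar in direction h.\<close>
    have "divergence \<Phi> x = (\<Sum>i\<in>UNIV. g' x (axis i 1) * h $ i)"
      unfolding divergence_has_derivative[OF \<Phi>_deriv] by simp
    also have "\<dots> = g' x (\<Sum>i\<in>UNIV. (h $ i) *\<^sub>R axis i 1)"
      by (simp add: blinfun.sum_right blinfun.scaleR_right mult.commute)
    also have "(\<Sum>i\<in>UNIV. (h $ i) *\<^sub>R axis i 1) = h"
      using basis_expansion[of h] by (simp add: scalar_mult_eq_scaleR)
    finally show "divergence \<Phi> x = \<phi> x - \<phi> (x - h)" by (simp add: g'_h)
  qed
qed

lemma integral_lborel_shift:
  fixes f :: "'a::euclidean_space \<Rightarrow> real"
  assumes [measurable]: "f \<in> borel_measurable borel"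
  shows "(LINT x|lborel. f (x + h)) = (LINT x|lborel. f x)"
proof -
  have "(LINT x|lborel. f x) = (LINT x|distr lborel borel ((+) h). f x)"
    by (simp only: lborel_distr_plus)
  also have "\<dots> = (LINT x|lborel. f (h + x))"
    by (rule integral_distr) auto
  finally show ?thesis by (simp only: add.commute)
qed

lemma loc_int_shift:
  assumes "loc_int u" shows "loc_int (\<lambda>x. u (x + h))"
proof -
  have [measurable]: "u \<in> borel_measurable borel" using assms by (simp add: loc_int_def)
  have "(\<integral>\<^sup>+x. indicator (ball 0 R) x * ennreal \<bar>u (x + h)\<bar> \<partial>lborel) < \<infinity>" for R
  proof -
    have "(\<integral>\<^sup>+x. indicator (ball 0 R) x * ennreal \<bar>u (x + h)\<bar> \<partial>lborel)
       \<le> (\<integral>\<^sup>+x. indicator (ball 0 (R + norm h)) (x + h) * ennreal \<bar>u (x + h)\<bar> \<partial>lborel)"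
    proof (intro nn_integral_mono mult_right_mono)
      fix x
      show "indicator (ball 0 R) x \<le> (indicator (ball 0 (R + norm h)) (x + h) :: ennreal)"
        using norm_triangle_ineq[of x h] by (auto simp: indicator_def)
    qed simp
    also have "\<dots> = (\<integral>\<^sup>+x. indicator (ball 0 (R + norm h)) x * ennreal \<bar>u x\<bar> \<partial>lborel)"
      by (rule nn_integral_lborel_shift[where f="\<lambda>x. indicator (ball 0 (R + norm h)) x * ennreal \<bar>u x\<bar>"]) measurable
    also have "\<dots> < \<infinity>" using assms by (simp add: loc_int_def)
    finally show ?thesis .
  qed
  then show ?thesis unfolding loc_int_def by simp
qed

text \<open>Moving the shift to the test function turns the pairing of v(x) - v(x + h) with \<phi>
  into that of v with \<phi>(x) - \<phi>(x - h), the divergence of a field of norm at most |h|. The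
  Borel representative v carries the translations, while the variation belongs to u; the two agree
  under the integral.\<close>

lemma variation_translation:
  fixes u :: "real ^ 'n::finite \<Rightarrow> real"
  assumes tv: "total_variation u < \<infinity>" and v: "loc_int v" and uv: "AE x in lebesgue. u x = v x"
    and um: "u \<in> borel_measurable lebesgue"
  shows "shift_bounded (real_of_ereal (total_variation u)) v"
proof -
  let ?T = "real_of_ereal (total_variation u)"
  have T: "0 \<le> ?T" by (simp add: real_of_ereal_pos total_variation_nonneg)
  have [measurable]: "v \<in> borel_measurable borel" using v by (simp add: loc_int_def)
  have "(\<integral>\<^sup>+x. ennreal \<bar>v (x + h) - v x\<bar> \<partial>lborel) \<le> ennreal (?T * norm h)" for h
  proof (cases "h = 0")
    \<comment> \<open>A nonzero shift is needed because |h| is the positive bound by which the test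
      field is rescaled.\<close>
    case False
    have "(\<integral>\<^sup>+x. ennreal \<bar>v x - v (x + h)\<bar> \<partial>lborel) \<le> ennreal (?T * norm h)"
    proof (rule dual_bound)
      show "loc_int (\<lambda>x. v x - v (x + h))" by (intro loc_int_diff loc_int_shift v)
      show "0 \<le> ?T * norm h" using T by simp
      fix \<phi> :: "real ^ 'n \<Rightarrow> real" and d r
      assume \<phi>: "C1_with \<phi> d" "\<And>x. r \<le> norm x \<Longrightarrow> \<phi> x = 0" "\<And>x. \<bar>\<phi> x\<bar> \<le> 1"
      obtain \<Phi> where \<Phi>: "\<Phi> \<in> C1c_fields" "\<And>x. norm (\<Phi> x) \<le> norm h" "\<And>x. divergence \<Phi> x = \<phi> x - \<phi> (x - h)"
        using translation_field[OF \<phi>] by blast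
      have [measurable]: "\<phi> \<in> borel_measurable borel"
        using C1_with_continuous[OF \<phi>(1)] by (rule borel_measurable_continuous_onI)
      have z: "\<phi> (x - h) = 0" if "r + norm h \<le> norm x" for x
        by (rule \<phi>(2)) (use that norm_triangle_ineq2[of x h] in linarith)
      have i: "integrable lborel (\<lambda>x. v x * \<phi> x)" "integrable lborel (\<lambda>x. v (x + h) * \<phi> x)"
        "integrable lborel (\<lambda>x. v x * \<phi> (x - h))"
        by (rule loc_int_mult(1)[OF v, of _ 1 r] loc_int_mult(1)[OF loc_int_shift[OF v], of _ 1 r]
             loc_int_mult(1)[OF v, of _ 1 "r + norm h"]; use \<phi> z in simp)+
      have "(LINT x|lborel. (v x - v (x + h)) * \<phi> x) = (LINT x|lborel. v x * \<phi> x) - (LINT x|lborel. v (x + h) * \<phi> x)"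
        unfolding left_diff_distrib by (rule Bochner_Integration.integral_diff[OF i(1,2)])
      also have "(LINT x|lborel. v (x + h) * \<phi> x) = (LINT x|lborel. v x * \<phi> (x - h))"
        using integral_lborel_shift[of "\<lambda>x. v x * \<phi> (x - h)" h] by simp
      also have "(LINT x|lborel. v x * \<phi> x) - \<dots> = (LINT x|lborel. v x * divergence \<Phi> x)"
        unfolding \<Phi>(3) right_diff_distrib by (rule Bochner_Integration.integral_diff[OF i(1,3), symmetric])
      also have "\<dots> = (LINT x|lebesgue. v x * divergence \<Phi> x)"
        unfolding \<Phi>(3) by (rule integral_completion[symmetric]) measurable
      also have "\<dots> = (LINT x|lebesgue. u x * divergence \<Phi> x)"
      proof (rule integral_cong_AE)
        have "(\<lambda>x. divergence \<Phi> x) \<in> borel_measurable lborel" unfolding \<Phi>(3) by measurable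
        then have [measurable]: "(\<lambda>x. divergence \<Phi> x) \<in> borel_measurable lebesgue" by (rule measurable_completion)
        have [measurable]: "v \<in> borel_measurable lebesgue" by (rule measurable_completion) simp
        note um [measurable]
        show "(\<lambda>x. v x * divergence \<Phi> x) \<in> borel_measurable lebesgue" "(\<lambda>x. u x * divergence \<Phi> x) \<in> borel_measurable lebesgue"
          by measurable
        show "AE x in lebesgue. v x * divergence \<Phi> x = u x * divergence \<Phi> x" using uv by eventually_elim simp
      qed
      also have "\<dots> \<le> norm h * ?T"
        by (rule total_variation_test[OF tv \<Phi>(1,2)]) (use False in simp)
      finally show "(LINT x|lborel. (v x - v (x + h)) * \<phi> x) \<le> ?T * norm h" by (simp add: mult.commute)
    qed
    then show ?thesis by (simp add: abs_minus_commute)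
  qed simp
  then show ?thesis using T unfolding shift_bounded_def by simp
qed

subsection \<open>The compact embeddings\<close>

lemma abs_diff_powr_le:
  fixes a b :: real
  assumes "0 \<le> p" shows "\<bar>a - b\<bar> powr p \<le> 2 powr p * (\<bar>a\<bar> powr p + \<bar>b\<bar> powr p)"
proof -
  have "\<bar>a - b\<bar> powr p \<le> (2 * max \<bar>a\<bar> \<bar>b\<bar>) powr p"
    using assms by (intro powr_mono2) auto
  also have "\<dots> = 2 powr p * max \<bar>a\<bar> \<bar>b\<bar> powr p" by (rule powr_mult)
  also have "\<dots> \<le> 2 powr p * (\<bar>a\<bar> powr p + \<bar>b\<bar> powr p)"
    by (intro mult_left_mono) (auto simp: max_def)
  finally show ?thesis .
qed

text \<open>The weights \<open>2 powr (k * r)\<close> make the increments of a fast subsequence decay geometrically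
  at almost every point, which replaces Minkowski's inequality.\<close>

lemma weighted_complete:
  fixes u :: "nat \<Rightarrow> 'a \<Rightarrow> real" and K :: "'a \<Rightarrow> real"
  assumes [measurable]: "\<And>n. u n \<in> borel_measurable M" "K \<in> borel_measurable M"
    and K: "\<And>x. 0 < K x" and r: "0 < r"
    and Cauchy: "\<And>e. 0 < e \<Longrightarrow> \<exists>n0. \<forall>m\<ge>n0. \<forall>n\<ge>n0. (\<integral>\<^sup>+x. ennreal (K x * \<bar>u m x - u n x\<bar> powr r) \<partial>M) \<le> ennreal e"
  obtains l where "l \<in> borel_measurable M"
    "\<And>e. 0 < e \<Longrightarrow> \<exists>n0. \<forall>n\<ge>n0. (\<integral>\<^sup>+x. ennreal (K x * \<bar>u n x - l x\<bar> powr r) \<partial>M) \<le> ennreal e"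
proof -
  let ?I = "\<lambda>m n. (\<integral>\<^sup>+x. ennreal (K x * \<bar>u m x - u n x\<bar> powr r) \<partial>M)"
  \<comment> \<open>The factor 2^(-k r) cancels the weight of the k-th increment, and (1/2)^k is
    left over to make the weighted series summable.\<close>
  define e where "e k = (1/2)^k * 2 powr (- (real k * r))" for k :: nat
  have e: "0 < e k" for k by (simp add: e_def)
  have "\<exists>\<tau>. \<forall>k. (\<forall>m\<ge>\<tau> k. \<forall>n\<ge>\<tau> k. ?I m n \<le> ennreal (e k)) \<and> \<tau> k < \<tau> (Suc k)"
  proof (rule dependent_nat_choice)
    show "\<exists>t. \<forall>m\<ge>t. \<forall>n\<ge>t. ?I m n \<le> ennreal (e 0)" by (rule Cauchy[OF e])
    fix t k
    obtain t' where "\<forall>m\<ge>t'. \<forall>n\<ge>t'. ?I m n \<le> ennreal (e (Suc k))" using Cauchy[OF e] by blast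
    then show "\<exists>t'. (\<forall>m\<ge>t'. \<forall>n\<ge>t'. ?I m n \<le> ennreal (e (Suc k))) \<and> t < t'"
      by (intro exI[of _ "max t' (Suc t)"]) auto
  qed
  then obtain \<tau> where \<tau>: "\<And>k m n. m \<ge> \<tau> k \<Longrightarrow> n \<ge> \<tau> k \<Longrightarrow> ?I m n \<le> ennreal (e k)" "\<And>k. \<tau> k < \<tau> (Suc k)"
    by blast
  have mono: "strict_mono \<tau>" using \<tau>(2) by (rule strict_mono_Suc_iff[THEN iffD2, rule_format])
  let ?d = "\<lambda>k x. \<bar>u (\<tau> (Suc k)) x - u (\<tau> k) x\<bar>"
  let ?f = "\<lambda>k x. ennreal (2 powr (real k * r)) * ennreal (K x * ?d k x powr r)"
  have "(\<integral>\<^sup>+x. (\<Sum>k. ?f k x) \<partial>M) = (\<Sum>k. \<integral>\<^sup>+x. ?f k x \<partial>M)"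
    by (rule nn_integral_suminf) measurable
  also have "\<dots> \<le> (\<Sum>k. ennreal ((1/2)^k))"
  proof (rule suminf_le)
    fix k
    have "(\<integral>\<^sup>+x. ?f k x \<partial>M) = ennreal (2 powr (real k * r)) * ?I (\<tau> (Suc k)) (\<tau> k)"
      by (rule nn_integral_cmult) measurable
    also have "\<dots> \<le> ennreal (2 powr (real k * r)) * ennreal (e k)"
      using \<tau> by (intro mult_left_mono) (auto simp: less_imp_le)
    also have "\<dots> = ennreal ((1/2)^k)"
      by (simp add: ennreal_mult[symmetric] e_def powr_minus)
    finally show "(\<integral>\<^sup>+x. ?f k x \<partial>M) \<le> ennreal ((1/2)^k)" .
  qed auto
  also have "\<dots> = ennreal (\<Sum>k. (1/2)^k)" by (intro suminf_ennreal2) auto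
  also have "\<dots> < \<infinity>" by simp
  finally have "(\<integral>\<^sup>+x. (\<Sum>k. ?f k x) \<partial>M) \<noteq> \<infinity>" by simp
  then have "AE x in M. (\<Sum>k. ?f k x) \<noteq> \<infinity>" by (intro nn_integral_noteq_infinite) measurable
  then have conv: "AE x in M. convergent (\<lambda>k. u (\<tau> k) x)"
  proof eventually_elim
    case (elim x)
    define S where "S = enn2real (\<Sum>k. ?f k x)"
    have S: "(\<Sum>k. ?f k x) = ennreal S" using elim by (simp add: S_def less_top)
    have S0: "0 \<le> S" by (simp add: S_def)
    have "norm (u (\<tau> (Suc k)) x - u (\<tau> k) x) \<le> (S / K x) powr (1 / r) * (1/2)^k" for k
    proof -
      \<comment> \<open>A single term is at most the whole series S; undoing the weight bounds the
        k-th increment by a constant depending on x times 2^-k.\<close>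
      have "?f k x \<le> (\<Sum>k. ?f k x)" using sum_le_suminf[of "\<lambda>k. ?f k x" "{k}"] by simp
      then have "ennreal (2 powr (real k * r) * (K x * ?d k x powr r)) \<le> ennreal S"
        unfolding S using K[of x] by (simp add: ennreal_mult[symmetric] less_imp_le)
      then have "2 powr (real k * r) * (K x * ?d k x powr r) \<le> S" using S0 by simp
      then have "(2 powr real k) powr r * ?d k x powr r \<le> S / K x"
        using K[of x] by (simp add: field_simps powr_powr)
      then have "(2^k * ?d k x) powr r \<le> S / K x" by (simp add: powr_mult powr_realpow)
      then have "((2^k * ?d k x) powr r) powr (1 / r) \<le> (S / K x) powr (1 / r)"
        using r by (intro powr_mono2) auto
      then have "2^k * ?d k x \<le> (S / K x) powr (1 / r)" using r by (simp add: powr_powr)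
      then show ?thesis by (simp add: field_simps)
    qed
    then have "summable (\<lambda>k. u (\<tau> (Suc k)) x - u (\<tau> k) x)"
      by (intro summable_comparison_test'[OF summable_mult[OF summable_geometric]]) auto
    then have "convergent (\<lambda>n. u (\<tau> n) x - u (\<tau> 0) x)"
      unfolding summable_iff_convergent sum_lessThan_telescope[of "\<lambda>n. u (\<tau> n) x"] .
    then have "convergent (\<lambda>n. (u (\<tau> n) x - u (\<tau> 0) x) + u (\<tau> 0) x)"
      by (intro convergent_add convergent_const)
    then show ?case by simp
  qed
  define l where "l x = lim (\<lambda>k. u (\<tau> k) x)" for x
  have [measurable]: "l \<in> borel_measurable M" unfolding l_def[abs_def] by (rule borel_measurable_lim_metric) simp
  have "\<exists>n0. \<forall>n\<ge>n0. (\<integral>\<^sup>+x. ennreal (K x * \<bar>u n x - l x\<bar> powr r) \<partial>M) \<le> ennreal e" if e: "0 < e" for e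
  proof -
    obtain n0 where n0: "\<And>m n. m \<ge> n0 \<Longrightarrow> n \<ge> n0 \<Longrightarrow> ?I m n \<le> ennreal e" using Cauchy[OF e] by blast
    have "(\<integral>\<^sup>+x. ennreal (K x * \<bar>u n x - l x\<bar> powr r) \<partial>M) \<le> ennreal e" if n: "n \<ge> n0" for n
    proof -
      \<comment> \<open>Fatou's lemma along the fast subsequence: the Cauchy bound survives when the
        second index tends to infinity.\<close>
      have "(\<integral>\<^sup>+x. ennreal (K x * \<bar>u n x - l x\<bar> powr r) \<partial>M)
         = (\<integral>\<^sup>+x. liminf (\<lambda>k. ennreal (K x * \<bar>u n x - u (\<tau> k) x\<bar> powr r)) \<partial>M)"
      proof (rule nn_integral_cong_AE, use conv in eventually_elim)
        case (elim x)
        then have "(\<lambda>k. u (\<tau> k) x) \<longlonglongrightarrow> l x" unfolding l_def by (simp add: convergent_LIMSEQ_iff)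
        then have "(\<lambda>k. \<bar>u n x - u (\<tau> k) x\<bar> powr r) \<longlonglongrightarrow> \<bar>u n x - l x\<bar> powr r"
          using r by (intro tendsto_powr' tendsto_intros) auto
        then have "(\<lambda>k. ennreal (K x * \<bar>u n x - u (\<tau> k) x\<bar> powr r)) \<longlonglongrightarrow> ennreal (K x * \<bar>u n x - l x\<bar> powr r)"
          by (intro tendsto_ennrealI tendsto_mult_left)
        then show ?case by (intro lim_imp_Liminf[symmetric]) auto
      qed
      also have "\<dots> \<le> liminf (\<lambda>k. ?I n (\<tau> k))" by (rule nn_integral_liminf) measurable
      also have "\<dots> \<le> limsup (\<lambda>k. ?I n (\<tau> k))" by (rule Liminf_le_Limsup) simp
      also have "\<dots> \<le> ennreal e"
      proof (rule Limsup_bounded)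
        show "\<forall>\<^sub>F k in sequentially. ?I n (\<tau> k) \<le> ennreal e"
          using n0[OF n] seq_suble[OF mono] order_trans
          by (intro eventually_sequentiallyI[of n0]) blast
      qed
      finally show ?thesis .
    qed
    then show ?thesis by blast
  qed
  with \<open>l \<in> borel_measurable M\<close> show ?thesis by (rule that)
qed

section \<open>Tail estimates from the conditions on the potentials\<close>

lemma VK1_uniform:
  fixes K :: "real ^ 'n::finite \<Rightarrow> real"
  assumes "VK1 K" and R: "0 < R" and \<epsilon>: "0 < \<epsilon>"
  shows "\<exists>\<rho>. \<forall>A\<in>sets borel. emeasure lebesgue A \<le> ennreal R \<longrightarrow> \<bar>LINT x : A \<inter> - ball 0 \<rho> | lebesgue. K x\<bar> < \<epsilon>"
proof (rule ccontr)
  assume "\<not> ?thesis"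
  \<comment> \<open>\<open>VK1\<close> speaks of one sequence at a time. If no radius served all
    sets, bad sets chosen for the radii n = 0, 1, 2, ... would form a sequence on which the uniform
    limit fails.\<close>
  then have "\<forall>n::nat. \<exists>A. A \<in> sets borel \<and> emeasure lebesgue A \<le> ennreal R \<and> \<not> \<bar>LINT x : A \<inter> - ball 0 (real n) | lebesgue. K x\<bar> < \<epsilon>"
    by blast
  then obtain A where A: "\<And>n::nat. A n \<in> sets borel" "\<And>n. emeasure lebesgue (A n) \<le> ennreal R"
     "\<And>n. \<not> \<bar>LINT x : A n \<inter> - ball 0 (real n) | lebesgue. K x\<bar> < \<epsilon>" by metis
  then have "uniform_limit UNIV (\<lambda>r n. LINT x : A n \<inter> - ball 0 r | lebesgue. K x) (\<lambda>n. 0) at_top"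
    using assms unfolding VK1_def by blast
  from uniform_limitD[OF this \<epsilon>] obtain r0 where
    r0: "\<And>r n. r \<ge> r0 \<Longrightarrow> dist (LINT x : A n \<inter> - ball 0 r | lebesgue. K x) 0 < \<epsilon>"
    unfolding eventually_at_top_linorder by auto
  obtain n where "r0 \<le> real n" using real_arch_simple by blast
  from r0[OF this, of n] A(3)[of n] show False by simp
qed

text \<open>The Bochner integral of a non-integrable function is 0 by convention, so a bound on it
  carries over to the nonnegative integral only once integrability is known. That follows from the
  boundedness of K and the finite measure of A.\<close>

lemma VK1_uniform_nn:
  fixes K :: "real ^ 'n::finite \<Rightarrow> real"
  assumes "VK1 K" and R: "0 < R" and \<epsilon>: "0 < \<epsilon>"
    and K: "\<And>x. 0 < K x" "K \<in> borel_measurable borel" "AE x in lebesgue. \<bar>K x\<bar> \<le> k0"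
  shows "\<exists>\<rho>. \<forall>A\<in>sets borel. emeasure lebesgue A \<le> ennreal R \<longrightarrow>
      (\<integral>\<^sup>+x. indicator (A \<inter> - ball 0 \<rho>) x * ennreal (K x) \<partial>lebesgue) \<le> ennreal \<epsilon>"
proof -
  obtain \<rho> where \<rho>: "\<And>A. A \<in> sets borel \<Longrightarrow> emeasure lebesgue A \<le> ennreal R \<Longrightarrow> \<bar>LINT x : A \<inter> - ball 0 \<rho> | lebesgue. K x\<bar> < \<epsilon>"
    using VK1_uniform[OF assms(1-3)] by blast
  have "(\<integral>\<^sup>+x. indicator (A \<inter> - ball 0 \<rho>) x * ennreal (K x) \<partial>lebesgue) \<le> ennreal \<epsilon>"
    if A: "A \<in> sets borel" "emeasure lebesgue A \<le> ennreal R" for A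
  proof -
    let ?B = "A \<inter> - ball 0 \<rho>"
    have B: "?B \<in> sets lebesgue" using A(1) by simp
    have [measurable]: "K \<in> borel_measurable lebesgue" using K(2) by (intro measurable_completion) simp
    have fin: "emeasure lebesgue ?B < \<infinity>"
    proof -
      have "emeasure lebesgue ?B \<le> emeasure lebesgue A" using A(1) by (intro emeasure_mono) auto
      also have "\<dots> < \<infinity>" using A(2) by (simp add: le_less_trans)
      finally show ?thesis .
    qed
    have int: "integrable lebesgue (\<lambda>x. indicator ?B x * K x)"
    proof (rule Bochner_Integration.integrable_bound)
      show "integrable lebesgue (\<lambda>x. k0 * indicator ?B x)"
        using B fin by (intro integrable_mult_right integrable_real_indicator) auto
      show "(\<lambda>x. indicator ?B x * K x) \<in> borel_measurable lebesgue" using B by measurable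
      show "AE x in lebesgue. norm (indicator ?B x * K x) \<le> norm (k0 * indicator ?B x)"
        using K(3) by eventually_elim (auto simp: indicator_def)
    qed
    have "(\<integral>\<^sup>+x. indicator ?B x * ennreal (K x) \<partial>lebesgue) = (\<integral>\<^sup>+x. ennreal (indicator ?B x * K x) \<partial>lebesgue)"
      by (intro nn_integral_cong) (auto simp: indicator_def)
    also have "\<dots> = ennreal (LINT x|lebesgue. indicator ?B x * K x)"
      by (rule nn_integral_eq_integral[OF int]) (use K(1) in \<open>auto simp: less_imp_le\<close>)
    also have "\<dots> \<le> ennreal \<epsilon>"
      using \<rho>[OF A] by (intro ennreal_leI) (simp add: set_lebesgue_integral_def)
    finally show ?thesis .
  qed
  then show ?thesis by blast
qed

text \<open>A small s serves when a > 0 and a large one when a < 0; both signs occur, for the lower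
  and the upper threshold of |w|. The B + 1 in the witness avoids division by zero.\<close>

lemma ex_small_powr:
  fixes B :: real
  assumes "0 \<le> B" "0 < \<epsilon>" "a \<noteq> 0"
  shows "\<exists>s>0. s powr a * B \<le> \<epsilon>"
proof (intro exI conjI)
  let ?s = "(\<epsilon> / (B + 1)) powr (1 / a)"
  show "0 < ?s" using assms by simp
  have "?s powr a * B = \<epsilon> * (B / (B + 1))" using assms by (simp add: powr_powr)
  also have "\<dots> \<le> \<epsilon> * 1" using assms by (intro mult_left_mono) (auto simp: divide_le_eq_1)
  finally show "?s powr a * B \<le> \<epsilon>" by simp
qed

lemma powr_le_small:
  fixes s t :: real assumes "0 \<le> t" "t \<le> s" "1 \<le> r" shows "t powr r \<le> s powr (r - 1) * t"
proof (cases "t = 0")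
  case False
  then have "t powr r = t powr (r - 1) * t" using assms powr_mult_base[of t "r - 1"] by (simp add: mult.commute)
  also have "\<dots> \<le> s powr (r - 1) * t" using assms by (intro mult_right_mono powr_mono2) auto
  finally show ?thesis .
qed simp

lemma powr_le_large:
  fixes s t :: real assumes "0 < s" "s \<le> t" "r \<le> p" shows "t powr r \<le> s powr (r - p) * t powr p"
proof -
  have "t powr r = t powr (r - p) * t powr p" by (simp flip: powr_add)
  also have "\<dots> \<le> s powr (r - p) * t powr p" using assms by (intro mult_right_mono powr_mono2') auto
  finally show ?thesis .
qed

text \<open>The common interface of the two alternatives on the potentials. R and C depend on M and
  \<epsilon> but not on w, so one choice covers all differences of a bounded sequence, for which the
  last term is small by local compactness. M bounds the integrals themselves, without roots.\<close>

definition tail_controlled :: "(real ^ 'n::finite \<Rightarrow> real) \<Rightarrow> (real ^ 'n \<Rightarrow> real) \<Rightarrow> real \<Rightarrow> real \<Rightarrow> bool" where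
  "tail_controlled V K p r \<longleftrightarrow> (\<forall>M\<ge>0. \<forall>\<epsilon>>0. \<exists>R C. 0 \<le> C \<and> (\<forall>w\<in>borel_measurable borel.
     (\<integral>\<^sup>+x. ennreal (V x * \<bar>w x\<bar>) \<partial>lebesgue) \<le> ennreal M \<longrightarrow>
     (\<integral>\<^sup>+x. ennreal (\<bar>w x\<bar> powr p) \<partial>lebesgue) \<le> ennreal M \<longrightarrow>
     (\<integral>\<^sup>+x. ennreal (K x * \<bar>w x\<bar> powr r) \<partial>lebesgue)
       \<le> ennreal \<epsilon> + ennreal C * (\<integral>\<^sup>+x. indicator (ball 0 R) x * ennreal \<bar>w x\<bar> \<partial>lebesgue)))"

lemma nn_integral_lin4:
  assumes [measurable]: "f1 \<in> borel_measurable M" "f2 \<in> borel_measurable M" "f3 \<in> borel_measurable M" "f4 \<in> borel_measurable M"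
  shows "(\<integral>\<^sup>+x. c1 * f1 x + c2 * f2 x + c3 * f3 x + c4 * f4 x \<partial>M)
    = c1 * integral\<^sup>N M f1 + c2 * integral\<^sup>N M f2 + c3 * integral\<^sup>N M f3 + (c4 :: ennreal) * integral\<^sup>N M f4"
  by (simp add: nn_integral_add nn_integral_cmult)

text \<open>Points are sorted by the size of |w|. Where |w| < s0, the bound K \<le> k2 V and the
  surplus power r - 1 give smallness from the V-integral; where |w| \<ge> s1, the missing power p -
  r gives it from the p-th powers. What lies between has bounded measure by Markov's inequality, so
  \<open>VK1\<close> makes its part outside a large ball small, and inside the ball K |w|^r is at
  most a constant times |w|.\<close>

lemma tail_controlled_VK2:
  fixes V K :: "real ^ 'n::finite \<Rightarrow> real"
  assumes Vm: "V \<in> borel_measurable lebesgue" and V: "\<And>x. 0 < V x" and K: "\<And>x. 0 < K x" "continuous_on UNIV K"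
    and k0: "AE x in lebesgue. \<bar>K x\<bar> \<le> k0" and "VK1 K" and "VK2 V K" and r: "1 < r" "r < p"
  shows "tail_controlled V K p r"
  unfolding tail_controlled_def
proof (intro allI impI)
  fix M \<epsilon> :: real assume M: "0 \<le> M" and \<epsilon>: "0 < \<epsilon>"
  have Kb: "K \<in> borel_measurable borel" using K(2) by (rule borel_measurable_continuous_onI)
  then have [measurable]: "K \<in> borel_measurable lebesgue" by (intro measurable_completion) simp
  note Vm [measurable]
  obtain k2' where "AE x in lebesgue. \<bar>K x / V x\<bar> \<le> k2'" using \<open>VK2 V K\<close> by (auto simp: VK2_def ess_bounded_def)
  then have k2: "AE x in lebesgue. K x \<le> max k2' 0 * V x"
  proof eventually_elim
    case (elim x)
    then have "K x / V x \<le> max k2' 0" using V[of x] K(1)[of x] by (simp add: max.coboundedI1)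
    then show ?case using V[of x] by (simp add: divide_le_eq)
  qed
  define k2 where "k2 = max k2' 0"
  have k20: "0 \<le> k2" by (simp add: k2_def)
  define k where "k = max k0 0"
  have k: "0 \<le> k" "AE x in lebesgue. K x \<le> k" using k0 by (auto simp: k_def)
  obtain s0 where s0: "0 < s0" "s0 powr (r - 1) * (k2 * M) \<le> \<epsilon> / 3"
    using ex_small_powr[of "k2 * M" "\<epsilon> / 3" "r - 1"] k20 M \<epsilon> r by auto
  obtain s1 where s1: "0 < s1" "s1 powr (r - p) * (k * M) \<le> \<epsilon> / 3"
    using ex_small_powr[of "k * M" "\<epsilon> / 3" "r - p"] k M \<epsilon> r by auto
  \<comment> \<open>Markov's bound for the measure of the set where |w| \<ge> s0; the added 1 makes
    it positive, as \<open>VK1\<close> requires, even when M = 0.\<close>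
  define R0 where "R0 = s0 powr (- p) * M + 1"
  have R0: "0 < R0" using M by (simp add: R0_def add_nonneg_pos)
  have "0 < \<epsilon> / 3 / s1 powr r" using \<epsilon> s1 by simp
  from VK1_uniform_nn[OF \<open>VK1 K\<close> R0 this K(1) Kb k0]
  obtain \<rho> where \<rho>: "\<And>A. A \<in> sets borel \<Longrightarrow> emeasure lebesgue A \<le> ennreal R0 \<Longrightarrow>
      (\<integral>\<^sup>+x. indicator (A \<inter> - ball 0 \<rho>) x * ennreal (K x) \<partial>lebesgue) \<le> ennreal (\<epsilon> / 3 / s1 powr r)" by blast
  define C where "C = k * s1 powr (r - 1)"
  have C: "0 \<le> C" using k by (simp add: C_def)
  show "\<exists>R C. 0 \<le> C \<and> (\<forall>w\<in>borel_measurable borel.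
     (\<integral>\<^sup>+x. ennreal (V x * \<bar>w x\<bar>) \<partial>lebesgue) \<le> ennreal M \<longrightarrow>
     (\<integral>\<^sup>+x. ennreal (\<bar>w x\<bar> powr p) \<partial>lebesgue) \<le> ennreal M \<longrightarrow>
     (\<integral>\<^sup>+x. ennreal (K x * \<bar>w x\<bar> powr r) \<partial>lebesgue)
       \<le> ennreal \<epsilon> + ennreal C * (\<integral>\<^sup>+x. indicator (ball 0 R) x * ennreal \<bar>w x\<bar> \<partial>lebesgue))"
  proof (rule exI[of _ \<rho>], rule exI[of _ C], intro conjI C ballI impI)
    fix w :: "real ^ 'n \<Rightarrow> real"
    assume wb [measurable]: "w \<in> borel_measurable borel"
      and wV: "(\<integral>\<^sup>+x. ennreal (V x * \<bar>w x\<bar>) \<partial>lebesgue) \<le> ennreal M"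
      and wp: "(\<integral>\<^sup>+x. ennreal (\<bar>w x\<bar> powr p) \<partial>lebesgue) \<le> ennreal M"
    have wl [measurable]: "w \<in> borel_measurable lebesgue" by (rule measurable_completion) simp
    define A where "A = {x. s0 \<le> \<bar>w x\<bar>}"
    have A [measurable]: "A \<in> sets borel" unfolding A_def by measurable
    have Al [measurable]: "A \<in> sets lebesgue" "ball 0 \<rho> \<in> sets (lebesgue :: (real ^ 'n) measure)" using A by simp_all
    have "ennreal (s0 powr p) * emeasure lebesgue A = (\<integral>\<^sup>+x. ennreal (s0 powr p) * indicator A x \<partial>lebesgue)"
      by (rule nn_integral_cmult_indicator[symmetric]) simp
    also have "\<dots> \<le> (\<integral>\<^sup>+x. ennreal (\<bar>w x\<bar> powr p) \<partial>lebesgue)"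
      using s0 r by (intro nn_integral_mono) (auto simp: indicator_def A_def intro!: ennreal_leI powr_mono2)
    also note wp
    finally have "ennreal (s0 powr (- p)) * (ennreal (s0 powr p) * emeasure lebesgue A) \<le> ennreal (s0 powr (- p)) * ennreal M"
      by (rule mult_left_mono) simp
    then have "emeasure lebesgue A \<le> ennreal (s0 powr (- p) * M)"
      using s0 M by (simp add: mult.assoc[symmetric] ennreal_mult[symmetric] powr_add[symmetric])
    also have "\<dots> \<le> ennreal R0" by (intro ennreal_leI) (simp add: R0_def)
    finally have AR: "(\<integral>\<^sup>+x. indicator (A \<inter> - ball 0 \<rho>) x * ennreal (K x) \<partial>lebesgue) \<le> ennreal (\<epsilon> / 3 / s1 powr r)"
      by (rule \<rho>[OF A])
    have "(\<integral>\<^sup>+x. ennreal (K x * \<bar>w x\<bar> powr r) \<partial>lebesgue) \<le>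
      (\<integral>\<^sup>+x. ennreal (s0 powr (r - 1) * k2) * ennreal (V x * \<bar>w x\<bar>)
         + ennreal (s1 powr (r - p) * k) * ennreal (\<bar>w x\<bar> powr p)
         + ennreal (s1 powr r) * (indicator (A \<inter> - ball 0 \<rho>) x * ennreal (K x))
         + ennreal C * (indicator (ball 0 \<rho>) x * ennreal \<bar>w x\<bar>) \<partial>lebesgue)"
    proof (rule nn_integral_mono_AE, use k(2) k2 in eventually_elim)
      case (elim x)
      let ?t = "\<bar>w x\<bar>"
      note K1 = K(1)[of x]
      \<comment> \<open>s0 and s1 need not be ordered: the cases may overlap, but they cover every
        point, and each uses only one of the four terms.\<close>
      consider "\<not> s0 \<le> ?t" | "s1 \<le> ?t" | "s0 \<le> ?t" "?t \<le> s1" "x \<notin> ball 0 \<rho>" | "?t \<le> s1" "x \<in> ball 0 \<rho>"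
        by linarith
      then show ?case
      proof cases
        case 1
        have "K x * ?t powr r \<le> (k2 * V x) * (s0 powr (r - 1) * ?t)"
          using elim K1 r 1 k20 V[of x] unfolding k2_def[symmetric] by (intro mult_mono powr_le_small) auto
        also have "\<dots> = (s0 powr (r - 1) * k2) * (V x * ?t)" by simp
        finally have "ennreal (K x * ?t powr r) \<le> ennreal (s0 powr (r - 1) * k2) * ennreal (V x * ?t)"
          using k20 by (subst ennreal_mult'[symmetric]) (auto intro: ennreal_leI)
        then show ?thesis by (simp add: add_increasing2 add.assoc)
      next
        case 2
        have "K x * ?t powr r \<le> k * (s1 powr (r - p) * ?t powr p)"
          using elim K1 r 2 s1 by (intro mult_mono powr_le_large) auto
        also have "\<dots> = (s1 powr (r - p) * k) * ?t powr p" by simp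
        finally have "ennreal (K x * ?t powr r) \<le> ennreal (s1 powr (r - p) * k) * ennreal (?t powr p)"
          using k by (subst ennreal_mult'[symmetric]) (auto intro: ennreal_leI)
        then show ?thesis by (simp add: add_increasing2 add_increasing)
      next
        case 3
        have "K x * ?t powr r \<le> K x * s1 powr r"
          using K1 r 3 by (intro mult_left_mono powr_mono2) auto
        then have "ennreal (K x * ?t powr r) \<le> ennreal (s1 powr r) * ennreal (K x)"
          by (subst ennreal_mult'[symmetric]) (auto intro: ennreal_leI simp: mult.commute)
        moreover have "x \<in> A \<inter> - ball 0 \<rho>" using 3 by (simp add: A_def)
        ultimately show ?thesis by (simp add: add_increasing2 add_increasing)
      next
        case 4
        have "K x * ?t powr r \<le> k * (s1 powr (r - 1) * ?t)"
          using elim K1 r 4 by (intro mult_mono powr_le_small) auto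
        then have "ennreal (K x * ?t powr r) \<le> ennreal C * ennreal ?t"
          using C by (subst ennreal_mult'[symmetric]) (auto intro: ennreal_leI simp: C_def mult.assoc)
        then show ?thesis using 4 by (simp add: add_increasing)
      qed
    qed
    also have "\<dots> = ennreal (s0 powr (r - 1) * k2) * (\<integral>\<^sup>+x. ennreal (V x * \<bar>w x\<bar>) \<partial>lebesgue)
         + ennreal (s1 powr (r - p) * k) * (\<integral>\<^sup>+x. ennreal (\<bar>w x\<bar> powr p) \<partial>lebesgue)
         + ennreal (s1 powr r) * (\<integral>\<^sup>+x. indicator (A \<inter> - ball 0 \<rho>) x * ennreal (K x) \<partial>lebesgue)
         + ennreal C * (\<integral>\<^sup>+x. indicator (ball 0 \<rho>) x * ennreal \<bar>w x\<bar> \<partial>lebesgue)"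
      by (rule nn_integral_lin4) measurable
    also have "\<dots> \<le> ennreal (s0 powr (r - 1) * k2) * ennreal M + ennreal (s1 powr (r - p) * k) * ennreal M
         + ennreal (s1 powr r) * ennreal (\<epsilon> / 3 / s1 powr r)
         + ennreal C * (\<integral>\<^sup>+x. indicator (ball 0 \<rho>) x * ennreal \<bar>w x\<bar> \<partial>lebesgue)"
      by (intro add_mono mult_left_mono wV wp AR) auto
    also have "\<dots> = ennreal (s0 powr (r - 1) * (k2 * M) + s1 powr (r - p) * (k * M) + \<epsilon> / 3)
         + ennreal C * (\<integral>\<^sup>+x. indicator (ball 0 \<rho>) x * ennreal \<bar>w x\<bar> \<partial>lebesgue)"
      using k k20 M \<epsilon> s1 by (simp add: ennreal_mult[symmetric] ennreal_plus[symmetric] mult.assoc del: ennreal_plus)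
    also have "\<dots> \<le> ennreal \<epsilon> + ennreal C * (\<integral>\<^sup>+x. indicator (ball 0 \<rho>) x * ennreal \<bar>w x\<bar> \<partial>lebesgue)"
      using s0(2) s1(2) by (intro add_right_mono ennreal_leI) linarith
    finally show "(\<integral>\<^sup>+x. ennreal (K x * \<bar>w x\<bar> powr r) \<partial>lebesgue)
       \<le> ennreal \<epsilon> + ennreal C * (\<integral>\<^sup>+x. indicator (ball 0 \<rho>) x * ennreal \<bar>w x\<bar> \<partial>lebesgue)" .
  qed
qed

text \<open>The exponent \<theta> = (p - r)/(p - 1) satisfies r = \<theta> + p (1 - \<theta>), so
  V^\<theta> |t|^r is a weighted geometric mean of V |t| and |t|^p. Outside a large ball K /
  V^\<theta> is below \<delta>, which settles all values of w at once; inside, large values are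
  absorbed by the p-th powers and the others are at most a constant times |w|.\<close>

lemma tail_controlled_VK3:
  fixes V K :: "real ^ 'n::finite \<Rightarrow> real"
  assumes Vm: "V \<in> borel_measurable lebesgue" and V: "\<And>x. 0 < V x" and K: "\<And>x. 0 < K x" "continuous_on UNIV K"
    and k0: "AE x in lebesgue. \<bar>K x\<bar> \<le> k0" and "VK3 V K r"
  defines "p \<equiv> critical_exponent CARD('n)"
  shows "tail_controlled V K p r"
  unfolding tail_controlled_def
proof (intro allI impI)
  fix M \<epsilon> :: real assume M: "0 \<le> M" and \<epsilon>: "0 < \<epsilon>"
  have "K \<in> borel_measurable borel" using K(2) by (rule borel_measurable_continuous_onI)
  then have [measurable]: "K \<in> borel_measurable lebesgue" by (intro measurable_completion) simp
  note Vm [measurable]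
  define \<theta> where "\<theta> = (p - r) / (p - 1)"
  have r: "1 < r" "r < p" and lim: "((\<lambda>x. K x / V x powr \<theta>) \<longlongrightarrow> 0) at_infinity"
    using \<open>VK3 V K r\<close> unfolding VK3_def p_def \<theta>_def by auto
  have \<theta>: "0 < \<theta>" "\<theta> < 1"
    using r by (auto simp: \<theta>_def field_simps)
  have "\<theta> * (p - 1) = p - r" using r by (simp add: \<theta>_def)
  then have r_eq: "r = \<theta> + p * (1 - \<theta>)" by (simp add: algebra_simps)
  define k where "k = max k0 0"
  have k: "0 \<le> k" "AE x in lebesgue. K x \<le> k" using k0 by (auto simp: k_def)
  \<comment> \<open>The outer estimate charges \<delta> to both integrals, each bounded by M, so
    \<delta> M is spent twice, at \<epsilon>/4 each; M + 1 avoids division by zero.\<close>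
  define \<delta> where "\<delta> = \<epsilon> / (4 * (M + 1))"
  have \<delta>: "0 < \<delta>" using M \<epsilon> by (simp add: \<delta>_def)
  have \<delta>M: "\<delta> * M \<le> \<epsilon> / 4"
  proof -
    have "\<delta> * M \<le> \<delta> * (M + 1)" using \<delta> by simp
    also have "\<dots> = \<epsilon> / 4"
      using M mult_divide_mult_cancel_left[of "M + 1" \<epsilon> 4] by (simp add: \<delta>_def mult.commute)
    finally show ?thesis .
  qed
  have "\<forall>\<^sub>F x in at_infinity. K x / V x powr \<theta> < \<delta>" using lim \<delta> by (rule order_tendstoD(2))
  then obtain \<rho> where \<rho>: "\<And>x. \<rho> \<le> norm x \<Longrightarrow> K x / V x powr \<theta> < \<delta>"
    unfolding eventually_at_infinity by blast
  obtain s1 where s1: "0 < s1" "s1 powr (r - p) * (k * M) \<le> \<epsilon> / 2"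
    using ex_small_powr[of "k * M" "\<epsilon> / 2" "r - p"] k M \<epsilon> r by auto
  define C where "C = k * s1 powr (r - 1)"
  have C: "0 \<le> C" using k by (simp add: C_def)
  have out: "K x * \<bar>t\<bar> powr r \<le> \<delta> * (V x * \<bar>t\<bar>) + \<delta> * \<bar>t\<bar> powr p" if x: "\<rho> \<le> norm x" for x t
  proof -
    have "K x \<le> \<delta> * V x powr \<theta>" using \<rho>[OF x] V[of x] by (simp add: divide_less_eq)
    then have "K x * \<bar>t\<bar> powr r \<le> \<delta> * V x powr \<theta> * \<bar>t\<bar> powr r" by (rule mult_right_mono) simp
    also have "\<dots> = \<delta> * ((V x * \<bar>t\<bar>) powr \<theta> * (\<bar>t\<bar> powr p) powr (1 - \<theta>))"
      by (subst r_eq) (simp add: powr_mult powr_powr powr_add)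
    also have "\<dots> \<le> \<delta> * (V x * \<bar>t\<bar> + \<bar>t\<bar> powr p)"
    proof (rule mult_left_mono)
      \<comment> \<open>A substitute for Young's inequality: both factors are bounded by powers of
        the larger quantity, and the exponents add up to 1.\<close>
      let ?m = "max (V x * \<bar>t\<bar>) (\<bar>t\<bar> powr p)"
      have vt: "0 \<le> V x * \<bar>t\<bar>" using V[of x] by simp
      then have m: "0 \<le> ?m" by (rule max.coboundedI1)
      have "(V x * \<bar>t\<bar>) powr \<theta> * (\<bar>t\<bar> powr p) powr (1 - \<theta>) \<le> ?m powr \<theta> * ?m powr (1 - \<theta>)"
        using \<theta> V[of x] by (intro mult_mono powr_mono2) auto
      also have "\<dots> = ?m" using m by (simp flip: powr_add)
      also have "\<dots> \<le> V x * \<bar>t\<bar> + \<bar>t\<bar> powr p" using vt by simp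
      finally show "(V x * \<bar>t\<bar>) powr \<theta> * (\<bar>t\<bar> powr p) powr (1 - \<theta>) \<le> V x * \<bar>t\<bar> + \<bar>t\<bar> powr p" .
    qed (use \<delta> in simp)
    finally show ?thesis by (simp add: distrib_left)
  qed
  show "\<exists>R C. 0 \<le> C \<and> (\<forall>w\<in>borel_measurable borel.
     (\<integral>\<^sup>+x. ennreal (V x * \<bar>w x\<bar>) \<partial>lebesgue) \<le> ennreal M \<longrightarrow>
     (\<integral>\<^sup>+x. ennreal (\<bar>w x\<bar> powr p) \<partial>lebesgue) \<le> ennreal M \<longrightarrow>
     (\<integral>\<^sup>+x. ennreal (K x * \<bar>w x\<bar> powr r) \<partial>lebesgue)
       \<le> ennreal \<epsilon> + ennreal C * (\<integral>\<^sup>+x. indicator (ball 0 R) x * ennreal \<bar>w x\<bar> \<partial>lebesgue))"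
  proof (rule exI[of _ \<rho>], rule exI[of _ C], intro conjI C ballI impI)
    fix w :: "real ^ 'n \<Rightarrow> real"
    assume wb [measurable]: "w \<in> borel_measurable borel"
      and wV: "(\<integral>\<^sup>+x. ennreal (V x * \<bar>w x\<bar>) \<partial>lebesgue) \<le> ennreal M"
      and wp: "(\<integral>\<^sup>+x. ennreal (\<bar>w x\<bar> powr p) \<partial>lebesgue) \<le> ennreal M"
    have wl [measurable]: "w \<in> borel_measurable lebesgue" by (rule measurable_completion) simp
    have [measurable]: "ball 0 \<rho> \<in> sets (lebesgue :: (real ^ 'n) measure)" by simp
    have "(\<integral>\<^sup>+x. ennreal (K x * \<bar>w x\<bar> powr r) \<partial>lebesgue) \<le>
      (\<integral>\<^sup>+x. ennreal \<delta> * ennreal (V x * \<bar>w x\<bar>)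
         + ennreal \<delta> * ennreal (\<bar>w x\<bar> powr p)
         + ennreal (s1 powr (r - p) * k) * ennreal (\<bar>w x\<bar> powr p)
         + ennreal C * (indicator (ball 0 \<rho>) x * ennreal \<bar>w x\<bar>) \<partial>lebesgue)"
    proof (rule nn_integral_mono_AE, use k(2) in eventually_elim)
      case (elim x)
      let ?t = "\<bar>w x\<bar>"
      note K1 = K(1)[of x]
      consider "\<rho> \<le> norm x" | "s1 \<le> ?t" | "?t \<le> s1" "x \<in> ball 0 \<rho>" by fastforce
      then show ?case
      proof cases
        case 1
        have "ennreal (K x * ?t powr r) \<le> ennreal (\<delta> * (V x * ?t)) + ennreal (\<delta> * ?t powr p)"
          using out[OF 1, of "w x"] \<delta> V[of x] by (intro ennreal_le_add) auto
        also have "\<dots> = ennreal \<delta> * ennreal (V x * ?t) + ennreal \<delta> * ennreal (?t powr p)"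
          using \<delta> by (simp add: ennreal_mult')
        finally show ?thesis by (simp add: add_increasing2)
      next
        case 2
        have "K x * ?t powr r \<le> k * (s1 powr (r - p) * ?t powr p)"
          using elim K1 r 2 s1 by (intro mult_mono powr_le_large) auto
        also have "\<dots> = (s1 powr (r - p) * k) * ?t powr p" by simp
        finally have "ennreal (K x * ?t powr r) \<le> ennreal (s1 powr (r - p) * k) * ennreal (?t powr p)"
          using k by (subst ennreal_mult'[symmetric]) (auto intro: ennreal_leI)
        then show ?thesis by (simp add: add_increasing2 add_increasing)
      next
        case 3
        have "K x * ?t powr r \<le> k * (s1 powr (r - 1) * ?t)"
          using elim K1 r 3 by (intro mult_mono powr_le_small) auto
        then have "ennreal (K x * ?t powr r) \<le> ennreal C * ennreal ?t"
          using C by (subst ennreal_mult'[symmetric]) (auto intro: ennreal_leI simp: C_def mult.assoc)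
        then show ?thesis using 3 by (simp add: add_increasing)
      qed
    qed
    also have "\<dots> = ennreal \<delta> * (\<integral>\<^sup>+x. ennreal (V x * \<bar>w x\<bar>) \<partial>lebesgue)
         + ennreal \<delta> * (\<integral>\<^sup>+x. ennreal (\<bar>w x\<bar> powr p) \<partial>lebesgue)
         + ennreal (s1 powr (r - p) * k) * (\<integral>\<^sup>+x. ennreal (\<bar>w x\<bar> powr p) \<partial>lebesgue)
         + ennreal C * (\<integral>\<^sup>+x. indicator (ball 0 \<rho>) x * ennreal \<bar>w x\<bar> \<partial>lebesgue)"
      by (rule nn_integral_lin4) measurable
    also have "\<dots> \<le> ennreal \<delta> * ennreal M + ennreal \<delta> * ennreal M + ennreal (s1 powr (r - p) * k) * ennreal M
         + ennreal C * (\<integral>\<^sup>+x. indicator (ball 0 \<rho>) x * ennreal \<bar>w x\<bar> \<partial>lebesgue)"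
      by (intro add_mono mult_left_mono wV wp) auto
    also have "\<dots> = ennreal (\<delta> * M + \<delta> * M + s1 powr (r - p) * (k * M))
         + ennreal C * (\<integral>\<^sup>+x. indicator (ball 0 \<rho>) x * ennreal \<bar>w x\<bar> \<partial>lebesgue)"
      using k M \<delta> by (simp add: ennreal_mult[symmetric] ennreal_plus[symmetric] mult.assoc del: ennreal_plus)
    also have "\<dots> \<le> ennreal \<epsilon> + ennreal C * (\<integral>\<^sup>+x. indicator (ball 0 \<rho>) x * ennreal \<bar>w x\<bar> \<partial>lebesgue)"
      using \<delta>M s1(2) by (intro add_right_mono ennreal_leI) linarith
    finally show "(\<integral>\<^sup>+x. ennreal (K x * \<bar>w x\<bar> powr r) \<partial>lebesgue)
       \<le> ennreal \<epsilon> + ennreal C * (\<integral>\<^sup>+x. indicator (ball 0 \<rho>) x * ennreal \<bar>w x\<bar> \<partial>lebesgue)" .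
  qed
qed

section \<open>Seminorms, Borel representatives and scaling\<close>

lemma critical_exponent_gt_1: "2 \<le> N \<Longrightarrow> 1 < critical_exponent N"
  by (simp add: critical_exponent_def field_simps)

lemma EV_norm_nonneg:
  assumes "\<And>x. 0 < V x" shows "0 \<le> EV_norm V u"
proof -
  have "0 \<le> (LINT x | lebesgue. V x * \<bar>u x\<bar>)"
    using assms by (intro integral_nonneg_AE) (auto simp: less_imp_le)
  then show ?thesis
    unfolding EV_norm_def by (intro add_nonneg_nonneg real_of_ereal_pos total_variation_nonneg)
qed

lemma shift_bounded_mono: "shift_bounded M u \<Longrightarrow> M \<le> M' \<Longrightarrow> shift_bounded M' u"
  unfolding shift_bounded_def
  by (meson ennreal_leI mult_right_mono norm_ge_zero order_trans)

text \<open>Rests on |v| \<le> 1 + |v|^p. It is crude compared with Hoelder's inequality, but only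
  finiteness and uniform bounds on balls are drawn from it.\<close>

lemma nn_integral_ball_le_powr:
  fixes v :: "'a::euclidean_space \<Rightarrow> real"
  assumes [measurable]: "v \<in> borel_measurable borel" and p: "1 \<le> p"
  shows "(\<integral>\<^sup>+x. indicator (ball 0 R) x * ennreal \<bar>v x\<bar> \<partial>lborel)
    \<le> ennreal (measure lborel (ball (0::'a) R)) + (\<integral>\<^sup>+x. ennreal (\<bar>v x\<bar> powr p) \<partial>lborel)"
proof -
  have "(\<integral>\<^sup>+x. indicator (ball 0 R) x * ennreal \<bar>v x\<bar> \<partial>lborel)
    \<le> (\<integral>\<^sup>+x. indicator (ball 0 R) x + ennreal (\<bar>v x\<bar> powr p) \<partial>lborel)"
  proof (intro nn_integral_mono)
    fix x
    have "\<bar>v x\<bar> \<le> 1 + \<bar>v x\<bar> powr p"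
      using powr_le_large[of 1 "\<bar>v x\<bar>" 1 p] p by (cases "1 \<le> \<bar>v x\<bar>") (auto intro: add_increasing2)
    then have "ennreal \<bar>v x\<bar> \<le> ennreal 1 + ennreal (\<bar>v x\<bar> powr p)"
      by (intro ennreal_le_add) auto
    then show "indicator (ball 0 R) x * ennreal \<bar>v x\<bar> \<le> indicator (ball 0 R) x + ennreal (\<bar>v x\<bar> powr p)"
      by (auto simp: indicator_def)
  qed
  also have "\<dots> = emeasure lborel (ball (0::'a) R) + (\<integral>\<^sup>+x. ennreal (\<bar>v x\<bar> powr p) \<partial>lborel)"
    by (subst nn_integral_add) auto
  finally show ?thesis by (simp only: emeasure_lborel_ball_eq)
qed

text \<open>Members of the space are only Lebesgue measurable, while translations and Tonelli are
  handled for Borel functions on \<open>lborel\<close>. A single M bounds the variation and the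
  potential term at once because both are nonnegative.\<close>

lemma EV_representative:
  fixes V u :: "real ^ 'n::finite \<Rightarrow> real"
  assumes N: "2 \<le> CARD('n)" and V: "\<And>x. 0 < V x" and u: "u \<in> EV_space V" and M: "EV_norm V u \<le> M"
  shows "\<exists>v. loc_int v \<and> (AE x in lebesgue. u x = v x) \<and> shift_bounded M v \<and>
     (\<integral>\<^sup>+x. ennreal (\<bar>v x\<bar> powr critical_exponent CARD('n)) \<partial>lborel) < \<infinity> \<and>
     (\<integral>\<^sup>+x. ennreal (V x * \<bar>v x\<bar>) \<partial>lebesgue) \<le> ennreal M"
proof -
  define p where "p = critical_exponent CARD('n)"
  have p: "1 < p" unfolding p_def by (rule critical_exponent_gt_1[OF N])
  have um: "u \<in> borel_measurable lebesgue" and up: "integrable lebesgue (\<lambda>x. \<bar>u x\<bar> powr p)"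
    and tv: "total_variation u < \<infinity>" and uV: "integrable lebesgue (\<lambda>x. V x * \<bar>u x\<bar>)"
    using u by (auto simp: EV_space_def E_space_def p_def)
  obtain v where v [measurable]: "v \<in> borel_measurable borel" and "AE x in lborel. u x = v x"
    using completion_ex_borel_measurable_real[OF um] by auto
  then have uv: "AE x in lebesgue. u x = v x" by (simp add: AE_completion_iff)
  have "(\<integral>\<^sup>+x. ennreal (\<bar>v x\<bar> powr p) \<partial>lborel) = (\<integral>\<^sup>+x. ennreal (\<bar>v x\<bar> powr p) \<partial>lebesgue)"
    by (simp add: nn_integral_completion)
  also have "\<dots> = (\<integral>\<^sup>+x. ennreal (\<bar>u x\<bar> powr p) \<partial>lebesgue)"
    by (rule nn_integral_cong_AE, use uv in eventually_elim) simp
  also have "\<dots> < \<infinity>"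
    by (subst nn_integral_eq_integral[OF up]) auto
  finally have vp: "(\<integral>\<^sup>+x. ennreal (\<bar>v x\<bar> powr p) \<partial>lborel) < \<infinity>" .
  have li: "loc_int v"
    unfolding loc_int_def
  proof (intro conjI v allI)
    fix R
    show "(\<integral>\<^sup>+x. indicator (ball 0 R) x * ennreal \<bar>v x\<bar> \<partial>lborel) < \<infinity>"
      using p vp by (intro le_less_trans[OF nn_integral_ball_le_powr[OF v, of p]]) auto
  qed
  have T: "0 \<le> real_of_ereal (total_variation u)" by (simp add: real_of_ereal_pos total_variation_nonneg)
  have I: "0 \<le> (LINT x | lebesgue. V x * \<bar>u x\<bar>)"
    using V by (intro integral_nonneg_AE) (auto simp: less_imp_le)
  have sb: "shift_bounded M v"
    by (rule shift_bounded_mono[OF variation_translation[OF tv li uv um]]) (use M I in \<open>simp add: EV_norm_def\<close>)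
  have "(\<integral>\<^sup>+x. ennreal (V x * \<bar>v x\<bar>) \<partial>lebesgue) = (\<integral>\<^sup>+x. ennreal (V x * \<bar>u x\<bar>) \<partial>lebesgue)"
    by (rule nn_integral_cong_AE, use uv in eventually_elim) simp
  also have "\<dots> = ennreal (LINT x | lebesgue. V x * \<bar>u x\<bar>)"
    by (rule nn_integral_eq_integral[OF uV]) (use V in \<open>auto simp: less_imp_le\<close>)
  also have "\<dots> \<le> ennreal M" by (intro ennreal_leI) (use M T in \<open>simp add: EV_norm_def\<close>)
  finally show ?thesis using li uv sb vp unfolding p_def by blast
qed

lemma total_variation_AE_zero:
  assumes "AE x in lebesgue. u x = 0" shows "total_variation u = 0"
proof -
  have z: "(LINT x | lebesgue. u x * divergence \<phi> x) = 0" for \<phi>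
    by (rule integral_eq_zero_AE, use assms in eventually_elim) simp
  have "(\<lambda>x. 0) \<in> {\<phi> \<in> C1c_fields. \<forall>x. norm (\<phi> x) \<le> 1}" using zero_C1c by auto
  then show ?thesis unfolding total_variation_def z by (intro SUP_eq_const) (auto simp: zero_ereal_def)
qed

lemma total_variation_cmult_le:
  fixes u :: "real ^ 'n::finite \<Rightarrow> real"
  assumes "0 \<le> c" "total_variation u < \<infinity>"
  shows "total_variation (\<lambda>x. c * u x) \<le> ereal (c * real_of_ereal (total_variation u))"
  unfolding total_variation_def[of "\<lambda>x. c * u x"]
proof (rule SUP_least, safe)
  fix \<phi> :: "real ^ 'n \<Rightarrow> real ^ 'n" assume "\<phi> \<in> C1c_fields" "\<forall>x. norm (\<phi> x) \<le> 1"
  then have "(LINT x | lebesgue. u x * divergence \<phi> x) \<le> 1 * real_of_ereal (total_variation u)"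
    using assms by (intro total_variation_test) auto
  then have "c * (LINT x | lebesgue. u x * divergence \<phi> x) \<le> c * real_of_ereal (total_variation u)"
    using assms by (intro mult_left_mono) auto
  then show "ereal (LINT x | lebesgue. c * u x * divergence \<phi> x) \<le> ereal (c * real_of_ereal (total_variation u))"
    by (simp add: mult.assoc)
qed

text \<open>Serves to rescale a function into the unit ball of the seminorm, for which the upper
  bound on the norm is enough.\<close>

lemma EV_cmult:
  fixes V u :: "real ^ 'n::finite \<Rightarrow> real"
  assumes u: "u \<in> EV_space V" and c: "0 \<le> c"
  shows "(\<lambda>x. c * u x) \<in> EV_space V" "EV_norm V (\<lambda>x. c * u x) \<le> c * EV_norm V u"
proof -
  let ?p = "critical_exponent CARD('n)"
  have um [measurable]: "u \<in> borel_measurable lebesgue" and up: "integrable lebesgue (\<lambda>x. \<bar>u x\<bar> powr ?p)"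
    and tv: "total_variation u < \<infinity>" and uV: "integrable lebesgue (\<lambda>x. V x * \<bar>u x\<bar>)"
    using u by (auto simp: EV_space_def E_space_def)
  have tvc: "total_variation (\<lambda>x. c * u x) \<le> ereal (c * real_of_ereal (total_variation u))"
    by (rule total_variation_cmult_le[OF c tv])
  have eq: "(\<lambda>x. V x * \<bar>c * u x\<bar>) = (\<lambda>x. c * (V x * \<bar>u x\<bar>))" "(\<lambda>x. \<bar>c * u x\<bar> powr ?p) = (\<lambda>x. c powr ?p * \<bar>u x\<bar> powr ?p)"
    using c by (auto simp: abs_mult powr_mult)
  show "(\<lambda>x. c * u x) \<in> EV_space V"
    unfolding EV_space_def E_space_def using tvc up uV by (auto simp: eq le_less_trans)
  have "real_of_ereal (total_variation (\<lambda>x. c * u x)) \<le> c * real_of_ereal (total_variation u)"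
    using real_of_ereal_positive_mono[OF total_variation_nonneg tvc] by simp
  then show "EV_norm V (\<lambda>x. c * u x) \<le> c * EV_norm V u"
    unfolding EV_norm_def eq(1) by (simp add: distrib_left)
qed

lemma LK_norm_powr:
  assumes "\<And>x. 0 < K x" "0 < r" "u \<in> LK_space K r"
  shows "(\<integral>\<^sup>+x. ennreal (K x * \<bar>u x\<bar> powr r) \<partial>lebesgue) = ennreal (LK_norm K r u powr r)"
proof -
  have "0 \<le> (LINT x|lebesgue. K x * \<bar>u x\<bar> powr r)"
    using assms by (intro integral_nonneg_AE) (auto simp: less_imp_le)
  then have "LK_norm K r u powr r = (LINT x|lebesgue. K x * \<bar>u x\<bar> powr r)"
    using assms by (simp add: LK_norm_def powr_powr)
  then show ?thesis
    using assms by (subst nn_integral_eq_integral) (auto simp: LK_space_def less_imp_le)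
qed

lemma LK_spaceI:
  assumes "\<And>x. 0 < K x" and [measurable]: "K \<in> borel_measurable lebesgue" "u \<in> borel_measurable lebesgue"
    and "(\<integral>\<^sup>+x. ennreal (K x * \<bar>u x\<bar> powr r) \<partial>lebesgue) < \<infinity>"
  shows "u \<in> LK_space K r"
proof -
  have "integrable lebesgue (\<lambda>x. K x * \<bar>u x\<bar> powr r)"
    using assms(1,4) by (intro integrableI_nonneg) (auto simp: less_imp_le)
  then show ?thesis by (simp add: LK_space_def)
qed

lemma LK_norm_leI:
  assumes "\<And>x. 0 < K x" "0 < r" "u \<in> LK_space K r" "0 \<le> B"
    and "(\<integral>\<^sup>+x. ennreal (K x * \<bar>u x\<bar> powr r) \<partial>lebesgue) \<le> ennreal (B powr r)"
  shows "LK_norm K r u \<le> B"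
proof (rule ccontr)
  assume "\<not> ?thesis"
  then have "B powr r < LK_norm K r u powr r" using assms by (intro powr_less_mono2) auto
  moreover have "LK_norm K r u powr r \<le> B powr r"
    using assms(5) unfolding LK_norm_powr[OF assms(1-3)] by simp
  ultimately show False by simp
qed

text \<open>The Sobolev inequality turns a bound on the norm into one on the p-th powers, so a
  bounded sequence and its differences meet the premises of the tail estimate with fixed constants.
  The estimate with \<epsilon> = 1 gives boundedness of the inclusion; with small \<epsilon>, and
  convergence in mean on balls, it gives a Cauchy sequence in the weighted space.\<close>

lemma compactly_embedded_of_tail_controlled:
  fixes V K :: "real ^ 'n::finite \<Rightarrow> real"
  assumes N: "2 \<le> CARD('n)" and Vm [measurable]: "V \<in> borel_measurable lebesgue" and V: "\<And>x. 0 < V x"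
    and K: "\<And>x. 0 < K x" "continuous_on UNIV K" and r: "1 < r"
    and tail: "tail_controlled V K (critical_exponent CARD('n)) r"
  shows "compactly_embedded (EV_space V) (EV_norm V) (LK_space K r) (LK_norm K r)"
proof -
  define p where "p = critical_exponent CARD('n)"
  have p: "1 < p" unfolding p_def by (rule critical_exponent_gt_1[OF N])
  have Kb [measurable]: "K \<in> borel_measurable borel" using K(2) by (rule borel_measurable_continuous_onI)
  have Kl [measurable]: "K \<in> borel_measurable lebesgue" by (rule measurable_completion) simp
  have r0: "0 < r" using r by simp
  obtain C0 where C0: "0 \<le> C0" and sob: "\<And>u M. shift_bounded M u \<Longrightarrow> (\<integral>\<^sup>+x. ennreal (\<bar>u x\<bar> powr p) \<partial>lborel) < \<infinity> \<Longrightarrow>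
      (\<integral>\<^sup>+x. ennreal (\<bar>(u :: real ^ 'n \<Rightarrow> real) x\<bar> powr p) \<partial>lborel) \<le> ennreal (C0 * M powr p)"
    using shift_sobolev[where 'a="real ^ 'n"] N unfolding p_def critical_exponent_def by auto
  note rep = EV_representative[OF N V, folded p_def]
  have tailD: "\<exists>R C. 0 \<le> C \<and> (\<forall>w\<in>borel_measurable borel.
     (\<integral>\<^sup>+x. ennreal (V x * \<bar>w x\<bar>) \<partial>lebesgue) \<le> ennreal M \<longrightarrow>
     (\<integral>\<^sup>+x. ennreal (\<bar>w x\<bar> powr p) \<partial>lborel) \<le> ennreal M \<longrightarrow>
     (\<integral>\<^sup>+x. ennreal (K x * \<bar>w x\<bar> powr r) \<partial>lborel)
       \<le> ennreal \<epsilon> + ennreal C * (\<integral>\<^sup>+x. indicator (ball 0 R) x * ennreal \<bar>w x\<bar> \<partial>lborel))"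
    if "0 \<le> M" "0 < \<epsilon>" for M \<epsilon>
    using tail that unfolding tail_controlled_def p_def[symmetric] nn_integral_completion by blast
  have unif: "\<exists>B\<ge>0. \<forall>u\<in>EV_space V. EV_norm V u \<le> M \<longrightarrow> (\<integral>\<^sup>+x. ennreal (K x * \<bar>u x\<bar> powr r) \<partial>lebesgue) \<le> ennreal B"
    if M: "0 \<le> M" for M
  proof -
    \<comment> \<open>One constant for both premises of the tail estimate: M for the potential term
      and C0 M^p for the critical power.\<close>
    define M' where "M' = max M (C0 * M powr p)"
    have "0 \<le> M'" using M by (simp add: M'_def)
    from tailD[OF this, of 1] obtain R C where C: "0 \<le> C" and RC: "\<And>w. w\<in>borel_measurable borel \<Longrightarrow>
     (\<integral>\<^sup>+x. ennreal (V x * \<bar>w x\<bar>) \<partial>lebesgue) \<le> ennreal M' \<Longrightarrow>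
     (\<integral>\<^sup>+x. ennreal (\<bar>w x\<bar> powr p) \<partial>lborel) \<le> ennreal M' \<Longrightarrow>
     (\<integral>\<^sup>+x. ennreal (K x * \<bar>w x\<bar> powr r) \<partial>lborel)
       \<le> ennreal 1 + ennreal C * (\<integral>\<^sup>+x. indicator (ball 0 R) x * ennreal \<bar>w x\<bar> \<partial>lborel)" by auto
    define b where "b = measure lborel (ball (0 :: real ^ 'n) R)"
    have "(\<integral>\<^sup>+x. ennreal (K x * \<bar>u x\<bar> powr r) \<partial>lebesgue) \<le> ennreal (1 + C * (b + M'))"
      if u: "u \<in> EV_space V" "EV_norm V u \<le> M" for u
    proof -
      obtain v where v: "loc_int v" "AE x in lebesgue. u x = v x" "shift_bounded M v"
        "(\<integral>\<^sup>+x. ennreal (\<bar>v x\<bar> powr p) \<partial>lborel) < \<infinity>" "(\<integral>\<^sup>+x. ennreal (V x * \<bar>v x\<bar>) \<partial>lebesgue) \<le> ennreal M"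
        using rep[OF u] by blast
      have vb: "v \<in> borel_measurable borel" using v(1) by (simp add: loc_int_def)
      have vp: "(\<integral>\<^sup>+x. ennreal (\<bar>v x\<bar> powr p) \<partial>lborel) \<le> ennreal M'"
        using sob[OF v(3,4)] by (rule order_trans) (simp add: M'_def ennreal_leI)
      have vV: "(\<integral>\<^sup>+x. ennreal (V x * \<bar>v x\<bar>) \<partial>lebesgue) \<le> ennreal M'"
        using v(5) by (rule order_trans) (simp add: M'_def ennreal_leI)
      have "(\<integral>\<^sup>+x. ennreal (K x * \<bar>u x\<bar> powr r) \<partial>lebesgue) = (\<integral>\<^sup>+x. ennreal (K x * \<bar>v x\<bar> powr r) \<partial>lebesgue)"
        by (rule nn_integral_cong_AE, use v(2) in eventually_elim) simp
      also have "\<dots> = (\<integral>\<^sup>+x. ennreal (K x * \<bar>v x\<bar> powr r) \<partial>lborel)" by (rule nn_integral_completion)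
      also have "\<dots> \<le> ennreal 1 + ennreal C * (\<integral>\<^sup>+x. indicator (ball 0 R) x * ennreal \<bar>v x\<bar> \<partial>lborel)"
        by (rule RC[OF vb vV vp])
      also have "\<dots> \<le> ennreal 1 + ennreal C * (ennreal b + ennreal M')"
        unfolding b_def using p
        by (intro add_left_mono mult_left_mono order_trans[OF nn_integral_ball_le_powr[OF vb, of p]] vp) auto
      also have "\<dots> = ennreal (1 + C * (b + M'))"
        using C \<open>0 \<le> M'\<close> by (simp add: b_def ennreal_plus[symmetric] ennreal_mult[symmetric] del: ennreal_plus ennreal_1)
      finally show ?thesis .
    qed
    moreover have "0 \<le> 1 + C * (b + M')" using C \<open>0 \<le> M'\<close> by (simp add: b_def)
    ultimately show ?thesis by blast
  qed
  have um: "u \<in> borel_measurable lebesgue" if "u \<in> EV_space V" for u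
    using that by (simp add: EV_space_def E_space_def)
  have sub: "u \<in> LK_space K r" if u: "u \<in> EV_space V" for u
  proof -
    obtain B where "(\<integral>\<^sup>+x. ennreal (K x * \<bar>u x\<bar> powr r) \<partial>lebesgue) \<le> ennreal B"
      using unif[of "EV_norm V u"] u EV_norm_nonneg[of V u] V by blast
    then have "(\<integral>\<^sup>+x. ennreal (K x * \<bar>u x\<bar> powr r) \<partial>lebesgue) < \<infinity>" by (simp add: le_less_trans)
    then show ?thesis by (intro LK_spaceI K Kl um u)
  qed
  have ker: "EV_norm V u = 0" if u: "u \<in> EV_space V" and z: "LK_norm K r u = 0" for u
  proof -
    note um[OF u, measurable]
    have "(\<integral>\<^sup>+x. ennreal (K x * \<bar>u x\<bar> powr r) \<partial>lebesgue) = 0"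
      using LK_norm_powr[OF K(1) r0 sub[OF u]] z by simp
    then have "AE x in lebesgue. ennreal (K x * \<bar>u x\<bar> powr r) = 0"
      by (subst (asm) nn_integral_0_iff_AE) auto
    then have uz: "AE x in lebesgue. u x = 0"
    proof eventually_elim
      case (elim x)
      then have "K x * \<bar>u x\<bar> powr r \<le> 0" by (simp add: ennreal_eq_0_iff)
      then show ?case using K(1)[of x] by (simp add: mult_le_0_iff)
    qed
    have "(LINT x | lebesgue. V x * \<bar>u x\<bar>) = 0"
      by (rule integral_eq_zero_AE, use uz in eventually_elim) simp
    then show ?thesis by (simp add: EV_norm_def total_variation_AE_zero[OF uz])
  qed
  have bound: "\<exists>C. \<forall>u\<in>EV_space V. LK_norm K r u \<le> C * EV_norm V u"
  proof -
    obtain B where B: "0 \<le> B" "\<And>u. u \<in> EV_space V \<Longrightarrow> EV_norm V u \<le> 1 \<Longrightarrow>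
       (\<integral>\<^sup>+x. ennreal (K x * \<bar>u x\<bar> powr r) \<partial>lebesgue) \<le> ennreal B" using unif[of 1] by auto
    \<comment> \<open>The r-th root of the bound on the unit ball; B + 1 in place of B keeps D
      positive, so that e / D below makes sense.\<close>
    define D where "D = (B + 1) powr (1 / r)"
    have D: "0 < D" "B \<le> D powr r" using B(1) r0 by (auto simp: D_def powr_powr)
    have "LK_norm K r u \<le> D * EV_norm V u" if u: "u \<in> EV_space V" for u
    proof (rule field_le_epsilon)
      fix e :: real assume e: "0 < e"
      \<comment> \<open>Slightly above the norm, so that dividing by t is possible even when the
        norm is 0; the surplus e / D costs exactly e after multiplication by D.\<close>
      define t where "t = EV_norm V u + e / D"
      have t: "0 < t" "EV_norm V u \<le> t"
        using e D EV_norm_nonneg[of V u] V by (auto simp: t_def add_nonneg_pos)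
      define w where "w = (\<lambda>x. (1 / t) * u x)"
      have w: "w \<in> EV_space V" "EV_norm V w \<le> (1 / t) * EV_norm V u"
        unfolding w_def by (rule EV_cmult[OF u]; use t in simp)+
      have "(1 / t) * EV_norm V u \<le> 1" using t by simp
      then have "EV_norm V w \<le> 1" using w(2) by linarith
      then have wB: "(\<integral>\<^sup>+x. ennreal (K x * \<bar>w x\<bar> powr r) \<partial>lebesgue) \<le> ennreal B" by (rule B(2)[OF w(1)])
      note um[OF w(1), measurable]
      have "(\<integral>\<^sup>+x. ennreal (K x * \<bar>u x\<bar> powr r) \<partial>lebesgue) = (\<integral>\<^sup>+x. ennreal (t powr r) * ennreal (K x * \<bar>w x\<bar> powr r) \<partial>lebesgue)"
      proof (intro nn_integral_cong)
        fix x
        have "\<bar>u x\<bar> = t * \<bar>w x\<bar>" using t by (simp add: w_def abs_mult)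
        then have "K x * \<bar>u x\<bar> powr r = t powr r * (K x * \<bar>w x\<bar> powr r)" by (simp add: powr_mult)
        then show "ennreal (K x * \<bar>u x\<bar> powr r) = ennreal (t powr r) * ennreal (K x * \<bar>w x\<bar> powr r)"
          by (simp only: ennreal_mult' powr_ge_zero)
      qed
      also have "\<dots> = ennreal (t powr r) * (\<integral>\<^sup>+x. ennreal (K x * \<bar>w x\<bar> powr r) \<partial>lebesgue)"
        by (rule nn_integral_cmult) measurable
      also have "\<dots> \<le> ennreal (t powr r) * ennreal (D powr r)"
        using order_trans[OF wB ennreal_leI[OF D(2)]] by (intro mult_left_mono) auto
      also have "\<dots> = ennreal ((D * t) powr r)"
        by (simp add: powr_mult ennreal_mult[symmetric] mult.commute)
      finally have "LK_norm K r u \<le> D * t"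
        using D t by (intro LK_norm_leI[OF K(1) r0 sub[OF u]]) auto
      then show "LK_norm K r u \<le> D * EV_norm V u + e" using D by (simp add: t_def distrib_left)
    qed
    then show ?thesis by blast
  qed
  have compact: "\<exists>l\<in>LK_space K r. \<exists>\<sigma> :: nat \<Rightarrow> nat. strict_mono \<sigma> \<and> (\<lambda>k. LK_norm K r (\<lambda>x. u (\<sigma> k) x - l x)) \<longlonglongrightarrow> 0"
    if u: "\<And>n. u n \<in> EV_space V" and M: "\<And>n. EV_norm V (u n) \<le> M" for u :: "nat \<Rightarrow> real ^ 'n \<Rightarrow> real" and M
  proof -
    have M0: "0 \<le> M" using order_trans[OF EV_norm_nonneg[OF V] M[of 0]] .
    have "\<exists>v. \<forall>n. loc_int (v n) \<and> (AE x in lebesgue. u n x = v n x) \<and> shift_bounded M (v n) \<and>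
     (\<integral>\<^sup>+x. ennreal (\<bar>v n x\<bar> powr p) \<partial>lborel) < \<infinity> \<and> (\<integral>\<^sup>+x. ennreal (V x * \<bar>v n x\<bar>) \<partial>lebesgue) \<le> ennreal M"
      using rep[OF u M] by (intro choice) blast
    then obtain v where v: "\<And>n. loc_int (v n)" "\<And>n. AE x in lebesgue. u n x = v n x" "\<And>n. shift_bounded M (v n)"
        "\<And>n. (\<integral>\<^sup>+x. ennreal (\<bar>v n x\<bar> powr p) \<partial>lborel) < \<infinity>" "\<And>n. (\<integral>\<^sup>+x. ennreal (V x * \<bar>v n x\<bar>) \<partial>lebesgue) \<le> ennreal M"
      by blast
    have vb [measurable]: "v n \<in> borel_measurable borel" for n using v(1) by (simp add: loc_int_def)
    have vl [measurable]: "v n \<in> borel_measurable lebesgue" for n by (rule measurable_completion) simp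
    have "\<exists>B. \<forall>n. (\<integral>\<^sup>+x. indicator (ball 0 R) x * ennreal \<bar>v n x\<bar> \<partial>lborel) \<le> ennreal B" for R
    proof (intro exI allI)
      fix n
      have "(\<integral>\<^sup>+x. indicator (ball 0 R) x * ennreal \<bar>v n x\<bar> \<partial>lborel)
        \<le> ennreal (measure lborel (ball (0 :: real ^ 'n) R)) + ennreal (C0 * M powr p)"
        using p by (intro order_trans[OF nn_integral_ball_le_powr[OF vb, of p]] add_left_mono sob v) auto
      also have "\<dots> = ennreal (measure lborel (ball (0 :: real ^ 'n) R) + C0 * M powr p)"
        using C0 by (subst ennreal_plus) auto
      finally show "(\<integral>\<^sup>+x. indicator (ball 0 R) x * ennreal \<bar>v n x\<bar> \<partial>lborel)
        \<le> ennreal (measure lborel (ball (0 :: real ^ 'n) R) + C0 * M powr p)" .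
    qed
    from shift_compact[OF v(3) this] obtain \<sigma> :: "nat \<Rightarrow> nat" where \<sigma>: "strict_mono \<sigma>"
      and loc: "\<And>R e. 0 < e \<Longrightarrow> \<exists>n0. \<forall>m\<ge>n0. \<forall>n\<ge>n0.
       (\<integral>\<^sup>+x. indicator (ball 0 R) x * ennreal \<bar>v (\<sigma> m) x - v (\<sigma> n) x\<bar> \<partial>lborel) \<le> ennreal e" by blast
    have Cauchy: "\<exists>n0. \<forall>m\<ge>n0. \<forall>n\<ge>n0. (\<integral>\<^sup>+x. ennreal (K x * \<bar>v (\<sigma> m) x - v (\<sigma> n) x\<bar> powr r) \<partial>lborel) \<le> ennreal e"
      if e: "0 < e" for e
    proof -
      define M' where "M' = max (M + M) (C0 * (M + M) powr p)"
      have "0 \<le> M'" using M0 by (simp add: M'_def)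
      from tailD[OF this, of "e / 2"] e obtain R C where C: "0 \<le> C" and RC: "\<And>w. w\<in>borel_measurable borel \<Longrightarrow>
       (\<integral>\<^sup>+x. ennreal (V x * \<bar>w x\<bar>) \<partial>lebesgue) \<le> ennreal M' \<Longrightarrow>
       (\<integral>\<^sup>+x. ennreal (\<bar>w x\<bar> powr p) \<partial>lborel) \<le> ennreal M' \<Longrightarrow>
       (\<integral>\<^sup>+x. ennreal (K x * \<bar>w x\<bar> powr r) \<partial>lborel)
         \<le> ennreal (e / 2) + ennreal C * (\<integral>\<^sup>+x. indicator (ball 0 R) x * ennreal \<bar>w x\<bar> \<partial>lborel)" by auto
      have "0 < e / (2 * (C + 1))" using e C by simp
      from loc[OF this, of R] obtain n0 where n0: "\<And>m n. m \<ge> n0 \<Longrightarrow> n \<ge> n0 \<Longrightarrow>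
        (\<integral>\<^sup>+x. indicator (ball 0 R) x * ennreal \<bar>v (\<sigma> m) x - v (\<sigma> n) x\<bar> \<partial>lborel) \<le> ennreal (e / (2 * (C + 1)))" by blast
      have "(\<integral>\<^sup>+x. ennreal (K x * \<bar>v (\<sigma> m) x - v (\<sigma> n) x\<bar> powr r) \<partial>lborel) \<le> ennreal e"
        if mn: "m \<ge> n0" "n \<ge> n0" for m n
      proof -
        let ?w = "\<lambda>x. v (\<sigma> m) x - v (\<sigma> n) x"
        have wb: "?w \<in> borel_measurable borel" by measurable
        have "(\<integral>\<^sup>+x. ennreal (V x * \<bar>?w x\<bar>) \<partial>lebesgue) \<le> (\<integral>\<^sup>+x. ennreal (V x * \<bar>v (\<sigma> m) x\<bar>) + ennreal (V x * \<bar>v (\<sigma> n) x\<bar>) \<partial>lebesgue)"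
        proof (intro nn_integral_mono ennreal_le_add)
          fix x
          show "V x * \<bar>?w x\<bar> \<le> V x * \<bar>v (\<sigma> m) x\<bar> + V x * \<bar>v (\<sigma> n) x\<bar>"
            unfolding distrib_left[symmetric] using V[of x] by (intro mult_left_mono) auto
        qed (use V in \<open>auto simp: less_imp_le\<close>)
        also have "\<dots> = (\<integral>\<^sup>+x. ennreal (V x * \<bar>v (\<sigma> m) x\<bar>) \<partial>lebesgue) + (\<integral>\<^sup>+x. ennreal (V x * \<bar>v (\<sigma> n) x\<bar>) \<partial>lebesgue)"
          by (rule nn_integral_add) measurable
        also have "\<dots> \<le> ennreal M + ennreal M" by (intro add_mono v)
        also have "\<dots> = ennreal (M + M)" by (rule ennreal_plus[OF M0 M0, symmetric])
        also have "\<dots> \<le> ennreal M'" by (intro ennreal_leI) (simp add: M'_def)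
        finally have wV: "(\<integral>\<^sup>+x. ennreal (V x * \<bar>?w x\<bar>) \<partial>lebesgue) \<le> ennreal M'" .
        \<comment> \<open>The crude power inequality only shows that this integral is finite, the
          premise of the Sobolev inequality; the bound itself comes from that inequality applied to
          the difference, with shift constant M + M.\<close>
        have "(\<integral>\<^sup>+x. ennreal (\<bar>?w x\<bar> powr p) \<partial>lborel) \<le>
           (\<integral>\<^sup>+x. ennreal (2 powr p) * (ennreal (\<bar>v (\<sigma> m) x\<bar> powr p) + ennreal (\<bar>v (\<sigma> n) x\<bar> powr p)) \<partial>lborel)"
          using abs_diff_powr_le[of p] p
          by (intro nn_integral_mono) (simp add: ennreal_plus[symmetric] ennreal_mult[symmetric] ennreal_leI del: ennreal_plus)
        also have "\<dots> = ennreal (2 powr p) * ((\<integral>\<^sup>+x. ennreal (\<bar>v (\<sigma> m) x\<bar> powr p) \<partial>lborel) + (\<integral>\<^sup>+x. ennreal (\<bar>v (\<sigma> n) x\<bar> powr p) \<partial>lborel))"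
          by (simp add: nn_integral_cmult nn_integral_add)
        also have "\<dots> < \<infinity>" using v(4) by (simp add: ennreal_mult_less_top)
        finally have "(\<integral>\<^sup>+x. ennreal (\<bar>?w x\<bar> powr p) \<partial>lborel) \<le> ennreal (C0 * (M + M) powr p)"
          by (intro sob shift_bounded_diff v)
        also have "\<dots> \<le> ennreal M'" by (intro ennreal_leI) (simp add: M'_def)
        finally have wp: "(\<integral>\<^sup>+x. ennreal (\<bar>?w x\<bar> powr p) \<partial>lborel) \<le> ennreal M'" .
        have "(\<integral>\<^sup>+x. ennreal (K x * \<bar>?w x\<bar> powr r) \<partial>lborel)
          \<le> ennreal (e / 2) + ennreal C * (\<integral>\<^sup>+x. indicator (ball 0 R) x * ennreal \<bar>?w x\<bar> \<partial>lborel)"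
          by (rule RC[OF wb wV wp])
        also have "\<dots> \<le> ennreal (e / 2) + ennreal C * ennreal (e / (2 * (C + 1)))"
          by (intro add_left_mono mult_left_mono n0 mn) auto
        also have "\<dots> = ennreal (e / 2 + C * (e / (2 * (C + 1))))"
          using C e by (simp add: ennreal_plus[symmetric] ennreal_mult[symmetric] del: ennreal_plus)
        also have "\<dots> \<le> ennreal e"
        proof (intro ennreal_leI)
          have "C * (e / (2 * (C + 1))) = (e / 2) * (C / (C + 1))" by simp
          also have "\<dots> \<le> (e / 2) * 1" using C e by (intro mult_left_mono) (auto simp: divide_le_eq_1)
          finally have "C * (e / (2 * (C + 1))) \<le> e / 2" by (simp only: mult_1_right)
          from add_left_mono[OF this, of "e / 2"] show "e / 2 + C * (e / (2 * (C + 1))) \<le> e"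
            by (simp only: field_sum_of_halves)
        qed
        finally show ?thesis .
      qed
      then show ?thesis by blast
    qed
    have "K \<in> borel_measurable lborel" "\<And>n. v (\<sigma> n) \<in> borel_measurable lborel" by simp_all
    then obtain l where lb: "l \<in> borel_measurable lborel"
      and lim: "\<And>e. 0 < e \<Longrightarrow> \<exists>n0. \<forall>n\<ge>n0. (\<integral>\<^sup>+x. ennreal (K x * \<bar>v (\<sigma> n) x - l x\<bar> powr r) \<partial>lborel) \<le> ennreal e"
      using weighted_complete[of "\<lambda>n. v (\<sigma> n)" lborel K r] K(1) r0 Cauchy by blast
    have [measurable]: "l \<in> borel_measurable lebesgue" using lb by (rule measurable_completion)
    note um[OF u, measurable]
    have eq: "(\<integral>\<^sup>+x. ennreal (K x * \<bar>u (\<sigma> n) x - l x\<bar> powr r) \<partial>lebesgue) = (\<integral>\<^sup>+x. ennreal (K x * \<bar>v (\<sigma> n) x - l x\<bar> powr r) \<partial>lborel)" for n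
      unfolding nn_integral_completion[of lborel, symmetric]
      by (rule nn_integral_cong_AE, use v(2)[of "\<sigma> n"] in eventually_elim) simp
    obtain n1 where n1: "(\<integral>\<^sup>+x. ennreal (K x * \<bar>u (\<sigma> n1) x - l x\<bar> powr r) \<partial>lebesgue) \<le> ennreal 1"
      using lim[of 1] unfolding eq by auto
    have lL: "l \<in> LK_space K r"
    proof (rule LK_spaceI[OF K(1) Kl])
      \<comment> \<open>l is the difference of u and u - l for one member u of the subsequence
        within weighted distance 1 (in r-th powers), and both have finite weighted
        integrals.\<close>
      have "(\<integral>\<^sup>+x. ennreal (K x * \<bar>l x\<bar> powr r) \<partial>lebesgue) \<le>
         (\<integral>\<^sup>+x. ennreal (2 powr r) * (ennreal (K x * \<bar>u (\<sigma> n1) x\<bar> powr r) + ennreal (K x * \<bar>u (\<sigma> n1) x - l x\<bar> powr r)) \<partial>lebesgue)"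
      proof (intro nn_integral_mono)
        fix x
        have "\<bar>l x\<bar> powr r \<le> 2 powr r * (\<bar>u (\<sigma> n1) x\<bar> powr r + \<bar>u (\<sigma> n1) x - l x\<bar> powr r)"
          using abs_diff_powr_le[of r "u (\<sigma> n1) x" "u (\<sigma> n1) x - l x"] r0 by simp
        then have "K x * \<bar>l x\<bar> powr r \<le> K x * (2 powr r * (\<bar>u (\<sigma> n1) x\<bar> powr r + \<bar>u (\<sigma> n1) x - l x\<bar> powr r))"
          using K(1)[of x] by (intro mult_left_mono) auto
        then have "K x * \<bar>l x\<bar> powr r \<le> 2 powr r * (K x * \<bar>u (\<sigma> n1) x\<bar> powr r + K x * \<bar>u (\<sigma> n1) x - l x\<bar> powr r)"
          by (simp add: algebra_simps)
        then show "ennreal (K x * \<bar>l x\<bar> powr r) \<le>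
          ennreal (2 powr r) * (ennreal (K x * \<bar>u (\<sigma> n1) x\<bar> powr r) + ennreal (K x * \<bar>u (\<sigma> n1) x - l x\<bar> powr r))"
          using K(1)[of x] by (simp add: ennreal_plus[symmetric] ennreal_mult[symmetric] ennreal_leI less_imp_le del: ennreal_plus)
      qed
      also have "\<dots> = ennreal (2 powr r) * ((\<integral>\<^sup>+x. ennreal (K x * \<bar>u (\<sigma> n1) x\<bar> powr r) \<partial>lebesgue) + (\<integral>\<^sup>+x. ennreal (K x * \<bar>u (\<sigma> n1) x - l x\<bar> powr r) \<partial>lebesgue))"
        by (simp add: nn_integral_cmult nn_integral_add)
      also have "\<dots> < \<infinity>"
        using LK_norm_powr[OF K(1) r0 sub[OF u]] le_less_trans[OF n1] by (simp add: ennreal_mult_less_top)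
      finally show "(\<integral>\<^sup>+x. ennreal (K x * \<bar>l x\<bar> powr r) \<partial>lebesgue) < \<infinity>" .
    qed measurable
    have "(\<lambda>k. LK_norm K r (\<lambda>x. u (\<sigma> k) x - l x)) \<longlonglongrightarrow> 0"
    proof (rule LIMSEQ_I)
      fix e :: real assume e: "0 < e"
      then have "0 < (e / 2) powr r" by simp
      from lim[OF this] obtain n0 where n0: "\<And>n. n \<ge> n0 \<Longrightarrow>
        (\<integral>\<^sup>+x. ennreal (K x * \<bar>u (\<sigma> n) x - l x\<bar> powr r) \<partial>lebesgue) \<le> ennreal ((e / 2) powr r)" unfolding eq by blast
      have "norm (LK_norm K r (\<lambda>x. u (\<sigma> n) x - l x) - 0) < e" if n: "n \<ge> n0" for n
      proof -
        have "(\<lambda>x. u (\<sigma> n) x - l x) \<in> LK_space K r"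
          using n0[OF n] by (intro LK_spaceI[OF K(1) Kl]) (auto simp: le_less_trans)
        then have "LK_norm K r (\<lambda>x. u (\<sigma> n) x - l x) \<le> e / 2"
          using n0[OF n] e by (intro LK_norm_leI[OF K(1) r0]) auto
        moreover have "0 \<le> LK_norm K r (\<lambda>x. u (\<sigma> n) x - l x)" by (simp add: LK_norm_def)
        ultimately show ?thesis using e by simp
      qed
      then show "\<exists>n0. \<forall>n\<ge>n0. norm (LK_norm K r (\<lambda>x. u (\<sigma> n) x - l x) - 0) < e" by blast
    qed
    then show ?thesis using lL \<sigma> by blast
  qed
  show ?thesis
    unfolding compactly_embedded_def using sub ker bound compact by blast
qed

theorem proposition2p6:
  fixes V K :: "real ^ 'n::finite \<Rightarrow> real"
  assumes "CARD('n) \<ge> 2"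
    and "(V, K) \<in> VK_class"
  shows "(VK2 V K \<longrightarrow>
            (\<forall>r. 1 < r \<and> r < critical_exponent CARD('n) \<longrightarrow>
               compactly_embedded (EV_space V) (EV_norm V) (LK_space K r) (LK_norm K r))) \<and>
         (\<forall>q. VK3 V K q \<longrightarrow>
            compactly_embedded (EV_space V) (EV_norm V) (LK_space K q) (LK_norm K q))"
proof -
  have Vm: "V \<in> borel_measurable lebesgue" and V: "\<And>x. 0 < V x" and K: "\<And>x. 0 < K x" "continuous_on UNIV K"
    and "ess_bounded K" and VK1: "VK1 K"
    using assms(2) by (auto simp: VK_class_def VK0_def)
  then obtain k0 where k0: "AE x in lebesgue. \<bar>K x\<bar> \<le> k0" by (auto simp: ess_bounded_def)
  show ?thesis
  proof (intro conjI impI allI)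
    fix r assume "VK2 V K" and r: "1 < r \<and> r < critical_exponent CARD('n)"
    show "compactly_embedded (EV_space V) (EV_norm V) (LK_space K r) (LK_norm K r)"
      using r by (intro compactly_embedded_of_tail_controlled[OF assms(1) Vm V K]
        tail_controlled_VK2[OF Vm V K k0 VK1 \<open>VK2 V K\<close>]) auto
  next
    fix q assume q: "VK3 V K q"
    then have "1 < q" by (simp add: VK3_def)
    then show "compactly_embedded (EV_space V) (EV_norm V) (LK_space K q) (LK_norm K q)"
      by (intro compactly_embedded_of_tail_controlled[OF assms(1) Vm V K]
        tail_controlled_VK3[OF Vm V K k0 q])
  qed
qed

end
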